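(* Consider a $p$-type general (Crump–Mode–Jagers) branching process with reproduction point processes $\boldsymbol{\xi}=(\xi^{i,j})_{i,j=1,\dots,p}$ and matrix of intensity measures $\boldsymbol{\mu}=(\mu^{i,j})_{i,j=1,\dots,p}$, where the $\mu^{i,j}$ are locally finite and $\boldsymbol{\mu}$ is non-lattice. Let $\vartheta\in\mathbb{R}$ lie in the interior of $\mathcal{D}(\mathcal{L}\boldsymbol{\mu})$, suppose that the spectral radius of the matrix $\boldsymbol{\mu}(0)=(\mu^{i,j}(\{0\}))_{i,j}$ is strictly smaller than $1$, and suppose that $$\sup_{\eta\in\mathbb{R}}\big\|(\mathbf{I}_p-\mathcal{L}\boldsymbol{\mu}(\vartheta+\mathrm{i}\eta))^{-1}\big\|<\infty$$ (in particular, all these inverses exist). Further, suppose that $\Lambda_\vartheta$ is finite. Let $M(t)=(\mathbf{E}^i[N_t^j])_{i,j=1,\dots,p}$, where $\mathbf{E}^i[N_t^j]$ is the expected number of individuals of type $j$ born up to and including time $t$ given that the ancestor's type is $i$. Then there exist matrices $C_{\lambda,k}\in\mathbb{C}^{p\times p}$, $k=0,\dots,\mathtt{k}(\lambda)-1$, $\lambda\in\Lambda_\vartheta$, and $C_{0,\mathtt{k}(0)}\in\mathbb{C}^{p\times p}$ such that $$M(t)=\sum_{\lambda\in\Lambda_\vartheta}e^{\lambda t}\sum_{k=0}^{\mathtt{k}(\lambda)-1}t^kC_{\lambda,k}+t^{\mathtt{k}(0)}C_{0,\mathtt{k}(0)}+O(te^{\vartheta t})\quad\text{as }t\to\infty,$$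 where the error bound applies entrywise.
   Context: The branching process: there are $p\in\mathbb{N}$ types. The process starts with one ancestor $\varnothing$ born at time $S(\varnothing)=0$ with type $\tau(\varnothing)\in\{1,\dots,p\}$. Individuals are labelled by $u\in\bigcup_{n\ge0}\mathbb{N}^n$. The $\boldsymbol{\xi}_u=(\xi_u^{i,j})_{i,j}$ are i.i.d. copies of a $p\times p$ matrix $\boldsymbol{\xi}$ of point processes (random locally finite point measures) on $[0,\infty)$, independent of $\tau(\varnothing)$. An individual $u$ of type $i$ born at time $S(u)$ produces children of type $j$ at the times $S(u)+x$, $x$ ranging over the points of $\xi_u^{i,j}$, $j=1,\dots,p$ (with multiplicity). $\mathbf{E}^i$ denotes expectation when $\tau(\varnothing)=i$; $N_t^j$ is the number of all individuals $u$ ever born with type $j$ and $S(u)\le t$ (including the ancestor). The intensity measures are $\mu^{i,j}(\cdot)=\mathbf{E}[\xi^{i,j}(\cdot)]$. $\mathbf{I}_p$ is the $p\times p$ identity matrix; $\|\cdot\|$ is a matrix norm on $\mathbb{C}^{p\times p}$. $\mathcal{L}\boldsymbol{\mu}(z)=(\mathcal{L}\mu^{i,j}(z))_{i,j}$ with $\mathcal{L}\mu^{i,j}(z)=\int_{[0,\infty)} e^{-zx}\,\mu^{i,j}(\mathrm{d}x)$, and $$\mathcal{D}(\mathcal{L}\boldsymbol{\mu})=\Big\{z\in\mathbb{C}:\int e^{-\mathrm{Re}(z)x}\,\mu^{i,j}(\mathrm{d}x)<\infty\text{ for all }i,j\Big\}.$$ Non-lattice: for all $h>0$ and all $h_1,\dots,h_p\in[0,h)$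 there exist $i,j$ with $\mu^{i,j}\big((h_j-h_i+h\mathbb{Z})^{\mathsf{c}}\big)>0$. Roots: $\Lambda=\{\lambda\in\mathcal{D}(\mathcal{L}\boldsymbol{\mu}):\det(\mathbf{I}_p-\mathcal{L}\boldsymbol{\mu}(\lambda))=0\}$ and, for $\theta\in\mathbb{R}$, $\Lambda_\theta=\{\lambda\in\Lambda:\mathrm{Re}(\lambda)>\theta\}$. For $\lambda\in\Lambda$, $\mathtt{k}(\lambda)\in\mathbb{N}=\{1,2,\dots\}$ is the smallest natural number such that all entries of $(z-\lambda)^{\mathtt{k}(\lambda)}(\mathbf{I}_p-\mathcal{L}\boldsymbol{\mu}(z))^{-1}$ are holomorphic in some neighborhood of $\lambda$. For $z\notin\Lambda$ set $\mathtt{k}(z)=0$. *)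

theory Defs
  imports
    "HOL-Probability.Probability"
    "HOL-Library.Landau_Symbols"
begin

section \<open>Point processes on the half-line\<close>

text \<open>
  The image of the counting measure on \<open>I\<close> under \<open>x\<close> is the sum of the Dirac measures at
  \<open>x k\<close>, \<open>k \<in> I\<close>, so repeated points are counted with multiplicity. Measures on the half-line
  are represented as measures on the Borel sets of the real line that do not charge the negative
  numbers.
\<close>

definition point_measures :: "real measure set" where
  "point_measures =
     {distr (count_space I) borel x | (I :: nat set) x.
        (\<forall>k\<in>I. 0 \<le> x k) \<and> (\<forall>t. finite {k \<in> I. x k \<le> t})}"

text \<open>The sigma-algebra generated by the evaluations \<open>\<nu> \<mapsto> \<nu> B\<close>, in analogy to
  \<^const>\<open>subprob_algebra\<close>.\<close>

definition point_process_space :: "real measure measure" where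
  "point_process_space =
     (SUP B \<in> sets borel. vimage_algebra point_measures (\<lambda>\<nu>. emeasure \<nu> B) borel)"

text \<open>The entry \<open>(i, j)\<close> of a matrix of point processes is the value at the pair \<open>(i, j)\<close>.\<close>

definition reproduction_space :: "('p::finite \<times> 'p \<Rightarrow> real measure) measure" where
  "reproduction_space = (\<Pi>\<^sub>M ij\<in>UNIV. point_process_space)"

text \<open>
  The points of \<open>\<nu>\<close>, repeated according to their multiplicity and listed in increasing order,
  are \<open>nth_point \<nu> 0 \<le> nth_point \<nu> 1 \<le> \<dots>\<close>. If \<open>\<nu>\<close> has at most \<open>n\<close> points, then the
  infimum is taken over the empty set and \<open>nth_point \<nu> n = \<infinity>\<close>.
\<close>

definition nth_point :: "real measure \<Rightarrow> nat \<Rightarrow> ereal" where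
  "nth_point \<nu> n = Inf {ereal x | x. 0 \<le> x \<and> of_nat (Suc n) \<le> emeasure \<nu> {0..x}}"

definition intensity ::
  "'w measure \<Rightarrow> ('w \<Rightarrow> 'p::finite \<times> 'p \<Rightarrow> real measure) \<Rightarrow> 'p \<Rightarrow> 'p \<Rightarrow> real measure" where
  "intensity P \<xi> i j =
     measure_of UNIV (sets borel) (\<lambda>B. \<integral>\<^sup>+ \<omega>. emeasure (\<xi> \<omega> (i, j)) B \<partial>P)"


section \<open>The multi-type Crump--Mode--Jagers process\<close>

text \<open>
  The individual \<open>u\<^sub>1 u\<^sub>2 \<dots> u\<^sub>n\<close> is the list \<open>[u\<^sub>n, \<dots>, u\<^sub>2, u\<^sub>1]\<close>, so the children of \<open>u\<close>
  are the lists \<open>m # u\<close>. The points of the \<open>p\<close> processes in a row are distributed over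
  the labels by a bijection between \<open>nat\<close> and \<open>'p \<times> nat\<close>: if \<open>m\<close> corresponds to \<open>(j, n)\<close>, then
  \<open>m # u\<close> is the child of \<open>u\<close> of type \<open>j\<close> belonging to the \<open>n\<close>-th point (counted from 0).
  Labels of individuals that are never born have birth time \<open>\<infinity>\<close>.
\<close>

definition child_label :: "nat \<Rightarrow> 'p::finite \<times> nat" where
  "child_label = from_nat_into UNIV"

primrec type_of_ind :: "'p::finite \<Rightarrow> nat list \<Rightarrow> 'p" where
  "type_of_ind i0 [] = i0"
| "type_of_ind i0 (m # u) = fst (child_label m)"

primrec birth_time ::
  "(nat list \<Rightarrow> 'p::finite \<times> 'p \<Rightarrow> real measure) \<Rightarrow> 'p \<Rightarrow> nat list \<Rightarrow> ereal" where
  "birth_time x i0 [] = 0"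
| "birth_time x i0 (m # u) =
     (case child_label m of (j, n) \<Rightarrow>
        birth_time x i0 u + nth_point (x u (type_of_ind i0 u, j)) n)"

text \<open>
  \<open>\<xi>c u\<close> is the copy of \<open>\<xi>\<close> used by the individual \<open>u\<close>.
\<close>

locale cmj_process = prob_space P for P :: "'w measure" +
  fixes \<xi> :: "'w \<Rightarrow> 'p::finite \<times> 'p \<Rightarrow> real measure"
    and \<xi>c :: "nat list \<Rightarrow> 'w \<Rightarrow> 'p \<times> 'p \<Rightarrow> real measure"
  assumes xi_measurable: "\<xi> \<in> P \<rightarrow>\<^sub>M reproduction_space"
    and xi_indep: "indep_vars (\<lambda>_. reproduction_space) \<xi>c UNIV"
    and xi_copies: "\<And>u. distr P reproduction_space (\<xi>c u) = distr P reproduction_space \<xi>"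

definition num_born ::
  "(nat list \<Rightarrow> 'p::finite \<times> 'p \<Rightarrow> real measure) \<Rightarrow> 'p \<Rightarrow> real \<Rightarrow> 'p \<Rightarrow> ennreal" where
  "num_born x i0 t j =
     emeasure (count_space UNIV) {u. type_of_ind i0 u = j \<and> birth_time x i0 u \<le> ereal t}"

text \<open>
  Since the ancestor's type is independent of the reproduction processes, the expectation given
  that the ancestor has type \<open>i\<close> is the expectation for the process started from \<open>i\<close>.
\<close>

definition expected_born ::
  "'w measure \<Rightarrow> (nat list \<Rightarrow> 'w \<Rightarrow> 'p::finite \<times> 'p \<Rightarrow> real measure)
    \<Rightarrow> 'p \<Rightarrow> real \<Rightarrow> 'p \<Rightarrow> ennreal" where
  "expected_born P \<xi>c i t j = (\<integral>\<^sup>+ \<omega>. num_born (\<lambda>u. \<xi>c u \<omega>) i t j \<partial>P)"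

definition mean_matrix ::
  "'w measure \<Rightarrow> (nat list \<Rightarrow> 'w \<Rightarrow> 'p::finite \<times> 'p \<Rightarrow> real measure)
    \<Rightarrow> real \<Rightarrow> real^'p^'p" where
  "mean_matrix P \<xi>c t = (\<chi> i j. enn2real (expected_born P \<xi>c i t j))"


section \<open>Matrices of measures and their Laplace transforms\<close>

definition locally_finite :: "real measure \<Rightarrow> bool" where
  "locally_finite \<nu> \<longleftrightarrow> (\<forall>K. compact K \<longrightarrow> emeasure \<nu> K < \<infinity>)"

definition non_lattice :: "('p::finite \<Rightarrow> 'p \<Rightarrow> real measure) \<Rightarrow> bool" where
  "non_lattice \<mu> \<longleftrightarrow>
     (\<forall>h>0. \<forall>d. (\<forall>i. 0 \<le> d i \<and> d i < h) \<longrightarrow>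
        (\<exists>i j. emeasure (\<mu> i j) (- {d j - d i + h * of_int k | k. True}) > 0))"

definition laplace_domain :: "('p::finite \<Rightarrow> 'p \<Rightarrow> real measure) \<Rightarrow> complex set" where
  "laplace_domain \<mu> =
     {z. \<forall>i j. (\<integral>\<^sup>+ x\<in>{0..}. ennreal (exp (- Re z * x)) \<partial>\<mu> i j) < \<infinity>}"

definition laplace :: "('p::finite \<Rightarrow> 'p \<Rightarrow> real measure) \<Rightarrow> complex \<Rightarrow> complex^'p^'p" where
  "laplace \<mu> z = (\<chi> i j. LINT x:{0..}|\<mu> i j. exp (- z * complex_of_real x))"

definition atom_at_zero :: "('p::finite \<Rightarrow> 'p \<Rightarrow> real measure) \<Rightarrow> complex^'p^'p" where
  "atom_at_zero \<mu> = (\<chi> i j. complex_of_real (measure (\<mu> i j) {0}))"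

definition spectral_radius :: "complex^'n^'n \<Rightarrow> real" where
  "spectral_radius A = Max (norm ` {l. \<exists>v. v \<noteq> 0 \<and> A *v v = l *s v})"

definition roots :: "('p::finite \<Rightarrow> 'p \<Rightarrow> real measure) \<Rightarrow> complex set" where
  "roots \<mu> = {l \<in> laplace_domain \<mu>. det (mat 1 - laplace \<mu> l) = 0}"

definition roots_gt :: "('p::finite \<Rightarrow> 'p \<Rightarrow> real measure) \<Rightarrow> real \<Rightarrow> complex set" where
  "roots_gt \<mu> \<theta> = {l \<in> roots \<mu>. Re l > \<theta>}"

text \<open>
  All entries of \<open>(z - l) ^ k * inverse (1 - laplace \<mu> z)\<close> are holomorphic in a neighbourhood of
  \<open>l\<close>. The inverse does not exist at a root \<open>l\<close> itself, so holomorphic means: defined in a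
  punctured disc around \<open>l\<close> and extending holomorphically to the full disc.
\<close>

definition pole_removed :: "('p::finite \<Rightarrow> 'p \<Rightarrow> real measure) \<Rightarrow> complex \<Rightarrow> nat \<Rightarrow> bool" where
  "pole_removed \<mu> l k \<longleftrightarrow>
     (\<exists>r>0. (\<forall>z \<in> ball l r - {l}. z \<in> laplace_domain \<mu> \<and> invertible (mat 1 - laplace \<mu> z)) \<and>
        (\<forall>i j. \<exists>g. g holomorphic_on ball l r \<and>
           (\<forall>z \<in> ball l r - {l}. g z = (z - l) ^ k * matrix_inv (mat 1 - laplace \<mu> z) $ i $ j)))"

definition pole_order :: "('p::finite \<Rightarrow> 'p \<Rightarrow> real measure) \<Rightarrow> complex \<Rightarrow> nat" where
  "pole_order \<mu> z = (if z \<in> roots \<mu> then LEAST k. 1 \<le> k \<and> pole_removed \<mu> z k else 0)"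

end

theory Submission
  imports Defs "HOL-Complex_Analysis.Complex_Analysis" "HOL-Real_Asymp.Real_Asymp"
begin

text \<open>
  The measures \<open>\<rho> i j\<close> with \<open>\<rho> i j {0..t} = E\<^sup>i[N\<^sub>t\<^sup>j]\<close> satisfy \<open>\<rho> = \<delta>\<^sub>0 + \<rho> * \<mu>\<close>, because the
  birth time of an individual is a sum of points of the independent processes of its ancestors.
  Hence the Laplace transform of \<open>\<rho>\<close> is \<open>R = (1 - L\<mu>)\<^sup>-\<^sup>1\<close> far to the right, where it is finite since
  \<open>L\<mu>(s)\<close> tends to the atom at zero, a nonnegative matrix of spectral radius less than 1.

  The indicator of \<open>{0..t}\<close> lies between two piecewise linear functions that differ from it only within
  distance \<open>e = exp (-(c - a) t)\<close> of \<open>t\<close>. The integrals of these against \<open>\<rho>\<close> are absolutely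
  convergent inverse Laplace integrals over \<open>Re z = c\<close>, which are moved to \<open>Re z = a\<close> with \<open>a\<close>
  slightly less than \<open>\<theta>\<close>. The residues give the expansion up to an error of order
  \<open>e exp (c t) = exp (a t)\<close>, and the remaining integral is at most of order \<open>exp (a t) ln (1/e)\<close>,
  which is where the factor \<open>t\<close> comes from.

  That \<open>R\<close> is bounded in the strip is a normal family argument: if the determinant of \<open>1 - L\<mu>\<close> came
  close to 0 far away from the real axis, then a limit of its vertical translates would vanish to the
  right of \<open>\<theta>\<close>, and by Hurwitz's theorem there would be infinitely many roots.
\<close>

section \<open>Contour shifts and the inversion formula\<close>

text \<open>The obstacle: \<open>R\<close> is merely bounded on vertical lines, and the kernel
  exp(zt)/z of the indicator of [0,t] decays only like 1/|z|, so the sharp inversion integral does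
  not converge absolutely. The factor (exp(ez) - 1)/(ez) is close to 1 for |z| below 1/e and adds a
  power of decay above, so what remains is essentially the integral of 1/|z| up to 1/e, a logarithm.
  The kernel has a pole at 0 of its own. If the new line lies to the left of 0, this pole is crossed
  and raises the order of the pole of \<open>R\<close> at 0 by one, which produces the power t^k(0).
  The renewal identity is not obtained by convolving measures: it is derived at real s as an
  identity between sums over labels in [0,\<infinity>] and then carried to complex z by the identity
  theorem. In the normal family argument the bound on the inverse along Re z = \<theta> keeps the
  limit function from vanishing identically and from vanishing on that line.\<close>

lemma integrable_inverse_one_plus_square: "integrable lborel (\<lambda>x::real. inverse (1 + x\<^sup>2))"
  using integrable_inverse_1_plus_square by (simp add: set_integrable_def)

lemma integrable_continuous_quadratic_decay:
  fixes g :: "real \<Rightarrow> complex"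
  assumes cont: "continuous_on UNIV g"
    and bnd: "\<And>x. T \<le> \<bar>x\<bar> \<Longrightarrow> norm (g x) \<le> B / x\<^sup>2"
  shows "integrable lborel g"
proof -
  define T' where "T' = max 1 T"
  have "compact (g ` {-T'..T'})"
    by (intro compact_continuous_image continuous_on_subset[OF cont]) auto
  then obtain K where K: "\<And>x. x \<in> {-T'..T'} \<Longrightarrow> norm (g x) \<le> K"
    by (metis bounded_iff compact_imp_bounded imageI)
  \<comment> \<open>The first summand serves the range up to \<open>T'\<close>, where
    \<open>g\<close> is bounded by compactness, the second the tails, where
    \<open>T' \<ge> 1\<close> gives 1 + x^2 \<le> 2 x^2. Absolute values appear because neither
    \<open>K\<close> nor \<open>B\<close> is known to be nonnegative.\<close>
  define C where "C = \<bar>K\<bar> * (1 + T'\<^sup>2) + 2 * \<bar>B\<bar>"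
  have "norm (g x) \<le> C * inverse (1 + x\<^sup>2)" for x
  proof -
    have pos: "1 + x\<^sup>2 > 0" by (smt (verit) zero_le_power2)
    have "norm (g x) * (1 + x\<^sup>2) \<le> C"
    proof (cases "\<bar>x\<bar> \<le> T'")
      case True
      then have 1: "norm (g x) \<le> \<bar>K\<bar>" using K[of x] by (meson abs_ge_self abs_le_D2 abs_le_iff atLeastAtMost_iff minus_le_iff order_trans)
      have 2: "x\<^sup>2 \<le> T'\<^sup>2" using power_mono[OF True, of 2] by simp
      have "norm (g x) * (1 + x\<^sup>2) \<le> \<bar>K\<bar> * (1 + T'\<^sup>2)"
        using 1 2 pos by (intro mult_mono) auto
      then show ?thesis by (simp add: C_def)
    next
      case False
      then have T: "T \<le> \<bar>x\<bar>" "1 \<le> \<bar>x\<bar>" by (auto simp: T'_def)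
      have x2: "1 \<le> x\<^sup>2" using power_mono[OF T(2), of 2] by simp
      have "norm (g x) \<le> \<bar>B\<bar> / x\<^sup>2"
        using bnd[OF T(1)] by (meson abs_ge_self divide_right_mono order_trans zero_le_power2)
      moreover have "0 < x\<^sup>2" using x2 by linarith
      ultimately have "norm (g x) * x\<^sup>2 \<le> \<bar>B\<bar>" using pos_le_divide_eq by blast
      moreover have "norm (g x) * (1 + x\<^sup>2) \<le> norm (g x) * (2 * x\<^sup>2)"
        using x2 by (intro mult_left_mono) auto
      moreover have "0 \<le> \<bar>K\<bar> * (1 + T'\<^sup>2)" by simp
      ultimately show ?thesis unfolding C_def by linarith
    qed
    then show ?thesis using pos by (simp add: field_simps)
  qed
  moreover have "C \<ge> 0" by (simp add: C_def)
  ultimately show ?thesis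
    using cont integrable_mult_right[OF integrable_inverse_one_plus_square, of C]
    by (intro Bochner_Integration.integrable_bound[of _ "\<lambda>x. C * inverse (1 + x\<^sup>2)" g])
       (auto simp: borel_measurable_continuous_onI abs_mult)
qed

lemma integral_symmetric_interval_tendsto:
  fixes g :: "real \<Rightarrow> complex"
  assumes "integrable lborel g"
  shows "(\<lambda>n. integral {- real n..real n} g) \<longlonglongrightarrow> (\<integral>x. g x \<partial>lborel)"
proof -
  have eq: "integral {- real n..real n} g = (\<integral>x. indicator {- real n..real n} x *\<^sub>R g x \<partial>lborel)" for n
    using set_borel_integral_eq_integral(2)[of "{- real n..real n}" g] assms
      integrable_mult_indicator[of "{- real n..real n}" lborel g]
    by (simp add: set_lebesgue_integral_def set_integrable_def)
  have "(\<lambda>n. \<integral>x. indicator {- real n..real n} x *\<^sub>R g x \<partial>lborel) \<longlonglongrightarrow> (\<integral>x. g x \<partial>lborel)"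
  proof (rule integral_dominated_convergence[where w="\<lambda>x. norm (g x)"])
    show "AE x in lborel. (\<lambda>n. indicator {- real n..real n} x *\<^sub>R g x) \<longlonglongrightarrow> g x"
    proof (intro AE_I2 tendsto_eventually)
      fix x :: real
      obtain N :: nat where "\<bar>x\<bar> \<le> real N" using real_arch_simple by blast
      then show "\<forall>\<^sub>F n in sequentially. indicator {- real n..real n} x *\<^sub>R g x = g x"
        by (intro eventually_sequentiallyI[of N]) (auto simp: indicator_def)
    qed
  qed (use assms in \<open>auto simp: indicator_def\<close>)
  then show ?thesis by (simp add: eq)
qed

text \<open>Residue theorem on rectangles reaching from height -n to n: the horizontal sides have
  fixed length and an integrand of order 1/n^2, so they vanish in the limit. The margins
  \<open>a' < a\<close> and \<open>b < b'\<close> put the closed rectangle into an open set. On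
  vertical sides dz = \<i> dx, hence the factor 2 pi instead of 2 pi \<i>.\<close>

lemma vertical_line_shift:
  fixes f :: "complex \<Rightarrow> complex"
  assumes ab: "a' < a" "a < b" "b < b'"
    and fin: "finite pts" and pts: "\<And>p. p \<in> pts \<Longrightarrow> a < Re p \<and> Re p < b"
    and hol: "f holomorphic_on ({z. a' < Re z \<and> Re z < b'} - pts)"
    and bnd: "\<And>z. a \<le> Re z \<Longrightarrow> Re z \<le> b \<Longrightarrow> T \<le> \<bar>Im z\<bar> \<Longrightarrow> norm (f z) \<le> B / (Im z)\<^sup>2"
  shows "integrable lborel (\<lambda>x. f (Complex a x))" (is ?A)
    and "integrable lborel (\<lambda>x. f (Complex b x))" (is ?B)
    and "(\<integral>x. f (Complex b x) \<partial>lborel) - (\<integral>x. f (Complex a x) \<partial>lborel) = 2 * pi * (\<Sum>p\<in>pts. residue f p)"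
      (is ?C)
proof -
  let ?S = "{z. a' < Re z \<and> Re z < b'}"
  have S: "open ?S" "convex ?S"
    using convex_Int[OF convex_halfspace_Re_gt[of a'] convex_halfspace_Re_lt[of b']]
    by (auto intro!: open_Collect_conj open_halfspace_Re_gt open_halfspace_Re_lt simp: Int_def)
  have cf: "continuous_on (?S - pts) f" using hol by (rule holomorphic_on_imp_continuous_on)
  have contl: "continuous_on UNIV (\<lambda>x. f (Complex c x))" if "a' < c" "c < b'" "c \<notin> Re ` pts" for c
    by (rule continuous_on_compose2[OF cf]) (use that in \<open>auto simp: Complex_eq intro!: continuous_intros image_eqI\<close>)
  have na: "a \<notin> Re ` pts" "b \<notin> Re ` pts" using pts by force+
  show iA: ?A using ab na bnd[of "Complex a _"]
    by (intro integrable_continuous_quadratic_decay[where T=T and B=B] contl) auto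
  show iB: ?B using ab na bnd[of "Complex b _"]
    by (intro integrable_continuous_quadratic_decay[where T=T and B=B] contl) auto
  \<comment> \<open>Above height \<open>M\<close> the decay hypothesis holds on the horizontal
    sides, and every pole lies strictly between them.\<close>
  define M where "M = Max (insert T (insert 0 ((\<lambda>p. \<bar>Im p\<bar>) ` pts)))"
  have M: "T \<le> M" "0 \<le> M" "\<And>p. p \<in> pts \<Longrightarrow> \<bar>Im p\<bar> \<le> M"
    unfolding M_def using fin by (auto intro!: Max_ge simp del: Max_insert)
  obtain N :: nat where N: "M < real N" using reals_Archimedean2 by blast
  define E where "E n = contour_integral (linepath (Complex a (- real n)) (Complex b (- real n))) f
      + contour_integral (linepath (Complex b (real n)) (Complex a (real n))) f" for n
  have rect: "2 * pi * \<i> * (\<Sum>p\<in>pts. residue f p) = \<i> * integral {- real n..real n} (\<lambda>x. f (Complex b x))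
      - \<i> * integral {- real n..real n} (\<lambda>x. f (Complex a x)) + E n"
    and E: "norm (E n) \<le> 2 * (B / (real n)\<^sup>2 * (b - a))" if n: "n \<ge> N" for n
  proof -
    have Mn: "M < real n" using n N by linarith
    let ?a1 = "Complex a (- real n)" and ?a2 = "Complex b (- real n)"
      and ?a3 = "Complex b (real n)" and ?a4 = "Complex a (real n)"
    have np: "0 < real n" using Mn M by linarith
    have sub: "closed_segment z w \<subseteq> ?S - pts"
      if "(z, w) \<in> {(?a1,?a2),(?a2,?a3),(?a3,?a4),(?a4,?a1)}" for z w
    proof
      fix u assume u: "u \<in> closed_segment z w"
      have "z \<in> ?S" "w \<in> ?S" using that ab by auto
      then have "u \<in> ?S" using u closed_segment_subset[OF _ _ S(2)] by blast
      moreover have "u \<notin> pts"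
      proof
        assume up: "u \<in> pts"
        have "Re u = a \<or> Re u = b \<or> \<bar>Im u\<bar> = real n"
          using that u by (auto simp: closed_segment_same_Re closed_segment_same_Im)
        then show False using pts[OF up] M(3)[OF up] Mn by auto
      qed
      ultimately show "u \<in> ?S - pts" by blast
    qed
    have ci: "f contour_integrable_on linepath z w"
      if "(z, w) \<in> {(?a1,?a2),(?a2,?a3),(?a3,?a4),(?a4,?a1)}" for z w
      using continuous_on_subset[OF cf sub[OF that]] by (rule contour_integrable_continuous_linepath)
    have ci': "f contour_integrable_on linepath ?a1 ?a2" "f contour_integrable_on linepath ?a2 ?a3"
      "f contour_integrable_on linepath ?a3 ?a4" "f contour_integrable_on linepath ?a4 ?a1"
      by (rule ci; simp)+
    have pim: "path_image (rectpath ?a1 ?a3) \<subseteq> ?S - pts"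
      using sub by (simp add: rectpath_def Let_def path_image_join)
    have "contour_integral (rectpath ?a1 ?a3) f
        = 2 * pi * \<i> * (\<Sum>p\<in>pts. winding_number (rectpath ?a1 ?a3) p * residue f p)"
    proof (rule Residue_theorem[OF S(1) _ fin hol])
      show "\<forall>z. z \<notin> ?S \<longrightarrow> winding_number (rectpath ?a1 ?a3) z = 0"
        using ab np by (auto intro!: winding_number_rectpath_outside simp: in_cbox_complex_iff)
    qed (use pim S convex_connected in auto)
    also have "(\<Sum>p\<in>pts. winding_number (rectpath ?a1 ?a3) p * residue f p) = (\<Sum>p\<in>pts. residue f p)"
    proof (intro sum.cong refl)
      fix p assume p: "p \<in> pts"
      have "p \<in> box ?a1 ?a3" using pts[OF p] M(3)[OF p] Mn by (auto simp: in_box_complex_iff)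
      then show "winding_number (rectpath ?a1 ?a3) p * residue f p = residue f p"
        by (simp add: winding_number_rectpath)
    qed
    finally have 1: "contour_integral (rectpath ?a1 ?a3) f = 2 * pi * \<i> * (\<Sum>p\<in>pts. residue f p)" .
    have 2: "contour_integral (rectpath ?a1 ?a3) f = contour_integral (linepath ?a1 ?a2) f +
      (contour_integral (linepath ?a2 ?a3) f + (contour_integral (linepath ?a3 ?a4) f + contour_integral (linepath ?a4 ?a1) f))"
      using ci' by (simp add: rectpath_def Let_def)
    have 3: "contour_integral (linepath ?a4 ?a1) f = - contour_integral (linepath ?a1 ?a4) f"
      using contour_integral_reversepath[of "linepath ?a1 ?a4" f] by simp
    have 4: "contour_integral (linepath ?a1 ?a4) f = \<i> * integral {- real n..real n} (\<lambda>x. f (Complex a x))"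
      "contour_integral (linepath ?a2 ?a3) f = \<i> * integral {- real n..real n} (\<lambda>x. f (Complex b x))"
      using np by (intro contour_integral_linepath_same_Re; simp)+
    show "2 * pi * \<i> * (\<Sum>p\<in>pts. residue f p) = \<i> * integral {- real n..real n} (\<lambda>x. f (Complex b x))
      - \<i> * integral {- real n..real n} (\<lambda>x. f (Complex a x)) + E n"
      using 1 2 3 4 by (simp add: E_def algebra_simps)
    have B: "0 \<le> B / (real n)\<^sup>2"
      using order_trans[OF norm_ge_zero bnd[of ?a1]] ab M Mn by simp
    have nb: "norm (contour_integral (linepath z w) f) \<le> B / (real n)\<^sup>2 * norm (w - z)"
      if "(z, w) \<in> {(?a1,?a2),(?a3,?a4)}" for z w
    proof (rule contour_integral_bound_linepath[OF _ B])
      show "f contour_integrable_on linepath z w" using that by (intro ci) auto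
      fix u assume "u \<in> closed_segment z w"
      then have u: "a \<le> Re u" "Re u \<le> b" "\<bar>Im u\<bar> = real n"
        using that ab by (auto simp: closed_segment_same_Im closed_segment_eq_real_ivl split: if_splits)
      then have "(Im u)\<^sup>2 = (real n)\<^sup>2" by (metis power2_abs)
      then show "norm (f u) \<le> B / (real n)\<^sup>2" using bnd[OF u(1,2)] u(3) M Mn by simp
    qed
    have d: "norm (?a2 - ?a1) = b - a" "norm (?a4 - ?a3) = b - a" using ab by (auto simp: cmod_def)
    show "norm (E n) \<le> 2 * (B / (real n)\<^sup>2 * (b - a))"
      unfolding E_def using norm_triangle_mono[OF nb[of ?a1 ?a2] nb[of ?a3 ?a4]] unfolding d
      by simp
  qed
  have "(\<lambda>n. 2 * (B / (real n)\<^sup>2 * (b - a))) \<longlonglongrightarrow> 0" by real_asymp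
  then have E0: "E \<longlonglongrightarrow> 0"
    by (rule Lim_null_comparison[rotated]) (use E in \<open>auto simp: eventually_sequentially\<close>)
  have "(\<lambda>n. \<i> * integral {- real n..real n} (\<lambda>x. f (Complex b x))
      - \<i> * integral {- real n..real n} (\<lambda>x. f (Complex a x)) + E n)
     \<longlonglongrightarrow> \<i> * (\<integral>x. f (Complex b x) \<partial>lborel) - \<i> * (\<integral>x. f (Complex a x) \<partial>lborel) + 0"
    by (intro tendsto_intros integral_symmetric_interval_tendsto iA iB E0)
  moreover have "(\<lambda>n. \<i> * integral {- real n..real n} (\<lambda>x. f (Complex b x))
      - \<i> * integral {- real n..real n} (\<lambda>x. f (Complex a x)) + E n)
     \<longlonglongrightarrow> 2 * pi * \<i> * (\<Sum>p\<in>pts. residue f p)"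
    by (rule tendsto_eventually, rule eventually_sequentiallyI[of N], rule rect[symmetric])
  ultimately have "2 * pi * \<i> * (\<Sum>p\<in>pts. residue f p)
     = \<i> * (\<integral>x. f (Complex b x) \<partial>lborel) - \<i> * (\<integral>x. f (Complex a x) \<partial>lborel) + 0"
    using LIMSEQ_unique by blast
  then have "\<i> * (2 * pi * (\<Sum>p\<in>pts. residue f p))
     = \<i> * ((\<integral>x. f (Complex b x) \<partial>lborel) - (\<integral>x. f (Complex a x) \<partial>lborel))"
    by (simp add: algebra_simps)
  then show ?C by simp
qed

text \<open>Used when a vertical line is pushed to infinity: the n-th line has distance at least n +
  1 from the imaginary axis, and the kernel on it is at most 1/|z|^2.\<close>

lemma integral_inverse_square_tendsto_0:
  fixes g :: "nat \<Rightarrow> real \<Rightarrow> complex"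
  assumes meas: "\<And>n. g n \<in> borel_measurable lborel"
    and bnd: "\<And>n x. norm (g n x) \<le> inverse ((real (Suc n))\<^sup>2 + x\<^sup>2)"
  shows "(\<lambda>n. \<integral>x. g n x \<partial>lborel) \<longlonglongrightarrow> 0"
proof -
  have "(\<lambda>n. \<integral>x. g n x \<partial>lborel) \<longlonglongrightarrow> (\<integral>x. 0 \<partial>(lborel::real measure))"
  proof (rule integral_dominated_convergence[where w="\<lambda>x. inverse (1 + x\<^sup>2)"])
    show "AE x in lborel. (\<lambda>n. g n x) \<longlonglongrightarrow> 0"
    proof (intro AE_I2)
      fix x :: real
      have "(\<lambda>n. inverse ((real (Suc n))\<^sup>2 + x\<^sup>2)) \<longlonglongrightarrow> 0" by real_asymp
      then show "(\<lambda>n. g n x) \<longlonglongrightarrow> 0"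
        by (rule Lim_null_comparison[rotated]) (use bnd in auto)
    qed
    show "AE x in lborel. norm (g n x) \<le> inverse (1 + x\<^sup>2)" for n
    proof (intro AE_I2)
      fix x :: real
      have "1 + x\<^sup>2 \<le> (real (Suc n))\<^sup>2 + x\<^sup>2" by (simp add: one_le_power)
      moreover have "0 < 1 + x\<^sup>2" by (smt (verit) zero_le_power2)
      ultimately have "inverse ((real (Suc n))\<^sup>2 + x\<^sup>2) \<le> inverse (1 + x\<^sup>2)"
        by (intro le_imp_inverse_le)
      then show "norm (g n x) \<le> inverse (1 + x\<^sup>2)" using bnd[of n x] by linarith
    qed
  qed (use meas integrable_inverse_one_plus_square in auto)
  then show ?thesis by simp
qed

section \<open>Inverse Laplace transforms of ramps and of smoothed indicators\<close>

lemma norm_exp_over_square: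
  "norm (exp (z * complex_of_real s) / z\<^sup>2) = exp (Re z * s) * inverse ((Re z)\<^sup>2 + (Im z)\<^sup>2)"
  by (simp add: norm_divide norm_inverse norm_mult norm_power cmod_power2 divide_inverse)

text \<open>For s \<ge> 0 the line is pushed to the left, where exp(zs) stays bounded, and crosses
  the double pole at 0 with residue s. For s < 0 it is pushed to the right and meets no
  pole.\<close>

lemma inverse_laplace_ramp:
  fixes c s :: real
  assumes c: "0 < c"
  shows "integrable lborel (\<lambda>x. exp (Complex c x * s) / (Complex c x)\<^sup>2)"
    and "(\<integral>x. exp (Complex c x * s) / (Complex c x)\<^sup>2 \<partial>lborel) = 2 * pi * max 0 s"
proof -
  define f where "f z = exp (z * complex_of_real s) / z\<^sup>2" for z
  have inv: "inverse ((Re z)\<^sup>2 + (Im z)\<^sup>2) \<le> 1 / (Im z)\<^sup>2" if "1 \<le> \<bar>Im z\<bar>" for z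
    using that by (auto simp: divide_inverse intro!: le_imp_inverse_le)
  have "integrable lborel (\<lambda>x. f (Complex c x)) \<and> (\<integral>x. f (Complex c x) \<partial>lborel) = 2 * pi * max 0 s"
  proof (cases "0 \<le> s")
    case True
    have hol: "f holomorphic_on ({z. - real (Suc n) - 1 < Re z \<and> Re z < c + 1} - {0})" for n
      unfolding f_def by (intro holomorphic_intros) auto
    have bnd: "norm (f z) \<le> exp (c * s) / (Im z)\<^sup>2" if "Re z \<le> c" "1 \<le> \<bar>Im z\<bar>" for z
      using mult_mono[of "exp (Re z * s)" "exp (c * s)", OF _ inv[OF that(2)]] that(1) True
      by (simp add: f_def norm_exp_over_square mult_right_mono)
    note shift = vertical_line_shift[of "- real (Suc n) - 1" "- real (Suc n)" c "c + 1" "{0}" f 1 "exp (c * s)" for n,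
        OF _ _ _ _ _ hol bnd]
    have res: "residue f 0 = s"
    proof -
      have "residue (\<lambda>z. exp (z * complex_of_real s) / z ^ Suc 1) 0
          = (deriv ^^ 1) (\<lambda>z. exp (z * complex_of_real s)) 0 / fact 1"
        by (rule residue_holomorphic_over_power'[of UNIV]) (auto intro!: holomorphic_intros)
      also have "(deriv ^^ 1) (\<lambda>z. exp (z * complex_of_real s)) 0 = s"
        by (auto intro!: DERIV_imp_deriv derivative_eq_intros)
      finally show ?thesis by (simp add: f_def[abs_def] power2_eq_square)
    qed
    have "(\<integral>x. f (Complex (- real (Suc n)) x) \<partial>lborel) = (\<integral>x. f (Complex c x) \<partial>lborel) - 2 * pi * s" for n
      using shift(3)[of n] c res by (simp add: algebra_simps)
    moreover have "(\<lambda>n. \<integral>x. f (Complex (- real (Suc n)) x) \<partial>lborel) \<longlonglongrightarrow> 0"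
    proof (rule integral_inverse_square_tendsto_0)
      show "(\<lambda>x. f (Complex (- real (Suc n)) x)) \<in> borel_measurable lborel" for n
        using shift(1)[of n] c by (intro borel_measurable_integrable) simp
      have "exp (- real (Suc n) * s) \<le> 1" for n
        using True by (simp only: exp_le_one_iff) (simp add: mult_nonpos_nonneg)
      then show "norm (f (Complex (- real (Suc n)) x)) \<le> inverse ((real (Suc n))\<^sup>2 + x\<^sup>2)" for n x
        using mult_right_mono[of "exp (- real (Suc n) * s)" 1 "inverse ((real (Suc n))\<^sup>2 + x\<^sup>2)"]
        by (simp only: f_def norm_exp_over_square complex.sel power2_minus mult_1) simp
    qed
    ultimately have "(\<lambda>n. (\<integral>x. f (Complex c x) \<partial>lborel) - 2 * pi * s) \<longlonglongrightarrow> 0"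
      by simp
    then have "(\<integral>x. f (Complex c x) \<partial>lborel) = 2 * pi * s"
      by (simp add: LIMSEQ_const_iff)
    then show ?thesis using shift(2)[of 0] c True by simp
  next
    case False
    have hol: "f holomorphic_on ({z. 0 < Re z \<and> Re z < c + real (Suc n) + 1} - {})" for n
      unfolding f_def by (intro holomorphic_intros) auto
    have bnd: "norm (f z) \<le> 1 / (Im z)\<^sup>2" if "c \<le> Re z" "1 \<le> \<bar>Im z\<bar>" for z
    proof -
      have "exp (Re z * s) \<le> 1" using c that False by (simp add: mult_nonneg_nonpos)
      then show ?thesis using mult_mono[of "exp (Re z * s)" 1, OF _ inv[OF that(2)]]
        by (simp add: f_def norm_exp_over_square)
    qed
    note shift = vertical_line_shift[of 0 c "c + real (Suc n)" "c + real (Suc n) + 1" "{}" f 1 1 for n,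
        OF _ _ _ _ _ hol bnd]
    have "(\<integral>x. f (Complex (c + real (Suc n)) x) \<partial>lborel) = (\<integral>x. f (Complex c x) \<partial>lborel)" for n
      using shift(3)[of n] c by simp
    moreover have "(\<lambda>n. \<integral>x. f (Complex (c + real (Suc n)) x) \<partial>lborel) \<longlonglongrightarrow> 0"
    proof (rule integral_inverse_square_tendsto_0)
      show "(\<lambda>x. f (Complex (c + real (Suc n)) x)) \<in> borel_measurable lborel" for n
        using shift(2)[of n] c by (intro borel_measurable_integrable) simp
      show "norm (f (Complex (c + real (Suc n)) x)) \<le> inverse ((real (Suc n))\<^sup>2 + x\<^sup>2)" for n x
      proof -
        have "exp ((c + real (Suc n)) * s) \<le> 1" using False c by (simp add: mult_nonneg_nonpos)
        moreover have "inverse ((c + real (Suc n))\<^sup>2 + x\<^sup>2) \<le> inverse ((real (Suc n))\<^sup>2 + x\<^sup>2)"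
          using c by (intro le_imp_inverse_le add_right_mono power_mono add_pos_nonneg) auto
        ultimately show ?thesis
          using mult_mono[of "exp ((c + real (Suc n)) * s)" 1 "inverse ((c + real (Suc n))\<^sup>2 + x\<^sup>2)" "inverse ((real (Suc n))\<^sup>2 + x\<^sup>2)"]
          by (simp only: f_def norm_exp_over_square complex.sel mult_1) simp
      qed
    qed
    ultimately have "(\<integral>x. f (Complex c x) \<partial>lborel) = 0"
      by (simp add: LIMSEQ_const_iff)
    then show ?thesis using shift(1)[of 0] c False by simp
  qed
  then show "integrable lborel (\<lambda>x. exp (Complex c x * s) / (Complex c x)\<^sup>2)"
    and "(\<integral>x. exp (Complex c x * s) / (Complex c x)\<^sup>2 \<partial>lborel) = 2 * pi * max 0 s"
    by (simp_all add: f_def)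
qed

text \<open>The sign of \<open>e\<close> selects the side. For \<open>e > 0\<close> the function
  rises from 0 at -e to 1 at 0 and lies above the indicator of [0,\<infinity>); for
  \<open>e < 0\<close> it rises from 0 at 0 to 1 at |e| and lies below it.\<close>

definition ramp_quotient :: "real \<Rightarrow> real \<Rightarrow> real" where
  "ramp_quotient e s = (max 0 (s + e) - max 0 s) / e"

lemma smoothing_kernel_inversion:
  fixes c t e :: real
  assumes "0 < c" "e \<noteq> 0"
  defines "f \<equiv> \<lambda>z. exp (z * complex_of_real t) * (exp (complex_of_real e * z) - 1) / (complex_of_real e * z\<^sup>2)"
  shows "integrable lborel (\<lambda>x. f (Complex c x))"
    and "(\<integral>x. f (Complex c x) \<partial>lborel) = 2 * pi * ramp_quotient e t"
proof -
  have eq: "f z = (exp (z * complex_of_real (t + e)) / z\<^sup>2 - exp (z * complex_of_real t) / z\<^sup>2) * inverse (complex_of_real e)" for z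
    using \<open>e \<noteq> 0\<close> by (cases "z = 0") (auto simp: f_def field_simps exp_add)
  note i = inverse_laplace_ramp[OF \<open>0 < c\<close>]
  show "integrable lborel (\<lambda>x. f (Complex c x))"
    unfolding eq by (intro integrable_mult_left Bochner_Integration.integrable_diff i)
  show "(\<integral>x. f (Complex c x) \<partial>lborel) = 2 * pi * ramp_quotient e t"
    unfolding eq using i[of "t + e"] i[of t]
    by (simp add: Bochner_Integration.integral_diff ramp_quotient_def field_simps)
qed

lemma ramp_quotient_bounds:
  assumes "e \<noteq> 0"
  shows "0 \<le> ramp_quotient e s" "ramp_quotient e s \<le> 1"
    "s + \<bar>e\<bar> < 0 \<Longrightarrow> ramp_quotient e s = 0"
    "0 < e \<Longrightarrow> 0 \<le> s \<Longrightarrow> ramp_quotient e s = 1"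
    "e < 0 \<Longrightarrow> s < 0 \<Longrightarrow> ramp_quotient e s = 0"
  using assms by (auto simp: ramp_quotient_def max_def field_simps)

text \<open>After smoothing, both factors are absolutely integrable, the kernel along the line and
  exp(-cy) against \<open>\<rho>\<close>, so Fubini applies. For fixed y the inner integral is the
  kernel inversion at time t - y.\<close>

lemma smoothed_measure_inversion:
  fixes \<rho> :: "real measure" and c t e :: real
  assumes sets[measurable_cong, simp]: "sets \<rho> = sets borel" and sf: "sigma_finite_measure \<rho>"
    and c: "0 < c" and e: "e \<noteq> 0"
    and int: "set_integrable \<rho> {0..} (\<lambda>y. exp (- c * y))"
  defines "f \<equiv> \<lambda>z. exp (z * complex_of_real t) * (exp (complex_of_real e * z) - 1) / (complex_of_real e * z\<^sup>2)"
  shows "(\<integral>x. f (Complex c x) * (LINT y:{0..}|\<rho>. exp (- Complex c x * complex_of_real y)) \<partial>lborel)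
     = 2 * pi * complex_of_real (LINT y:{0..}|\<rho>. ramp_quotient e (t - y))"
proof -
  interpret \<rho>: sigma_finite_measure \<rho> by fact
  interpret pair_sigma_finite lborel \<rho> ..
  have Cx: "Complex c = (\<lambda>x. complex_of_real c + \<i> * complex_of_real x)" by (auto simp: Complex_eq)
  define F where "F = (\<lambda>(x, y). f (Complex c x) * (indicator {0..} y *\<^sub>R exp (- Complex c x * complex_of_real y)))"
  have F_meas: "F \<in> borel_measurable (lborel \<Otimes>\<^sub>M \<rho>)"
    unfolding F_def f_def Cx by measurable
  have nE: "norm (indicator {0..} y *\<^sub>R exp (- Complex c x * complex_of_real y)) = indicator {0..} y *\<^sub>R exp (- c * y)" for x y
    by (simp add: indicator_def)
  have intF: "integrable (lborel \<Otimes>\<^sub>M \<rho>) F"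
  proof (rule Fubini_integrable[OF F_meas])
    have "(\<integral>y. norm (F (x, y)) \<partial>\<rho>) = norm (f (Complex c x)) * (LINT y:{0..}|\<rho>. exp (- c * y))" for x
      unfolding F_def prod.case norm_mult nE set_lebesgue_integral_def by simp
    then show "integrable lborel (\<lambda>x. \<integral>y. norm (F (x, y)) \<partial>\<rho>)"
      using smoothing_kernel_inversion(1)[OF c e] unfolding f_def by simp
    show "AE x in lborel. integrable \<rho> (\<lambda>y. F (x, y))"
    proof (intro AE_I2)
      fix x :: real
      have "integrable \<rho> (\<lambda>y. indicator {0..} y *\<^sub>R exp (- Complex c x * complex_of_real y))"
        using int unfolding set_integrable_def
        by (rule Bochner_Integration.integrable_bound) (auto simp: indicator_def)
      then show "integrable \<rho> (\<lambda>y. F (x, y))"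
        unfolding F_def prod.case by (rule integrable_mult_right)
    qed
  qed
  have "(\<integral>x. f (Complex c x) * (LINT y:{0..}|\<rho>. exp (- Complex c x * complex_of_real y)) \<partial>lborel)
     = (\<integral>x. (\<integral>y. F (x, y) \<partial>\<rho>) \<partial>lborel)"
    unfolding F_def prod.case set_lebesgue_integral_def integral_mult_right_zero ..
  also have "\<dots> = (\<integral>y. (\<integral>x. F (x, y) \<partial>lborel) \<partial>\<rho>)"
    using Fubini_integral[of "\<lambda>x y. F (x, y)"] intF by simp
  also have "(\<lambda>y. \<integral>x. F (x, y) \<partial>lborel) = (\<lambda>y. complex_of_real (2 * pi * (indicator {0..} y *\<^sub>R ramp_quotient e (t - y))))"
  proof
    fix y
    have "F (x, y) = (exp (Complex c x * complex_of_real (t - y)) * (exp (complex_of_real e * Complex c x) - 1)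
        / (complex_of_real e * (Complex c x)\<^sup>2)) * indicator {0..} y" for x
      by (auto simp: F_def f_def indicator_def exp_diff exp_minus field_simps)
    then show "(\<integral>x. F (x, y) \<partial>lborel) = complex_of_real (2 * pi * (indicator {0..} y *\<^sub>R ramp_quotient e (t - y)))"
      using smoothing_kernel_inversion(2)[OF c e, of "t - y"]
      by (cases "0 \<le> y") (simp_all add: indicator_def)
  qed
  also have "(\<integral>y. complex_of_real (2 * pi * (indicator {0..} y *\<^sub>R ramp_quotient e (t - y))) \<partial>\<rho>)
      = 2 * pi * complex_of_real (LINT y:{0..}|\<rho>. ramp_quotient e (t - y))"
    unfolding integral_complex_of_real set_lebesgue_integral_def by simp
  finally show ?thesis .
qed

lemma distribution_between_smoothings:
  fixes \<rho> :: "real measure" and c t e :: real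
  assumes sets[measurable_cong, simp]: "sets \<rho> = sets borel"
    and c: "0 < c" and e: "0 < e"
    and int: "set_integrable \<rho> {0..} (\<lambda>y. exp (- c * y))"
  shows "(LINT y:{0..}|\<rho>. ramp_quotient (- e) (t - y)) \<le> measure \<rho> {0..t}"
    and "measure \<rho> {0..t} \<le> (LINT y:{0..}|\<rho>. ramp_quotient e (t - y))"
    and "emeasure \<rho> {0..t} < \<infinity>"
proof -
  \<comment> \<open>The exponential weight is the only integrability at hand, so everything is
    compared with it: the functions in question are at most 1 and vanish for y > t + e, and exp(c(t
    + e - y)) is at least 1 up to there.\<close>
  have bound: "set_integrable \<rho> {0..} g" if g: "g \<in> borel_measurable borel"
      and gb: "\<And>y. \<bar>g y\<bar> \<le> exp (c * (t + e - y))" for g :: "real \<Rightarrow> real"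
  proof -
    have [measurable]: "g \<in> borel_measurable \<rho>" using g by (simp cong: measurable_cong_sets)
    have "integrable \<rho> (\<lambda>y. exp (c * (t + e)) * (indicator {0..} y *\<^sub>R exp (- c * y)))"
      using int unfolding set_integrable_def by (intro integrable_mult_right)
    then show ?thesis unfolding set_integrable_def
      by (rule Bochner_Integration.integrable_bound)
        (use gb in \<open>auto simp: indicator_def algebra_simps simp flip: exp_add\<close>)
  qed
  have iK: "set_integrable \<rho> {0..} (\<lambda>y. ramp_quotient d (t - y))" if d: "d = e \<or> d = - e" for d
  proof (rule bound)
    show "(\<lambda>y. ramp_quotient d (t - y)) \<in> borel_measurable borel"
      unfolding ramp_quotient_def by measurable
    fix y
    have nz: "d \<noteq> 0" "\<bar>d\<bar> = e" using d e by auto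
    show "\<bar>ramp_quotient d (t - y)\<bar> \<le> exp (c * (t + e - y))"
    proof (cases "t - y + e < 0")
      case True then show ?thesis using ramp_quotient_bounds(3)[OF nz(1)] nz by simp
    next
      case False
      then have "1 \<le> exp (c * (t + e - y))" using c by simp
      then show ?thesis using ramp_quotient_bounds(1,2)[OF nz(1), of "t - y"] by linarith
    qed
  qed
  have iI: "set_integrable \<rho> {0..} (indicat_real {0..t})"
  proof (rule bound)
    fix y :: real
    show "\<bar>indicat_real {0..t} y\<bar> \<le> exp (c * (t + e - y))" using c e by (auto simp: indicator_def)
  qed simp
  have eqi: "indicator {0..} y *\<^sub>R indicat_real {0..t} y = indicator {0..t} y" for y :: real
    by (auto simp: indicator_def)
  have "integrable \<rho> (indicat_real {0..t})" using iI unfolding set_integrable_def eqi .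
  then show "emeasure \<rho> {0..t} < \<infinity>" by (simp add: integrable_indicator_iff less_top)
  have m: "measure \<rho> {0..t} = (LINT y:{0..}|\<rho>. indicat_real {0..t} y)"
    unfolding set_lebesgue_integral_def eqi by simp
  show "(LINT y:{0..}|\<rho>. ramp_quotient (- e) (t - y)) \<le> measure \<rho> {0..t}"
    unfolding m
  proof (rule set_integral_mono)
    fix y :: real assume "y \<in> {0..}"
    then show "ramp_quotient (- e) (t - y) \<le> indicat_real {0..t} y"
      using e ramp_quotient_bounds[of "-e" "t - y"] by (auto simp: indicator_def)
  qed (use iK iI in auto)
  show "measure \<rho> {0..t} \<le> (LINT y:{0..}|\<rho>. ramp_quotient e (t - y))"
    unfolding m
  proof (rule set_integral_mono)
    fix y :: real assume "y \<in> {0..}"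
    then show "indicat_real {0..t} y \<le> ramp_quotient e (t - y)"
      using e ramp_quotient_bounds[of e "t - y"] by (auto simp: indicator_def)
  qed (use iK iI in auto)
qed

text \<open>Mean value bound along the segment from 0 to w, on which |exp| is at most exp |Re w|.
  Only the real part enters the exponential, so the bound stays useful on vertical lines, where Im w
  is unbounded.\<close>

lemma norm_exp_minus_one_le:
  fixes w :: complex
  shows "norm (exp w - 1) \<le> norm w * exp \<bar>Re w\<bar>"
proof -
  have "norm (exp w - exp 0) \<le> exp \<bar>Re w\<bar> * norm (w - 0)"
  proof (rule field_differentiable_bound[of "closed_segment 0 w" exp exp])
    fix z assume "z \<in> closed_segment 0 w"
    then obtain u where "0 \<le> u" "u \<le> 1" "z = u *\<^sub>R w" by (auto simp: closed_segment_def)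
    then have "\<bar>Re z\<bar> \<le> \<bar>Re w\<bar>" by (simp add: abs_mult mult_left_le_one_le)
    then show "norm (exp z) \<le> exp \<bar>Re w\<bar>" by simp
  qed (auto intro: has_field_derivative_at_within DERIV_exp)
  then show ?thesis by (simp add: mult.commute)
qed

text \<open>The second-order companion: (exp w - 1)/w differs from 1 by O(|w|) for bounded w, which
  measures the effect of the smoothing on a residue.\<close>

lemma norm_exp_minus_one_minus_le:
  fixes w :: complex
  shows "norm (exp w - 1 - w) \<le> (norm w)\<^sup>2 * exp (norm w)"
proof -
  have "norm ((exp w - w) - (exp 0 - 0)) \<le> (norm w * exp (norm w)) * norm (w - 0)"
  proof (rule field_differentiable_bound[of "closed_segment 0 w" "\<lambda>w. exp w - w" "\<lambda>w. exp w - 1"])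
    fix z assume "z \<in> closed_segment 0 w"
    then obtain u where u: "0 \<le> u" "u \<le> 1" "z = u *\<^sub>R w" by (auto simp: closed_segment_def)
    then have nz: "norm z \<le> norm w" by (simp add: mult_left_le_one_le)
    then have "\<bar>Re z\<bar> \<le> norm w" using abs_Re_le_cmod[of z] by linarith
    then show "norm (exp z - 1) \<le> norm w * exp (norm w)"
      using norm_exp_minus_one_le[of z] nz
      by (meson exp_ge_zero exp_le_cancel_iff mult_mono norm_ge_zero order_trans)
  qed (auto intro!: derivative_eq_intros)
  then show ?thesis by (simp add: power2_eq_square mult_ac diff_diff_eq add.commute)
qed

text \<open>By partial fractions, ln(1 + x) - ln(1 + e(1 + x)) is a primitive on the positive axis,
  with limit -ln e at infinity. This is where the logarithm of the error bound arises.\<close>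

lemma nn_integral_log_kernel:
  fixes e :: real
  assumes e: "0 < e"
  shows "(\<integral>\<^sup>+x. ennreal (1 / ((1 + \<bar>x\<bar>) * (1 + e * (1 + \<bar>x\<bar>)))) \<partial>lborel) = ennreal (2 * ln ((1 + e) / e))"
proof -
  let ?h = "\<lambda>x::real. 1 / ((1 + \<bar>x\<bar>) * (1 + e * (1 + \<bar>x\<bar>)))"
  let ?k = "\<lambda>x::real. 1 / ((1 + x) * (1 + e * (1 + x)))"
  have half: "(\<integral>\<^sup>+x. ennreal (?k x) * indicator {0..} x \<partial>lborel) = ennreal (ln ((1 + e) / e))"
  proof -
    have "(\<integral>\<^sup>+x. ennreal (?k x) * indicator {0..} x \<partial>lborel)
       = ennreal (- ln e - (ln (1 + 0) - ln (1 + e * (1 + 0))))"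
    proof (rule nn_integral_FTC_atLeast)
      show "?k \<in> borel_measurable borel" by measurable
      fix x :: real assume x: "0 \<le> x"
      have p: "0 < 1 + e * (1 + x)" using e x by (simp add: add_pos_nonneg)
      show "((\<lambda>x. ln (1 + x) - ln (1 + e * (1 + x))) has_real_derivative ?k x) (at x)"
        using x e p by (auto intro!: derivative_eq_intros simp: field_simps)
      show "0 \<le> ?k x" using x p by simp
    next
      show "((\<lambda>x. ln (1 + x) - ln (1 + e * (1 + x))) \<longlongrightarrow> - ln e) at_top"
        using e by real_asymp
    qed
    then show ?thesis using e by (simp add: ln_div)
  qed
  have "(\<integral>\<^sup>+x. ennreal (?h x) \<partial>lborel)
      = (\<integral>\<^sup>+x. ennreal (?h x) * indicator {0..} x + ennreal (?h x) * indicator {..0} x \<partial>lborel)"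
  proof (rule nn_integral_cong_AE)
    have "AE x in lborel. x \<noteq> (0::real)" by (rule AE_lborel_singleton)
    then show "AE x in lborel. ennreal (?h x) = ennreal (?h x) * indicator {0..} x + ennreal (?h x) * indicator {..0} x"
      by eventually_elim (auto simp: indicator_def)
  qed
  also have "\<dots> = (\<integral>\<^sup>+x. ennreal (?h x) * indicator {0..} x \<partial>lborel) + (\<integral>\<^sup>+x. ennreal (?h x) * indicator {..0} x \<partial>lborel)"
    by (rule nn_integral_add) auto
  also have "(\<integral>\<^sup>+x. ennreal (?h x) * indicator {..0} x \<partial>lborel) = (\<integral>\<^sup>+x. ennreal (?h x) * indicator {0..} x \<partial>lborel)"
    using nn_integral_real_affine[of "\<lambda>x. ennreal (?h x) * indicator {..0} x" "-1" 0]
    by (simp add: indicator_def)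
  also have "(\<integral>\<^sup>+x. ennreal (?h x) * indicator {0..} x \<partial>lborel) = (\<integral>\<^sup>+x. ennreal (?k x) * indicator {0..} x \<partial>lborel)"
    by (rule nn_integral_cong) (auto simp: indicator_def)
  finally show ?thesis using half e by (simp flip: ennreal_plus)
qed

text \<open>Both residues are integrals over one circle about \<open>p\<close>, so poles of any
  order, and the point 0 as well, are treated alike. With w = ez the integrands differ by the second
  one times (exp w - 1 - w)/w, which is O(e) on the circle.\<close>

lemma residue_smoothing_difference:
  fixes R :: "complex \<Rightarrow> complex" and c :: real
  assumes U: "open U" "p \<in> U" and hR: "R holomorphic_on U - {p}"
    and nz: "\<And>z. z \<in> U - {p} \<Longrightarrow> z \<noteq> 0" and Re_le: "\<And>z. z \<in> U \<Longrightarrow> Re z \<le> c"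
  shows "\<exists>C\<ge>0. \<forall>e t. e \<noteq> 0 \<longrightarrow> \<bar>e\<bar> \<le> 1 \<longrightarrow> 0 \<le> t \<longrightarrow>
    norm (residue (\<lambda>z. exp (z * complex_of_real t) * (exp (complex_of_real e * z) - 1) / (complex_of_real e * z\<^sup>2) * R z) p
      - residue (\<lambda>z. exp (z * complex_of_real t) * R z / z) p) \<le> C * \<bar>e\<bar> * exp (c * t)"
proof -
  define f where "f e t z = exp (z * complex_of_real t) * (exp (complex_of_real e * z) - 1)
      / (complex_of_real e * z\<^sup>2) * R z" for e t z
  define f0 where "f0 t z = exp (z * complex_of_real t) * R z / z" for t z
  have hf: "f e t holomorphic_on U - {p}" if "e \<noteq> 0" for e t
    unfolding f_def using nz that by (intro holomorphic_intros hR) auto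
  have hf0: "f0 t holomorphic_on U - {p}" for t
    unfolding f0_def using nz by (intro holomorphic_intros hR) auto
  obtain r where r: "0 < r" "cball p r \<subseteq> U" using U open_contains_cball[of U] by auto
  have sph: "sphere p r \<subseteq> U - {p}"
  proof
    fix z assume "z \<in> sphere p r"
    then show "z \<in> U - {p}" using r subsetD[OF r(2), of z] by auto
  qed
  have nzs: "z \<noteq> 0" if "z \<in> sphere p r" for z by (rule nz, rule subsetD[OF sph that])
  have "continuous_on (sphere p r) (\<lambda>z. R z / z)"
    by (rule continuous_on_divide[OF holomorphic_on_imp_continuous_on[OF holomorphic_on_subset[OF hR sph]]
          continuous_on_id]) (rule ballI, rule nzs)
  then have "compact ((\<lambda>z. R z / z) ` sphere p r)"
    by (intro compact_continuous_image compact_sphere)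
  then have "bounded ((\<lambda>z. R z / z) ` sphere p r)"
    by (rule compact_imp_bounded)
  then obtain D where D': "\<forall>x\<in>(\<lambda>z. R z / z) ` sphere p r. norm x \<le> D"
    unfolding bounded_iff by (rule exE)
  have D: "norm (R z / z) \<le> D" if "z \<in> sphere p r" for z
    by (rule bspec[OF D']) (rule imageI[OF that])
  define L where "L = norm p + r"
  have L: "norm z \<le> L" if "z \<in> sphere p r" for z
  proof -
    have "norm (z - p) = r" using that by (simp add: dist_norm norm_minus_commute)
    then show ?thesis using norm_triangle_sub[of z p] unfolding L_def by linarith
  qed
  have L0: "0 \<le> L" using r by (simp add: L_def)
  \<comment> \<open>\<open>D\<close> bounds R(z)/z and |e| * \<open>L * exp L\<close> bounds the
    factor (exp w - 1 - w)/w; the radius is left from the length of the circle after division by 2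
    pi.\<close>
  define C where "C = L * exp L * \<bar>D\<bar> * r"
  have "norm (residue (f e t) p - residue (f0 t) p) \<le> C * \<bar>e\<bar> * exp (c * t)"
    if e: "e \<noteq> 0" "\<bar>e\<bar> \<le> 1" and t: "0 \<le> t" for e t
  proof -
    have i1: "(f e t has_contour_integral 2 * pi * \<i> * residue (f e t) p) (circlepath p r)"
      by (rule base_residue[OF U r(1) hf[OF e(1)] r(2)])
    have i2: "(f0 t has_contour_integral 2 * pi * \<i> * residue (f0 t) p) (circlepath p r)"
      by (rule base_residue[OF U r(1) hf0 r(2)])
    have "((\<lambda>z. f e t z - f0 t z) has_contour_integral
        2 * pi * \<i> * (residue (f e t) p - residue (f0 t) p)) (circlepath p r)"
      using has_contour_integral_diff[OF i1 i2] by (simp only: right_diff_distrib)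
    from this have "norm (2 * pi * \<i> * (residue (f e t) p - residue (f0 t) p))
        \<le> (L * exp L * \<bar>D\<bar> * \<bar>e\<bar> * exp (c * t)) * (2 * pi * r)"
    proof (rule has_contour_integral_bound_circlepath)
      fix z assume "norm (z - p) = r"
      then have z: "z \<in> sphere p r" by (simp add: dist_norm norm_minus_commute)
      define w where "w = complex_of_real e * z"
      have z0: "z \<noteq> 0" using nzs[OF z] .
      then have w0: "w \<noteq> 0" using e by (simp add: w_def)
      have fdiff: "f e t z - f0 t z = exp (z * complex_of_real t) * ((exp w - 1 - w) / w) * (R z / z)"
      proof -
        have "f e t z = exp (z * complex_of_real t) * ((exp w - 1) / w) * (R z / z)"
          by (simp add: f_def w_def power2_eq_square mult_ac)
        moreover have "f0 t z = exp (z * complex_of_real t) * 1 * (R z / z)"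
          by (simp add: f0_def)
        moreover have "(exp w - 1 - w) / w = (exp w - 1) / w - 1"
          using w0 by (simp add: diff_divide_distrib)
        ultimately show ?thesis by (simp only: left_diff_distrib right_diff_distrib)
      qed
      have n1: "norm (exp (z * complex_of_real t)) \<le> exp (c * t)"
      proof -
        have "z \<in> U" using z sph by blast
        then show ?thesis using Re_le[of z] t by (simp add: mult_right_mono)
      qed
      have n2: "norm ((exp w - 1 - w) / w) \<le> \<bar>e\<bar> * L * exp L"
      proof -
        have nw: "norm w \<le> \<bar>e\<bar> * L" using L[OF z] by (simp add: w_def norm_mult mult_left_mono)
        have nw': "norm w \<le> L" using nw mult_right_mono[OF e(2) L0] by simp
        have pw: "0 < norm w" using w0 by simp
        have "(norm w)\<^sup>2 * exp (norm w) = (norm w * exp (norm w)) * norm w"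
          by (simp only: power2_eq_square mult_ac)
        then have "norm (exp w - 1 - w) \<le> (norm w * exp (norm w)) * norm w"
          using norm_exp_minus_one_minus_le[of w] by (simp only:)
        then have "norm ((exp w - 1 - w) / w) \<le> norm w * exp (norm w)"
          unfolding norm_divide using pos_divide_le_eq[OF pw] by blast
        also have "\<dots> \<le> \<bar>e\<bar> * L * exp L" using nw nw' L0 by (intro mult_mono) auto
        finally show ?thesis .
      qed
      have n3: "norm (R z / z) \<le> \<bar>D\<bar>" using D[OF z] by linarith
      have "norm (f e t z - f0 t z) \<le> exp (c * t) * (\<bar>e\<bar> * L * exp L) * \<bar>D\<bar>"
        unfolding fdiff norm_mult[of _ "R z / z"] norm_mult[of "exp (z * complex_of_real t)"]
        by (intro mult_mono n1 n2 n3 mult_nonneg_nonneg L0) auto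
      also have "\<dots> = L * exp L * \<bar>D\<bar> * \<bar>e\<bar> * exp (c * t)" by (simp add: mult_ac)
      finally show "norm (f e t z - f0 t z) \<le> L * exp L * \<bar>D\<bar> * \<bar>e\<bar> * exp (c * t)" .
    qed (use r L0 in auto)
    also have "\<dots> = 2 * pi * (C * \<bar>e\<bar> * exp (c * t))" by (simp add: C_def)
    also have "norm (2 * pi * \<i> * (residue (f e t) p - residue (f0 t) p)) = 2 * pi * norm (residue (f e t) p - residue (f0 t) p)"
      by (simp add: norm_mult)
    finally show ?thesis by simp
  qed
  then have "\<forall>e t. e \<noteq> 0 \<longrightarrow> \<bar>e\<bar> \<le> 1 \<longrightarrow> 0 \<le> t \<longrightarrow>
      norm (residue (f e t) p - residue (f0 t) p) \<le> C * \<bar>e\<bar> * exp (c * t)"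
    by blast
  moreover have "0 \<le> C" using r L0 by (simp add: C_def)
  ultimately have "\<exists>C\<ge>0. \<forall>e t. e \<noteq> 0 \<longrightarrow> \<bar>e\<bar> \<le> 1 \<longrightarrow> 0 \<le> t \<longrightarrow>
      norm (residue (f e t) p - residue (f0 t) p) \<le> C * \<bar>e\<bar> * exp (c * t)"
    by (intro exI[of _ C] conjI)
  then show ?thesis unfolding f_def[abs_def] f0_def[abs_def] .
qed

text \<open>With w = ez and u = |w| the numerator |exp w - 1| is at most a constant times min(1, u).
  Hence the kernel is at most a multiple of 1/(|z|(1 + u)), whose integral is logarithmic. The line
  avoids 0 so that |z| is comparable to 1 + |x| on it.\<close>

lemma smoothed_line_integral_bound:
  fixes R :: "complex \<Rightarrow> complex" and a B1 :: real
  assumes a0: "a \<noteq> 0" and B1: "\<And>x. norm (R (Complex a x)) \<le> B1"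
  shows "\<exists>C\<ge>0. \<forall>e t. e \<noteq> 0 \<longrightarrow> \<bar>e\<bar> \<le> 1 \<longrightarrow>
    integrable lborel (\<lambda>x. exp (Complex a x * complex_of_real t) * (exp (complex_of_real e * Complex a x) - 1)
      / (complex_of_real e * (Complex a x)\<^sup>2) * R (Complex a x)) \<longrightarrow>
    norm (\<integral>x. exp (Complex a x * complex_of_real t) * (exp (complex_of_real e * Complex a x) - 1)
      / (complex_of_real e * (Complex a x)\<^sup>2) * R (Complex a x) \<partial>lborel)
      \<le> C * exp (a * t) * ln ((1 + \<bar>e\<bar>) / \<bar>e\<bar>)"
proof -
  define f where "f e t z = exp (z * complex_of_real t) * (exp (complex_of_real e * z) - 1)
      / (complex_of_real e * z\<^sup>2) * R z" for e t z
  define E where "E = exp \<bar>a\<bar> + 1"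
  \<comment> \<open>Since |z| is at least the mean of |a| and |x|, this choice gives |z| \<ge> m(1 +
    |x|) on the whole line.\<close>
  define m where "m = min 1 \<bar>a\<bar> / 2"
  define C1 where "C1 = 2 * (2 * E * \<bar>B1\<bar> / m\<^sup>2)"
  have m: "0 < m" "m \<le> 1" using a0 by (auto simp: m_def)
  have kernel_line: "norm (f e t (Complex a x)) \<le> exp (a * t) * (2 * E * \<bar>B1\<bar> / m\<^sup>2)
      * (1 / ((1 + \<bar>x\<bar>) * (1 + \<bar>e\<bar> * (1 + \<bar>x\<bar>))))"
    if e: "e \<noteq> 0" "\<bar>e\<bar> \<le> 1" for e t x
  proof -
    define z where "z = Complex a x"
    define w where "w = complex_of_real e * z"
    define u where "u = \<bar>e\<bar> * norm z"
    have "\<bar>a\<bar> \<le> norm z" "\<bar>x\<bar> \<le> norm z"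
      using abs_Re_le_cmod[of z] abs_Im_le_cmod[of z] by (auto simp: z_def)
    moreover have "2 * (m * (1 + \<bar>x\<bar>)) \<le> \<bar>a\<bar> + \<bar>x\<bar>"
    proof -
      have "2 * m \<le> \<bar>a\<bar>" "2 * m \<le> 1" by (auto simp: m_def)
      then show ?thesis using mult_right_mono[of "2 * m" 1 "\<bar>x\<bar>"] by (simp add: algebra_simps)
    qed
    ultimately have zm: "m * (1 + \<bar>x\<bar>) \<le> norm z" by linarith
    have mp: "0 < m * (1 + \<bar>x\<bar>)" using m by (intro mult_pos_pos) auto
    then have z0: "0 < norm z" using zm by linarith
    have u0: "0 < u" using z0 e by (simp add: u_def)
    have nw: "norm w = u" by (simp add: w_def u_def norm_mult)
    have rw: "\<bar>Re w\<bar> \<le> \<bar>a\<bar>" using e mult_right_mono[OF e(2), of "\<bar>a\<bar>"] by (simp add: w_def z_def abs_mult)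
    have w1: "norm (exp w - 1) \<le> u * E"
    proof -
      have "norm (exp w - 1) \<le> u * exp \<bar>a\<bar>"
        using norm_exp_minus_one_le[of w] rw u0
        by (smt (verit) exp_le_cancel_iff mult_left_mono nw)
      then show ?thesis using u0 by (simp add: E_def algebra_simps)
    qed
    have w2: "norm (exp w - 1) \<le> E"
      unfolding E_def using rw by (intro order_trans[OF norm_triangle_ineq4]) (simp add: abs_le_iff)
    have E0: "0 < E" by (simp add: E_def add_pos_pos)
    \<comment> \<open>The bound \<open>u * E\<close> serves u \<le> 1 and the bound \<open>E\<close>
      serves u > 1; both fit under 2 E u / (1 + u).\<close>
    have w3: "norm (exp w - 1) * (1 + u) \<le> 2 * E * u"
    proof (cases "u \<le> 1")
      case True
      have "norm (exp w - 1) * (1 + u) \<le> (u * E) * 2" using w1 True u0 E0 by (intro mult_mono) auto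
      then show ?thesis by (simp add: mult_ac)
    next
      case False
      have "norm (exp w - 1) * (1 + u) \<le> E * (2 * u)" using w2 False u0 E0 by (intro mult_mono) auto
      then show ?thesis by (simp add: mult_ac)
    qed
    have den: "m\<^sup>2 * ((1 + \<bar>x\<bar>) * (1 + \<bar>e\<bar> * (1 + \<bar>x\<bar>))) \<le> norm z * (1 + u)"
    proof -
      have "m * (1 + \<bar>e\<bar> * (1 + \<bar>x\<bar>)) \<le> 1 + u"
      proof -
        have "\<bar>e\<bar> * (m * (1 + \<bar>x\<bar>)) \<le> u" unfolding u_def using zm by (intro mult_left_mono) auto
        then show ?thesis using m by (simp add: algebra_simps)
      qed
      then have "(m * (1 + \<bar>x\<bar>)) * (m * (1 + \<bar>e\<bar> * (1 + \<bar>x\<bar>))) \<le> norm z * (1 + u)"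
        using zm mp m by (intro mult_mono) auto
      then show ?thesis by (simp add: power2_eq_square mult_ac)
    qed
    have dp: "0 < m\<^sup>2 * ((1 + \<bar>x\<bar>) * (1 + \<bar>e\<bar> * (1 + \<bar>x\<bar>)))"
      using m by (intro mult_pos_pos add_pos_nonneg) auto
    have "norm (f e t z) = exp (a * t) * (norm (exp w - 1) / (u * norm z)) * norm (R z)"
      by (simp add: f_def norm_mult norm_divide norm_power u_def w_def z_def power2_eq_square)
    also have "norm (exp w - 1) / (u * norm z) \<le> 2 * E / (norm z * (1 + u))"
    proof -
      have "norm (exp w - 1) \<le> 2 * E * u / (1 + u)" using w3 u0 by (simp add: pos_le_divide_eq)
      then have "norm (exp w - 1) / (u * norm z) \<le> 2 * E * u / (1 + u) / (u * norm z)"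
        using u0 z0 by (intro divide_right_mono) auto
      also have "\<dots> = 2 * E / (norm z * (1 + u))" using u0 z0 by (simp add: divide_simps)
      finally show ?thesis .
    qed
    also have "\<dots> \<le> 2 * E / (m\<^sup>2 * ((1 + \<bar>x\<bar>) * (1 + \<bar>e\<bar> * (1 + \<bar>x\<bar>))))"
      using frac_le[OF _ order_refl dp den, of "2 * E"] E0 by simp
    finally have "norm (f e t z) \<le> exp (a * t) * (2 * E / (m\<^sup>2 * ((1 + \<bar>x\<bar>) * (1 + \<bar>e\<bar> * (1 + \<bar>x\<bar>))))) * norm (R z)"
      by (simp add: mult_left_mono mult_right_mono)
    also have "\<dots> \<le> exp (a * t) * (2 * E / (m\<^sup>2 * ((1 + \<bar>x\<bar>) * (1 + \<bar>e\<bar> * (1 + \<bar>x\<bar>))))) * \<bar>B1\<bar>"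
      using B1[of x] dp E0 by (intro mult_left_mono mult_nonneg_nonneg) (auto simp: z_def)
    finally show ?thesis by (simp add: z_def field_simps)
  qed
  have line_bound: "norm (\<integral>x. f e t (Complex a x) \<partial>lborel) \<le> C1 * exp (a * t) * ln ((1 + \<bar>e\<bar>) / \<bar>e\<bar>)"
    if e: "e \<noteq> 0" "\<bar>e\<bar> \<le> 1" and int: "integrable lborel (\<lambda>x. f e t (Complex a x))" for e t
  proof -
    define D where "D = exp (a * t) * (2 * E * \<bar>B1\<bar> / m\<^sup>2)"
    have D: "0 \<le> D" by (simp add: D_def E_def add_nonneg_nonneg)
    have kl: "norm (f e t (Complex a x)) \<le> D * (1 / ((1 + \<bar>x\<bar>) * (1 + \<bar>e\<bar> * (1 + \<bar>x\<bar>))))" for x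
      unfolding D_def by (rule kernel_line[OF e])
    have ln0: "0 \<le> ln ((1 + \<bar>e\<bar>) / \<bar>e\<bar>)" using e by (intro ln_ge_zero) (simp add: field_simps)
    have "ennreal (norm (\<integral>x. f e t (Complex a x) \<partial>lborel)) \<le> (\<integral>\<^sup>+x. ennreal (norm (f e t (Complex a x))) \<partial>lborel)"
      using int by (rule integral_norm_bound_ennreal)
    also have "\<dots> \<le> (\<integral>\<^sup>+x. ennreal D * ennreal (1 / ((1 + \<bar>x\<bar>) * (1 + \<bar>e\<bar> * (1 + \<bar>x\<bar>)))) \<partial>lborel)"
      by (intro nn_integral_mono) (simp only: ennreal_mult'[OF D, symmetric] ennreal_leI[OF kl])
    also have "\<dots> = ennreal D * ennreal (2 * ln ((1 + \<bar>e\<bar>) / \<bar>e\<bar>))"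
      using e by (subst nn_integral_cmult) (auto simp: nn_integral_log_kernel)
    also have "\<dots> = ennreal (C1 * exp (a * t) * ln ((1 + \<bar>e\<bar>) / \<bar>e\<bar>))"
    proof -
      have "D * (2 * ln ((1 + \<bar>e\<bar>) / \<bar>e\<bar>)) = C1 * exp (a * t) * ln ((1 + \<bar>e\<bar>) / \<bar>e\<bar>)"
        by (simp add: D_def C1_def)
      then show ?thesis by (simp only: ennreal_mult'[OF D, symmetric])
    qed
    finally show ?thesis
    proof (rule ennreal_le_iff[THEN iffD1, rotated])
      have "C1 * exp (a * t) = 2 * D" by (simp add: C1_def D_def)
      then show "0 \<le> C1 * exp (a * t) * ln ((1 + \<bar>e\<bar>) / \<bar>e\<bar>)" using D ln0 by simp
    qed
  qed
  moreover have "0 \<le> C1" using m by (simp add: C1_def E_def add_nonneg_nonneg)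
  ultimately have "\<exists>C\<ge>0. \<forall>e t. e \<noteq> 0 \<longrightarrow> \<bar>e\<bar> \<le> 1 \<longrightarrow> integrable lborel (\<lambda>x. f e t (Complex a x)) \<longrightarrow>
      norm (\<integral>x. f e t (Complex a x) \<partial>lborel) \<le> C * exp (a * t) * ln ((1 + \<bar>e\<bar>) / \<bar>e\<bar>)"
    by (intro exI[of _ C1] conjI allI impI)
  then show ?thesis unfolding f_def[abs_def] .
qed

text \<open>By \<open>a0\<close> the point 0 lies either strictly between the two lines, and then
  joins the singularities \<open>pts\<close>, or outside the strip of holomorphy; it is never on the
  line Re z = a. The residues in the conclusion belong to the unsmoothed kernel, so the smoothing
  width enters only the error.\<close>

lemma distribution_asymptotics:
  fixes \<rho> :: "real measure" and R :: "complex \<Rightarrow> complex" and a a' b' c T B :: real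
  assumes sets: "sets \<rho> = sets borel" and sf: "sigma_finite_measure \<rho>"
    and int: "set_integrable \<rho> {0..} (\<lambda>y. exp (- c * y))"
    and ord: "a' < a" "a < c" "c < b'" "0 < c" and a0: "a < 0 \<or> 0 < a \<and> 0 \<le> a'"
    and fin: "finite \<Lambda>" and \<Lambda>: "\<And>p. p \<in> \<Lambda> \<Longrightarrow> a < Re p \<and> Re p < c"
    and hol: "R holomorphic_on {z. a' < Re z \<and> Re z < b'} - \<Lambda>"
    and bnd: "\<And>z. a \<le> Re z \<Longrightarrow> Re z \<le> c \<Longrightarrow> T \<le> \<bar>Im z\<bar> \<Longrightarrow> norm (R z) \<le> B"
    and lap: "\<And>x. R (Complex c x) = (LINT y:{0..}|\<rho>. exp (- Complex c x * complex_of_real y))"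
  defines "pts \<equiv> \<Lambda> \<union> (if a < 0 then {0} else {})"
  shows "\<exists>K. \<forall>t\<ge>1. norm (complex_of_real (measure \<rho> {0..t})
      - (\<Sum>p\<in>pts. residue (\<lambda>z. exp (z * complex_of_real t) * R z / z) p)) \<le> K * t * exp (a * t)"
proof -
  let ?S = "{z. a' < Re z \<and> Re z < b'}"
  define f where "f e t z = exp (z * complex_of_real t) * (exp (complex_of_real e * z) - 1)
      / (complex_of_real e * z\<^sup>2) * R z" for e t z
  define f0 where "f0 t z = exp (z * complex_of_real t) * R z / z" for t z
  have nz: "z \<noteq> 0" if "z \<in> ?S - pts" for z using that a0 by (auto simp: pts_def split: if_splits)
  have hR: "R holomorphic_on ?S - pts" using hol by (rule holomorphic_on_subset) (auto simp: pts_def)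
  have hf: "f e t holomorphic_on ?S - pts" if "e \<noteq> 0" for e t
    unfolding f_def using nz that by (intro holomorphic_intros hR) auto
  have hf0: "f0 t holomorphic_on ?S - pts" for t
    unfolding f0_def using nz by (intro holomorphic_intros hR) auto
  have finp: "finite pts" using fin by (simp add: pts_def)
  have pts: "a < Re p \<and> Re p < c" if "p \<in> pts" for p
    using that \<Lambda> ord by (auto simp: pts_def split: if_splits)
  have ptsS: "pts \<subseteq> ?S" using pts ord by fastforce
  have line: "Complex a x \<in> ?S - pts" for x using ord pts[of "Complex a x"] by auto
  have cline: "continuous_on UNIV (\<lambda>x. R (Complex a x))"
    by (rule continuous_on_compose2[OF holomorphic_on_imp_continuous_on[OF hR]])
      (use line in \<open>auto simp: Complex_eq intro!: continuous_intros\<close>)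
  \<comment> \<open>Hypothesis \<open>bnd\<close> speaks only of heights from \<open>T\<close> on;
    below, the bound comes from continuity on a compact segment.\<close>
  obtain B1 where B1: "\<And>x. norm (R (Complex a x)) \<le> B1"
  proof -
    have "compact ((\<lambda>x. R (Complex a x)) ` {- \<bar>T\<bar>..\<bar>T\<bar>})"
      by (intro compact_continuous_image continuous_on_subset[OF cline]) auto
    then obtain K where K: "\<And>x. x \<in> {- \<bar>T\<bar>..\<bar>T\<bar>} \<Longrightarrow> norm (R (Complex a x)) \<le> K"
      by (metis bounded_iff compact_imp_bounded imageI)
    have "norm (R (Complex a x)) \<le> max B K" for x
    proof (cases "x \<in> {- \<bar>T\<bar>..\<bar>T\<bar>}")
      case False
      then have "T \<le> \<bar>x\<bar>" by auto
      then show ?thesis using bnd[of "Complex a x"] ord by auto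
    qed (use K in force)
    then show ?thesis using that by blast
  qed
  \<comment> \<open>This bound blows up as e tends to 0. It only justifies the contour shift for
    fixed e and t; the quantitative estimate is \<open>line_bound\<close>.\<close>
  have bound_f: "norm (f e t z) \<le> exp (c * t) * (exp (\<bar>a\<bar> + c) + 1) * B / \<bar>e\<bar> / (Im z)\<^sup>2"
    if z: "a \<le> Re z" "Re z \<le> c" "max T 1 \<le> \<bar>Im z\<bar>" and e: "e \<noteq> 0" "\<bar>e\<bar> \<le> 1" and t: "0 \<le> t" for e t z
  proof -
    have e1: "norm (exp (z * complex_of_real t)) \<le> exp (c * t)"
      using z t by (simp add: mult_right_mono)
    have "\<bar>Re z\<bar> \<le> \<bar>a\<bar> + c" using z ord by linarith
    then have "\<bar>e\<bar> * \<bar>Re z\<bar> \<le> 1 * (\<bar>a\<bar> + c)" using e by (intro mult_mono) auto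
    then have "e * Re z \<le> \<bar>a\<bar> + c" by (metis abs_ge_self abs_mult mult_1 order_trans)
    then have e2: "norm (exp (complex_of_real e * z) - 1) \<le> exp (\<bar>a\<bar> + c) + 1"
      by (intro order_trans[OF norm_triangle_ineq4]) simp
    have R: "norm (R z) \<le> B" using bnd[of z] z by simp
    have i: "0 < (Im z)\<^sup>2" using z(3) by auto
    have i2: "(Im z)\<^sup>2 \<le> (norm z)\<^sup>2" by (simp add: cmod_power2)
    have "norm (f e t z) = (norm (exp (z * complex_of_real t)) * norm (exp (complex_of_real e * z) - 1) * norm (R z)) / (\<bar>e\<bar> * (norm z)\<^sup>2)"
      by (simp add: f_def norm_mult norm_divide norm_power)
    also have "\<dots> \<le> (exp (c * t) * (exp (\<bar>a\<bar> + c) + 1) * B) / (\<bar>e\<bar> * (Im z)\<^sup>2)"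
      using e1 e2 R i i2 e order_trans[OF norm_ge_zero R]
      by (intro frac_le mult_mono mult_nonneg_nonneg mult_pos_pos mult_left_mono add_nonneg_nonneg) auto
    finally show ?thesis by simp
  qed
  have a00: "a \<noteq> 0" using a0 by auto
  from smoothed_line_integral_bound[of a R, OF a00 B1] obtain C1 where C1: "0 \<le> C1" and
    line_bound': "\<forall>e t. e \<noteq> 0 \<longrightarrow> \<bar>e\<bar> \<le> 1 \<longrightarrow> integrable lborel (\<lambda>x. f e t (Complex a x)) \<longrightarrow>
      norm (\<integral>x. f e t (Complex a x) \<partial>lborel) \<le> C1 * exp (a * t) * ln ((1 + \<bar>e\<bar>) / \<bar>e\<bar>)"
    unfolding f_def[abs_def] by (elim exE conjE)
  have line_bound: "norm (\<integral>x. f e t (Complex a x) \<partial>lborel) \<le> C1 * exp (a * t) * ln ((1 + \<bar>e\<bar>) / \<bar>e\<bar>)"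
    if "e \<noteq> 0" "\<bar>e\<bar> \<le> 1" "integrable lborel (\<lambda>x. f e t (Complex a x))" for e t
    using line_bound' that by blast
  have "\<exists>C\<ge>0. \<forall>e t. e \<noteq> 0 \<longrightarrow> \<bar>e\<bar> \<le> 1 \<longrightarrow> 0 \<le> t \<longrightarrow> norm (residue (f e t) p - residue (f0 t) p) \<le> C * \<bar>e\<bar> * exp (c * t)"
    if p: "p \<in> pts" for p
  proof -
    \<comment> \<open>The other singularities are removed, so that \<open>p\<close> is the only one
      left in the open set.\<close>
    define U where "U = {z. a < Re z \<and> Re z < c} - (pts - {p})"
    have "closed (pts - {p})" using finp by (simp add: finite_imp_closed)
    then have U: "open U" unfolding U_def
      by (intro open_Diff open_Collect_conj open_halfspace_Re_gt open_halfspace_Re_lt)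
    have pU: "p \<in> U" using pts[OF p] by (auto simp: U_def)
    have US: "U - {p} \<subseteq> ?S - pts" using ord unfolding U_def by (intro subsetI) auto
    show ?thesis unfolding f_def[abs_def] f0_def[abs_def]
    proof (rule residue_smoothing_difference[OF U pU holomorphic_on_subset[OF hR US]])
      show "z \<noteq> 0" if "z \<in> U - {p}" for z by (rule nz, rule subsetD[OF US that])
      show "Re z \<le> c" if "z \<in> U" for z using that by (simp add: U_def)
    qed
  qed
  then have "\<forall>p\<in>pts. \<exists>C. 0 \<le> C \<and> (\<forall>e t. e \<noteq> 0 \<longrightarrow> \<bar>e\<bar> \<le> 1 \<longrightarrow> 0 \<le> t \<longrightarrow>
      norm (residue (f e t) p - residue (f0 t) p) \<le> C * \<bar>e\<bar> * exp (c * t))"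
    by blast
  from bchoice[OF this] obtain C where C': "\<forall>p\<in>pts. 0 \<le> C p \<and> (\<forall>e t. e \<noteq> 0 \<longrightarrow> \<bar>e\<bar> \<le> 1 \<longrightarrow> 0 \<le> t \<longrightarrow>
      norm (residue (f e t) p - residue (f0 t) p) \<le> C p * \<bar>e\<bar> * exp (c * t))" ..
  then have C: "0 \<le> C p"
    "e \<noteq> 0 \<Longrightarrow> \<bar>e\<bar> \<le> 1 \<Longrightarrow> 0 \<le> t \<Longrightarrow>
       norm (residue (f e t) p - residue (f0 t) p) \<le> C p * \<bar>e\<bar> * exp (c * t)" if "p \<in> pts" for p e t
    using that by blast+
  define C2 where "C2 = (\<Sum>p\<in>pts. C p)"
  define K where "K = C1 * (1 + (c - a)) + C2"
  have C2: "0 \<le> C2" using C(1) by (simp add: C2_def sum_nonneg)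
  have "norm (complex_of_real (measure \<rho> {0..t}) - (\<Sum>p\<in>pts. residue (f0 t) p)) \<le> 3 * K * t * exp (a * t)"
    if t: "1 \<le> t" for t
  proof -
    define Q where "Q = (\<Sum>p\<in>pts. residue (f0 t) p)"
    define A where "A e = (LINT y:{0..}|\<rho>. ramp_quotient e (t - y))" for e
    define e where "e = exp (- (c - a) * t)"
    have "0 \<le> (c - a) * t" using ord t by simp
    then have e: "0 < e" "e \<le> 1" by (simp_all add: e_def algebra_simps)
    have ln: "ln ((1 + e) / e) \<le> (1 + (c - a)) * t"
    proof -
      have "ln (1 + e) \<le> 1" using ln_add_one_self_le_self[of e] e by linarith
      moreover have "ln ((1 + e) / e) = ln (1 + e) - ln e" using e by (simp add: ln_div)
      moreover have "ln e = - (c - a) * t" by (simp add: e_def)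
      ultimately have "ln ((1 + e) / e) \<le> 1 + (c - a) * t" by linarith
      also have "\<dots> \<le> (1 + (c - a)) * t" using t by (simp add: distrib_right)
      finally show ?thesis .
    qed
    have main: "norm (complex_of_real (A d) - Q) \<le> K * t * exp (a * t)" if d: "\<bar>d\<bar> = e" for d
    proof -
      define S where "S = C1 * exp (a * t) * ((1 + (c - a)) * t)"
      have S: "0 \<le> S" using C1 ord t by (simp add: S_def)
      have d0: "d \<noteq> 0" "\<bar>d\<bar> \<le> 1" using d e by auto
      have t0: "0 \<le> t" using t by simp
      have bf: "norm (f d t z) \<le> exp (c * t) * (exp (\<bar>a\<bar> + c) + 1) * B / \<bar>d\<bar> / (Im z)\<^sup>2"
        if "a \<le> Re z" "Re z \<le> c" "max T 1 \<le> \<bar>Im z\<bar>" for z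
        using that by (rule bound_f[OF _ _ _ d0 t0])
      have shift: "integrable lborel (\<lambda>x. f d t (Complex a x))"
        "(\<integral>x. f d t (Complex c x) \<partial>lborel) - (\<integral>x. f d t (Complex a x) \<partial>lborel) = 2 * pi * (\<Sum>p\<in>pts. residue (f d t) p)"
        by (rule vertical_line_shift(1,3)[OF ord(1,2,3) finp pts hf[OF d0(1)] bf]; assumption)+
      have "(\<integral>x. f d t (Complex c x) \<partial>lborel) = 2 * pi * complex_of_real (A d)"
        unfolding f_def lap A_def using ord(4) d0(1) int by (intro smoothed_measure_inversion sets sf)
      then have "2 * pi * complex_of_real (A d) - (\<integral>x. f d t (Complex a x) \<partial>lborel) = 2 * pi * (\<Sum>p\<in>pts. residue (f d t) p)"
        using shift(2) by simp
      moreover have "2 * pi * (\<Sum>p\<in>pts. residue (f d t) p - residue (f0 t) p) = 2 * pi * (\<Sum>p\<in>pts. residue (f d t) p) - 2 * pi * Q"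
        unfolding Q_def sum_subtractf by (rule right_diff_distrib)
      ultimately have "2 * pi * (complex_of_real (A d) - Q) = (\<integral>x. f d t (Complex a x) \<partial>lborel)
           + 2 * pi * (\<Sum>p\<in>pts. residue (f d t) p - residue (f0 t) p)"
        by (simp add: right_diff_distrib diff_eq_eq)
      then have "norm (2 * pi * (complex_of_real (A d) - Q)) \<le> norm (\<integral>x. f d t (Complex a x) \<partial>lborel)
           + norm (2 * pi * (\<Sum>p\<in>pts. residue (f d t) p - residue (f0 t) p))"
        by (simp only: norm_triangle_ineq)
      also have "\<dots> \<le> C1 * exp (a * t) * ln ((1 + e) / e) + 2 * pi * (C2 * e * exp (c * t))"
      proof (rule add_mono)
        show "norm (\<integral>x. f d t (Complex a x) \<partial>lborel) \<le> C1 * exp (a * t) * ln ((1 + e) / e)"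
          using line_bound[OF d0 shift(1)] d by simp
        have "norm (\<Sum>p\<in>pts. residue (f d t) p - residue (f0 t) p) \<le> (\<Sum>p\<in>pts. C p * e * exp (c * t))"
          unfolding d[symmetric] by (rule sum_norm_le) (rule C(2)[OF _ d0 t0])
        then show "norm (2 * pi * (\<Sum>p\<in>pts. residue (f d t) p - residue (f0 t) p)) \<le> 2 * pi * (C2 * e * exp (c * t))"
          unfolding C2_def sum_distrib_right by (simp add: norm_mult)
      qed
      finally have 1: "norm (2 * pi * (complex_of_real (A d) - Q))
          \<le> C1 * exp (a * t) * ln ((1 + e) / e) + 2 * pi * (C2 * e * exp (c * t))" .
      have 2: "C2 * e * exp (c * t) = C2 * exp (a * t)"
      proof -
        have "- (c - a) * t + c * t = a * t" by (simp add: algebra_simps)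
        then show ?thesis unfolding e_def mult.assoc exp_add[symmetric] by simp
      qed
      have 3: "C1 * exp (a * t) * ln ((1 + e) / e) \<le> S"
        unfolding S_def using ln C1 by (intro mult_left_mono) auto
      have 4: "S \<le> 2 * pi * S"
        using mult_right_mono[of 1 "2 * pi" S] S pi_gt3 by simp
      have 5: "norm (2 * pi * (complex_of_real (A d) - Q)) = 2 * pi * norm (complex_of_real (A d) - Q)"
        by (simp add: norm_mult)
      have 6: "2 * pi * (S + C2 * exp (a * t)) = 2 * pi * S + 2 * pi * (C2 * exp (a * t))"
        by (rule distrib_left)
      have "2 * pi * norm (complex_of_real (A d) - Q) \<le> 2 * pi * (S + C2 * exp (a * t))"
        using 1 3 4 unfolding 2 5 6 by linarith
      then have 7: "norm (complex_of_real (A d) - Q) \<le> S + C2 * exp (a * t)"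
        by simp
      have 8: "C2 * exp (a * t) \<le> C2 * exp (a * t) * t"
        using mult_left_mono[OF t, of "C2 * exp (a * t)"] C2 by simp
      have "K * t * exp (a * t) = S + C2 * exp (a * t) * t"
        by (simp add: S_def K_def distrib_right distrib_left)
      then show ?thesis using 7 8 by linarith
    qed
    have m1: "norm (complex_of_real (A e) - Q) \<le> K * t * exp (a * t)"
      and m2: "norm (complex_of_real (A (- e)) - Q) \<le> K * t * exp (a * t)"
      using main[of e] main[of "- e"] e by auto
    have "A (- e) \<le> measure \<rho> {0..t}" "measure \<rho> {0..t} \<le> A e"
      unfolding A_def using distribution_between_smoothings[OF sets ord(4) e(1) int] by auto
    \<comment> \<open>Both smoothings are close to the same \<open>Q\<close>, hence to each other.
      The measure lies between them, so it is within twice the error of \<open>A e\<close> and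
      within three times the error of \<open>Q\<close>.\<close>
    moreover have "norm ((complex_of_real (A e) - Q) - (complex_of_real (A (- e)) - Q)) \<le> 2 * (K * t * exp (a * t))"
      by (rule order_trans[OF norm_triangle_ineq4]) (use m1 m2 in linarith)
    then have "norm (complex_of_real (A e - A (- e))) \<le> 2 * (K * t * exp (a * t))"
      by simp
    ultimately have "norm (complex_of_real (measure \<rho> {0..t} - A e)) \<le> 2 * (K * t * exp (a * t))"
      unfolding norm_of_real by linarith
    then have "norm (complex_of_real (measure \<rho> {0..t} - A e) + (complex_of_real (A e) - Q)) \<le> 3 * (K * t * exp (a * t))"
      using m1 by (intro order_trans[OF norm_triangle_ineq]) linarith
    then show ?thesis by (simp add: Q_def mult.assoc)
  qed
  then have "\<forall>t\<ge>1. norm (complex_of_real (measure \<rho> {0..t}) - (\<Sum>p\<in>pts. residue (f0 t) p)) \<le> 3 * K * t * exp (a * t)"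
    by blast
  then show ?thesis unfolding f0_def[abs_def] by (rule exI)
qed

section \<open>Laplace transforms of measures and matrix inverses\<close>

lemma laplace_transform_bound:
  fixes \<nu> :: "real measure" and \<sigma> :: real
  assumes sets[measurable_cong, simp]: "sets \<nu> = sets borel" and int: "set_integrable \<nu> {0..} (\<lambda>x. exp (- \<sigma> * x))"
    and z: "\<sigma> \<le> Re z"
  shows "set_integrable \<nu> {0..} (\<lambda>x. exp (- z * complex_of_real x))"
    and "norm (LINT x:{0..}|\<nu>. exp (- z * complex_of_real x)) \<le> (LINT x:{0..}|\<nu>. exp (- \<sigma> * x))"
proof -
  have le: "norm (indicator {0..} x *\<^sub>R exp (- z * complex_of_real x)) \<le> indicator {0..} x *\<^sub>R exp (- \<sigma> * x)" for x
    using mult_right_mono[OF z, of x] by (auto simp: indicator_def)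
  show int': "set_integrable \<nu> {0..} (\<lambda>x. exp (- z * complex_of_real x))"
    using int unfolding set_integrable_def
    by (rule Bochner_Integration.integrable_bound) (use order_trans[OF le abs_ge_self] in auto)
  show "norm (LINT x:{0..}|\<nu>. exp (- z * complex_of_real x)) \<le> (LINT x:{0..}|\<nu>. exp (- \<sigma> * x))"
    using int int' le unfolding set_lebesgue_integral_def set_integrable_def
    by (intro Bochner_Integration.integral_norm_bound_integral) auto
qed

text \<open>Differentiation under the integral by dominated convergence along sequences. The gap 2d
  between Re z and \<sigma> is spent in halves: one d pays for moving to points near z, the other
  absorbs a factor x through x \<le> exp(dx)/d. This gives the majorant (1/d) exp(-\<sigma>
  x).\<close>

lemma laplace_transform_holomorphic:
  fixes \<nu> :: "real measure" and \<sigma> :: real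
  assumes sets[measurable_cong, simp]: "sets \<nu> = sets borel" and int: "set_integrable \<nu> {0..} (\<lambda>x. exp (- \<sigma> * x))"
  shows "(\<lambda>z. LINT x:{0..}|\<nu>. exp (- z * complex_of_real x)) holomorphic_on {z. \<sigma> < Re z}"
proof -
  let ?f = "\<lambda>z. LINT x:{0..}|\<nu>. exp (- z * complex_of_real x)"
  have "\<exists>D. (?f has_field_derivative D) (at z)" if z: "\<sigma> < Re z" for z
  proof -
    define d where "d = (Re z - \<sigma>) / 2"
    have d: "0 < d" "Re z - d = \<sigma> + d" using z by (auto simp: d_def field_simps)
    let ?D = "LINT x:{0..}|\<nu>. - complex_of_real x * exp (- z * complex_of_real x)"
    have "((\<lambda>w. (?f w - ?f z) / (w - z)) \<longlongrightarrow> ?D) (at z)"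
      unfolding tendsto_at_iff_sequentially
    proof (intro allI impI)
      fix X :: "nat \<Rightarrow> complex" assume X: "\<forall>i. X i \<in> UNIV - {z}" "X \<longlonglongrightarrow> z"
      have "\<forall>\<^sub>F n in sequentially. dist (X n) z < d" using tendstoD[OF X(2) d(1)] .
      then obtain N where N: "\<And>n. n \<ge> N \<Longrightarrow> dist (X n) z < d" by (auto simp: eventually_sequentially)
      \<comment> \<open>Dropping the first terms makes the majorant valid for every index, as
        dominated convergence requires.\<close>
      define Y where "Y n = X (n + N)" for n
      have Y: "Y n \<noteq> z" "norm (Y n - z) < d" for n using X(1) N[of "n + N"] by (auto simp: Y_def dist_norm)
      have Yl: "Y \<longlonglongrightarrow> z" unfolding Y_def using X(2) by (rule LIMSEQ_ignore_initial_segment)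
      let ?q = "\<lambda>n x. (exp (- Y n * complex_of_real x) - exp (- z * complex_of_real x)) / (Y n - z)"
      have "(\<lambda>n. LINT x:{0..}|\<nu>. ?q n x) \<longlonglongrightarrow> ?D"
        unfolding set_lebesgue_integral_def
      proof (rule integral_dominated_convergence[where w="\<lambda>x. (1 / d) * (indicator {0..} x *\<^sub>R exp (- \<sigma> * x))"])
        show "AE x in \<nu>. (\<lambda>n. indicator {0..} x *\<^sub>R ?q n x) \<longlonglongrightarrow> indicator {0..} x *\<^sub>R (- complex_of_real x * exp (- z * complex_of_real x))"
        proof (intro AE_I2 tendsto_scaleR tendsto_const)
          fix x :: real
          have "((\<lambda>w. exp (- w * complex_of_real x)) has_field_derivative - complex_of_real x * exp (- z * complex_of_real x)) (at z)"
            by (auto intro!: derivative_eq_intros)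
          then have "((\<lambda>w. (exp (- w * complex_of_real x) - exp (- z * complex_of_real x)) / (w - z)) \<longlongrightarrow> - complex_of_real x * exp (- z * complex_of_real x)) (at z)"
            by (simp add: has_field_derivative_iff)
          then show "(\<lambda>n. ?q n x) \<longlonglongrightarrow> - complex_of_real x * exp (- z * complex_of_real x)"
            unfolding tendsto_at_iff_sequentially using Y(1) Yl by (auto simp: o_def)
        qed
        show "AE x in \<nu>. norm (indicator {0..} x *\<^sub>R ?q n x) \<le> (1 / d) * (indicator {0..} x *\<^sub>R exp (- \<sigma> * x))" for n
        proof (intro AE_I2)
          fix x :: real
          show "norm (indicator {0..} x *\<^sub>R ?q n x) \<le> (1 / d) * (indicator {0..} x *\<^sub>R exp (- \<sigma> * x))"
          proof (cases "0 \<le> x")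
            case True
            define h where "h = Y n - z"
            have h: "h \<noteq> 0" "norm h < d" using Y by (auto simp: h_def)
            define w where "w = - h * complex_of_real x"
            have q: "?q n x = exp (- z * complex_of_real x) * ((exp w - 1) / h)"
              by (simp add: w_def h_def exp_diff[symmetric] algebra_simps flip: exp_add)
            have nw: "norm w = norm h * x" using True by (simp add: w_def norm_mult)
            have "\<bar>Re w\<bar> \<le> norm h * x" using abs_Re_le_cmod[of w] nw by simp
            also have "\<dots> \<le> d * x" using h True by (intro mult_right_mono) auto
            finally have "exp \<bar>Re w\<bar> \<le> exp (d * x)" by simp
            then have "norm (exp w - 1) \<le> norm h * x * exp (d * x)"
              using norm_exp_minus_one_le[of w] nw True by (smt (verit) mult_left_mono norm_ge_zero)
            then have "norm ((exp w - 1) / h) \<le> x * exp (d * x)"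
              using h by (simp add: norm_divide pos_divide_le_eq mult_ac)
            then have "norm (?q n x) \<le> exp (- Re z * x) * (x * exp (d * x))"
              unfolding q norm_mult by (intro mult_mono) (use True in auto)
            also have "\<dots> = x * exp (- (\<sigma> + d) * x)"
              unfolding d(2)[symmetric] by (simp add: exp_add[symmetric] algebra_simps)
            also have "\<dots> \<le> (1 / d) * exp (d * x) * exp (- (\<sigma> + d) * x)"
            proof (rule mult_right_mono)
              have "d * x \<le> exp (d * x)" using exp_ge_add_one_self[of "d * x"] by linarith
              then show "x \<le> (1 / d) * exp (d * x)" using d by (simp add: field_simps)
            qed simp
            also have "\<dots> = (1 / d) * exp (- \<sigma> * x)" by (simp add: exp_add[symmetric] algebra_simps)
            finally show ?thesis using True by simp
          qed auto
        qed
        show "integrable \<nu> (\<lambda>x. (1 / d) * (indicator {0..} x *\<^sub>R exp (- \<sigma> * x)))"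
          using int unfolding set_integrable_def by (rule integrable_mult_right)
      qed measurable
      moreover have eq: "(LINT x:{0..}|\<nu>. ?q n x) = (?f (Y n) - ?f z) / (Y n - z)" for n
      proof -
        have "\<sigma> \<le> Re (Y n)" using abs_Re_le_cmod[of "Y n - z"] Y(2)[of n] d by auto
        then have "(LINT x:{0..}|\<nu>. exp (- Y n * complex_of_real x) - exp (- z * complex_of_real x)) = ?f (Y n) - ?f z"
          using z by (intro set_integral_diff laplace_transform_bound(1)[OF sets int]) auto
        then show ?thesis by (simp only: set_integral_divide_zero)
      qed
      ultimately have "(\<lambda>n. (?f (X (n + N)) - ?f z) / (X (n + N) - z)) \<longlonglongrightarrow> ?D"
        unfolding eq unfolding Y_def by blast
      then have "(\<lambda>n. (?f (X n) - ?f z) / (X n - z)) \<longlonglongrightarrow> ?D"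
        by (rule LIMSEQ_offset)
      then show "((\<lambda>w. (?f w - ?f z) / (w - z)) \<circ> X) \<longlonglongrightarrow> ?D" by (simp add: o_def)
    qed
    then show ?thesis by (auto simp: has_field_derivative_iff)
  qed
  then show ?thesis
    by (auto simp: holomorphic_on_open open_halfspace_Re_gt)
qed

section \<open>Determinants and Cramer's rule\<close>

lemma det_holomorphic:
  fixes A :: "complex \<Rightarrow> complex^'n^'n"
  assumes "\<And>i j. (\<lambda>z. A z $ i $ j) holomorphic_on S"
  shows "(\<lambda>z. det (A z)) holomorphic_on S"
  unfolding det_def by (intro holomorphic_intros assms)

lemma norm_det_le:
  fixes A :: "complex^'n^'n"
  assumes "\<And>i j. norm (A $ i $ j) \<le> B"
  shows "norm (det A) \<le> fact CARD('n) * B ^ CARD('n)"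
proof -
  have "norm (det A) \<le> (\<Sum>p\<in>{p. p permutes (UNIV :: 'n set)}. B ^ CARD('n))"
    unfolding det_def
  proof (rule sum_norm_le)
    fix p assume "p \<in> {p. p permutes (UNIV :: 'n set)}"
    have "norm (\<Prod>i\<in>UNIV. A $ i $ p i) \<le> (\<Prod>i\<in>(UNIV :: 'n set). B)"
      unfolding prod_norm[symmetric] by (intro prod_mono) (use assms in auto)
    then show "norm (of_int (sign p) * (\<Prod>i\<in>UNIV. A $ i $ p i)) \<le> B ^ CARD('n)"
      by (simp add: norm_mult sign_def)
  qed
  also have "\<dots> = fact CARD('n) * B ^ CARD('n)"
    by (simp add: card_permutations[OF refl])
  finally show ?thesis .
qed

text \<open>Column i is replaced by the j-th unit vector, so the determinant is entry (i, j) of the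
  adjugate. Keeping the size of the matrix lets Cramer's rule apply directly.\<close>

definition cofactor_matrix :: "complex^'n^'n \<Rightarrow> 'n \<Rightarrow> 'n \<Rightarrow> complex^'n^'n" where
  "cofactor_matrix A i j = (\<chi> k l. if l = i then (if k = j then 1 else 0) else A $ k $ l)"

lemma matrix_inv_mult:
  fixes A :: "complex^'n^'n"
  assumes "invertible A"
  shows "A ** matrix_inv A = mat 1" "matrix_inv A ** A = mat 1"
  using someI_ex[OF assms[unfolded invertible_def]] by (auto simp: matrix_inv_def)

text \<open>Column j of the inverse solves A x = e_j. In this form holomorphy and bounds of the
  inverse become questions about determinants.\<close>

lemma matrix_inv_entry:
  fixes A :: "complex^'n^'n"
  assumes "det A \<noteq> 0"
  shows "matrix_inv A $ i $ j = det (cofactor_matrix A i j) / det A"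
proof -
  have "invertible A" using assms by (simp add: invertible_det_nz)
  then have "A *v (matrix_inv A *v axis j 1) = axis j 1"
    by (simp add: matrix_vector_mul_assoc matrix_inv_mult)
  then have "matrix_inv A *v axis j 1 = (\<chi> k. det (\<chi> i l. if l = k then axis j 1 $ i else A $ i $ l) / det A)"
    using cramer[OF assms] by blast
  moreover have "(matrix_inv A *v axis j 1) $ i = matrix_inv A $ i $ j"
    by (simp add: matrix_vector_mult_def axis_def if_distrib cong: if_cong)
  moreover have "(\<chi> k l. if l = i then axis j 1 $ k else A $ k $ l) = cofactor_matrix A i j"
    by (simp add: cofactor_matrix_def axis_def vec_eq_iff)
  ultimately show ?thesis by simp
qed

section \<open>Point processes and intensities\<close>

lemma point_measuresD:
  assumes "\<nu> \<in> point_measures"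
  shows "sets \<nu> = sets borel" "\<exists>N::nat. emeasure \<nu> {0..t} = of_nat N"
proof -
  obtain I :: "nat set" and x where \<nu>: "\<nu> = distr (count_space I) borel x"
    and x: "\<And>k. k \<in> I \<Longrightarrow> 0 \<le> x k" "\<And>t. finite {k \<in> I. x k \<le> t}"
    using assms by (auto simp: point_measures_def)
  show "sets \<nu> = sets borel" by (simp add: \<nu>)
  have "finite (x -` {0..t} \<inter> I)" by (rule finite_subset[OF _ x(2)[of t]]) auto
  then have "emeasure \<nu> {0..t} = of_nat (card (x -` {0..t} \<inter> I))"
    by (simp add: \<nu> emeasure_distr)
  then show "\<exists>N::nat. emeasure \<nu> {0..t} = of_nat N" by blast
qed

lemma nth_point_nonneg: "0 \<le> nth_point \<nu> n"
  unfolding nth_point_def by (rule Inf_greatest) auto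

text \<open>The infimum in \<open>nth_point\<close> is attained because the counting function is
  right-continuous: the intervals up to t + 1/(k+1) have finite measure and decrease to
  \<open>{0..t}\<close>.\<close>

lemma nth_point_le_iff:
  assumes \<nu>: "\<nu> \<in> point_measures" and t: "0 \<le> t"
  shows "nth_point \<nu> n \<le> ereal t \<longleftrightarrow> of_nat (Suc n) \<le> emeasure \<nu> {0..t}"
proof
  assume "of_nat (Suc n) \<le> emeasure \<nu> {0..t}"
  then show "nth_point \<nu> n \<le> ereal t"
    unfolding nth_point_def using t by (intro Inf_lower) auto
next
  assume le: "nth_point \<nu> n \<le> ereal t"
  have sets[simp]: "sets \<nu> = sets borel" using point_measuresD[OF \<nu>] by simp
  define A where "A k = {0..t + 1 / real (Suc k)}" for k
  have A: "of_nat (Suc n) \<le> emeasure \<nu> (A k)" for k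
  proof -
    have "nth_point \<nu> n < ereal (t + 1 / real (Suc k))" by (rule le_less_trans[OF le]) simp
    then obtain x where x: "0 \<le> x" "of_nat (Suc n) \<le> emeasure \<nu> {0..x}" "x < t + 1 / real (Suc k)"
      unfolding nth_point_def Inf_less_iff by auto
    have "emeasure \<nu> {0..x} \<le> emeasure \<nu> (A k)" using x by (intro emeasure_mono) (auto simp: A_def)
    then show ?thesis using x by order
  qed
  have "(\<lambda>k. emeasure \<nu> (A k)) \<longlonglongrightarrow> emeasure \<nu> (\<Inter>k. A k)"
  proof (rule Lim_emeasure_decseq)
    show "decseq A" unfolding A_def decseq_def
      by (auto intro: order_trans simp: frac_le)
    show "emeasure \<nu> (A k) \<noteq> \<infinity>" for k
      using point_measuresD(2)[OF \<nu>, of "t + 1 / real (Suc k)"] by (auto simp: A_def)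
  qed (auto simp: A_def)
  moreover have "(\<Inter>k. A k) = {0..t}"
  proof (intro equalityI subsetI)
    fix x assume "x \<in> (\<Inter>k. A k)"
    then have x: "0 \<le> x" "\<And>k. x \<le> t + 1 / real (Suc k)" by (auto simp: A_def)
    have "(\<lambda>k. t + 1 / real (Suc k)) \<longlonglongrightarrow> t" by real_asymp
    then have "x \<le> t" by (rule LIMSEQ_le_const) (use x(2) in auto)
    then show "x \<in> {0..t}" using x by auto
  qed (auto simp: A_def intro: order_trans)
  ultimately show "of_nat (Suc n) \<le> emeasure \<nu> {0..t}"
    using A by (auto intro: LIMSEQ_le_const)
qed

section \<open>Measurability of the points and exponential weights\<close>

lemma space_point_process_space: "space point_process_space = point_measures"
  unfolding point_process_space_def space_Sup_eq_UN by (auto intro: exI[of _ UNIV])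

lemma emeasure_point_process_measurable:
  assumes "B \<in> sets borel"
  shows "(\<lambda>\<nu>. emeasure \<nu> B) \<in> borel_measurable point_process_space"
  unfolding point_process_space_def
  by (rule measurable_Sup1[of "vimage_algebra point_measures (\<lambda>\<nu>. emeasure \<nu> B) borel"])
    (use assms in \<open>auto intro: measurable_vimage_algebra1\<close>)

text \<open>The sigma-algebra knows only the evaluations at Borel sets. By
  \<open>nth_point_le_iff\<close> each nontrivial sublevel set of \<open>nth_point\<close> is
  described by one such evaluation.\<close>

lemma nth_point_measurable: "(\<lambda>\<nu>. nth_point \<nu> n) \<in> borel_measurable point_process_space"
  unfolding borel_measurable_iff_Iic_ereal
proof
  fix a
  show "(\<lambda>\<nu>. nth_point \<nu> n) -` {..a} \<inter> space point_process_space \<in> sets point_process_space"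
  proof (cases "a = \<infinity> \<or> a < 0")
    case True
    then show ?thesis
    proof
      assume "a < 0"
      then have "(\<lambda>\<nu>. nth_point \<nu> n) -` {..a} = {}"
        using nth_point_nonneg[of _ n] by (auto dest: order.strict_trans1 simp: not_le[symmetric])
      then show ?thesis by simp
    next
      have "{..\<infinity>::ereal} = UNIV" by auto
      moreover assume "a = \<infinity>"
      ultimately show ?thesis by simp
    qed
  next
    case False
    then obtain t where t: "a = ereal t" "0 \<le> t" by (cases a) auto
    have "(\<lambda>\<nu>. nth_point \<nu> n) -` {..a} \<inter> space point_process_space
       = (\<lambda>\<nu>. emeasure \<nu> {0..t}) -` {of_nat (Suc n)..} \<inter> space point_process_space"
      using nth_point_le_iff[OF _ t(2)] by (auto simp: space_point_process_space t(1))
    also have "\<dots> \<in> sets point_process_space"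
      by (rule measurable_sets[OF emeasure_point_process_measurable]) auto
    finally show ?thesis .
  qed
qed

lemma component_reproduction_measurable:
  "(\<lambda>x. x ij) \<in> measurable reproduction_space point_process_space"
  unfolding reproduction_space_def by measurable

lemma nth_point_reproduction_measurable [measurable]:
  "(\<lambda>x. nth_point (x ij) n) \<in> borel_measurable reproduction_space"
  by (rule measurable_compose[OF component_reproduction_measurable nth_point_measurable])

text \<open>The value 0 at infinity makes the labels of individuals that are never born drop out of
  all sums.\<close>

definition exp_neg :: "real \<Rightarrow> ereal \<Rightarrow> ennreal" where
  "exp_neg s x = (if x = \<infinity> then 0 else ennreal (exp (- s * real_of_ereal x)))"

lemma exp_neg_measurable [measurable]: "exp_neg s \<in> borel_measurable borel"
  unfolding exp_neg_def by measurable

lemma exp_neg_add: "0 \<le> x \<Longrightarrow> 0 \<le> y \<Longrightarrow> exp_neg s (x + y) = exp_neg s x * exp_neg s y"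
  by (cases x; cases y) (auto simp: exp_neg_def exp_add[symmetric] ennreal_mult[symmetric] algebra_simps)

lemma exp_neg_0 [simp]: "exp_neg s 0 = 1"
  by (simp add: exp_neg_def)

text \<open>exp(-s x) is the integral of s exp(-s t) over t \<ge> x. This turns counting points up
  to time t into summing exponential weights of the points.\<close>

lemma exp_neg_layer_cake:
  assumes s: "0 < s" and x: "0 \<le> x"
  shows "(\<integral>\<^sup>+t. ennreal (s * exp (- s * t)) * indicator {0..} t * indicator {x..} (ereal t) \<partial>lborel) = exp_neg s x"
proof (cases x)
  case (real r)
  then have r: "0 \<le> r" using x by simp
  have "(\<integral>\<^sup>+t. ennreal (s * exp (- s * t)) * indicator {0..} t * indicator {x..} (ereal t) \<partial>lborel)
     = (\<integral>\<^sup>+t. ennreal (s * exp (- s * t)) * indicator {r..} t \<partial>lborel)"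
    using r by (intro nn_integral_cong) (auto simp: indicator_def real)
  also have "\<dots> = ennreal (0 - (- exp (- s * r)))"
  proof (rule nn_integral_FTC_atLeast)
    show "((\<lambda>t. - exp (- s * t)) \<longlongrightarrow> 0) at_top" using s by real_asymp
  qed (use s in \<open>auto intro!: derivative_eq_intros\<close>)
  finally show ?thesis by (simp add: exp_neg_def real)
qed (use x in \<open>auto simp: exp_neg_def\<close>)

lemma point_measure_eq_suminf:
  assumes \<nu>: "\<nu> \<in> point_measures" and t: "0 \<le> t"
  shows "emeasure \<nu> {0..t} = (\<Sum>n. indicator {nth_point \<nu> n..} (ereal t))"
proof -
  obtain N :: nat where N: "emeasure \<nu> {0..t} = of_nat N" using point_measuresD[OF \<nu>] by blast
  have "(indicator {nth_point \<nu> n..} (ereal t) :: ennreal) = (if n < N then 1 else 0)" for n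
    using nth_point_le_iff[OF \<nu> t, of n] unfolding N of_nat_le_iff by (simp add: indicator_def Suc_le_eq)
  then show ?thesis
    unfolding N by (subst suminf_finite[of "{..<N}"]) auto
qed

lemma sets_intensity [simp]: "sets (intensity P \<xi> i j) = sets borel"
  using sets.sigma_sets_eq[of borel] by (simp add: intensity_def)

lemma sigma_finite_locally_finite:
  assumes "locally_finite \<nu>" "sets \<nu> = sets borel"
  shows "sigma_finite_measure \<nu>"
proof
  have "space \<nu> = UNIV" using sets_eq_imp_space_eq[OF assms(2)] by simp
  moreover have "(\<Union>n::nat. {- real n..real n}) = UNIV"
  proof -
    have "\<exists>n::nat. x \<in> {- real n..real n}" for x
    proof -
      obtain n :: nat where "\<bar>x\<bar> \<le> real n" using real_arch_simple by blast
      then show ?thesis by (intro exI[of _ n]) auto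
    qed
    then show ?thesis by auto
  qed
  moreover have "emeasure \<nu> {- real n..real n} \<noteq> \<infinity>" for n
    using assms(1) compact_Icc unfolding locally_finite_def by (metis infinity_ennreal_def less_irrefl)
  ultimately show "\<exists>A. countable A \<and> A \<subseteq> sets \<nu> \<and> \<Union> A = space \<nu> \<and> (\<forall>a\<in>A. emeasure \<nu> a \<noteq> \<infinity>)"
    using assms(2) by (intro exI[of _ "range (\<lambda>n::nat. {- real n..real n})"]) auto
qed

section \<open>The intensity measures and their transforms at real arguments\<close>

context cmj_process
begin

lemma xi_point_measures: "\<omega> \<in> space P \<Longrightarrow> \<xi> \<omega> ij \<in> point_measures"
  using measurable_space[OF measurable_compose[OF xi_measurable component_reproduction_measurable]]
  by (simp add: space_point_process_space)

lemma xi_emeasure_measurable: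
  "B \<in> sets borel \<Longrightarrow> (\<lambda>\<omega>. emeasure (\<xi> \<omega> ij) B) \<in> borel_measurable P"
  by (rule measurable_compose[OF measurable_compose[OF xi_measurable component_reproduction_measurable]
        emeasure_point_process_measurable])

lemma xi_nth_point_measurable [measurable]: "(\<lambda>\<omega>. nth_point (\<xi> \<omega> ij) n) \<in> borel_measurable P"
  by (rule measurable_compose[OF xi_measurable nth_point_reproduction_measurable])

lemma emeasure_intensity:
  assumes "B \<in> sets borel"
  shows "emeasure (intensity P \<xi> i j) B = (\<integral>\<^sup>+\<omega>. emeasure (\<xi> \<omega> (i, j)) B \<partial>P)"
proof (rule emeasure_measure_of[OF intensity_def])
  show "countably_additive (sets (intensity P \<xi> i j)) (\<lambda>B. \<integral>\<^sup>+\<omega>. emeasure (\<xi> \<omega> (i, j)) B \<partial>P)"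
  proof (rule countably_additiveI)
    fix A :: "nat \<Rightarrow> real set"
    assume A: "range A \<subseteq> sets (intensity P \<xi> i j)" "disjoint_family A"
    have "(\<Sum>n. \<integral>\<^sup>+\<omega>. emeasure (\<xi> \<omega> (i, j)) (A n) \<partial>P) = (\<integral>\<^sup>+\<omega>. (\<Sum>n. emeasure (\<xi> \<omega> (i, j)) (A n)) \<partial>P)"
      using A by (intro nn_integral_suminf[symmetric] xi_emeasure_measurable) auto
    also have "\<dots> = (\<integral>\<^sup>+\<omega>. emeasure (\<xi> \<omega> (i, j)) (\<Union> (range A)) \<partial>P)"
      using A by (intro nn_integral_cong suminf_emeasure) (auto simp: point_measuresD(1)[OF xi_point_measures])
    finally show "(\<Sum>n. \<integral>\<^sup>+\<omega>. emeasure (\<xi> \<omega> (i, j)) (A n) \<partial>P) = (\<integral>\<^sup>+\<omega>. emeasure (\<xi> \<omega> (i, j)) (\<Union> (range A)) \<partial>P)" .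
  qed
qed (use assms in \<open>auto simp: positive_def\<close>)

text \<open>\<open>q\<close> consists of the type of the child and the rank of its point, the form
  in which \<open>child_label\<close> delivers it.\<close>

definition child_transform :: "real \<Rightarrow> 'p \<Rightarrow> 'p \<times> nat \<Rightarrow> ennreal" where
  "child_transform s k q = (\<integral>\<^sup>+\<omega>. exp_neg s (nth_point (\<xi> \<omega> (k, fst q)) (snd q)) \<partial>P)"

text \<open>By the layer-cake formula both sides are the integral of s exp(-s t) against the
  expected number of points in [0,t]. Local finiteness supplies the sigma-finiteness for exchanging
  integrals, and s > 0 the layer cake.\<close>

lemma laplace_intensity_eq_suminf:
  assumes s: "0 < s" and lf: "locally_finite (intensity P \<xi> i j)"
  shows "(\<integral>\<^sup>+x\<in>{0..}. ennreal (exp (- s * x)) \<partial>intensity P \<xi> i j) = (\<Sum>n. child_transform s i (j, n))"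
proof -
  define \<mu> where "\<mu> = intensity P \<xi> i j"
  have sets_mu[measurable_cong, simp]: "sets \<mu> = sets borel" by (simp add: \<mu>_def)
  interpret \<mu>: sigma_finite_measure \<mu>
    unfolding \<mu>_def by (rule sigma_finite_locally_finite[OF lf sets_intensity])
  interpret L: pair_sigma_finite \<mu> lborel ..
  interpret Q: pair_sigma_finite P lborel by unfold_locales
  let ?h = "\<lambda>t::real. ennreal (s * exp (- s * t)) * indicator {0..} t"
  have "(\<integral>\<^sup>+x\<in>{0..}. ennreal (exp (- s * x)) \<partial>\<mu>)
      = (\<integral>\<^sup>+x. (\<integral>\<^sup>+t. ?h t * (if 0 \<le> x \<and> x \<le> t then 1 else 0) \<partial>lborel) \<partial>\<mu>)"
  proof (rule nn_integral_cong)
    fix x :: real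
    show "ennreal (exp (- s * x)) * indicator {0..} x = (\<integral>\<^sup>+t. ?h t * (if 0 \<le> x \<and> x \<le> t then 1 else 0) \<partial>lborel)"
    proof (cases "0 \<le> x")
      case True
      have "exp_neg s (ereal x) = (\<integral>\<^sup>+t. ?h t * (if 0 \<le> x \<and> x \<le> t then 1 else 0) \<partial>lborel)"
        using True by (subst exp_neg_layer_cake[OF s, symmetric]) (auto intro!: nn_integral_cong simp: indicator_def)
      then show ?thesis using True by (simp add: exp_neg_def)
    qed auto
  qed
  also have "\<dots> = (\<integral>\<^sup>+t. (\<integral>\<^sup>+x. ?h t * (if 0 \<le> x \<and> x \<le> t then 1 else 0) \<partial>\<mu>) \<partial>lborel)"
    by (rule L.Fubini'[symmetric]) measurable
  also have "\<dots> = (\<integral>\<^sup>+t. ?h t * emeasure \<mu> {0..t} \<partial>lborel)"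
  proof (rule nn_integral_cong)
    fix t :: real
    have "(\<integral>\<^sup>+x. ?h t * (if 0 \<le> x \<and> x \<le> t then 1 else 0) \<partial>\<mu>) = (\<integral>\<^sup>+x. ?h t * indicator {0..t} x \<partial>\<mu>)"
      by (intro nn_integral_cong) (auto simp: indicator_def)
    then show "(\<integral>\<^sup>+x. ?h t * (if 0 \<le> x \<and> x \<le> t then 1 else 0) \<partial>\<mu>) = ?h t * emeasure \<mu> {0..t}"
      by (simp add: nn_integral_cmult_indicator)
  qed
  also have "\<dots> = (\<integral>\<^sup>+t. (\<integral>\<^sup>+\<omega>. (\<Sum>n. ?h t * indicator {nth_point (\<xi> \<omega> (i, j)) n..} (ereal t)) \<partial>P) \<partial>lborel)"
  proof (rule nn_integral_cong)
    fix t :: real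
    show "?h t * emeasure \<mu> {0..t} = (\<integral>\<^sup>+\<omega>. (\<Sum>n. ?h t * indicator {nth_point (\<xi> \<omega> (i, j)) n..} (ereal t)) \<partial>P)"
    proof (cases "0 \<le> t")
      case True
      have "?h t * emeasure \<mu> {0..t} = (\<integral>\<^sup>+\<omega>. ?h t * emeasure (\<xi> \<omega> (i, j)) {0..t} \<partial>P)"
        unfolding \<mu>_def by (subst emeasure_intensity) (auto simp: nn_integral_cmult xi_emeasure_measurable)
      also have "\<dots> = (\<integral>\<^sup>+\<omega>. (\<Sum>n. ?h t * indicator {nth_point (\<xi> \<omega> (i, j)) n..} (ereal t)) \<partial>P)"
        by (intro nn_integral_cong) (simp add: point_measure_eq_suminf[OF xi_point_measures True])
      finally show ?thesis .
    qed auto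
  qed
  also have "\<dots> = (\<integral>\<^sup>+\<omega>. (\<integral>\<^sup>+t. (\<Sum>n. ?h t * indicator {nth_point (\<xi> \<omega> (i, j)) n..} (ereal t)) \<partial>lborel) \<partial>P)"
  proof (rule Q.Fubini')
    have "(\<lambda>(\<omega>, t). \<Sum>n. ?h t * (if nth_point (\<xi> \<omega> (i, j)) n \<le> ereal t then 1 else 0)) \<in> borel_measurable (P \<Otimes>\<^sub>M lborel)"
      by measurable
    then show "(\<lambda>(\<omega>, t). \<Sum>n. ?h t * indicator {nth_point (\<xi> \<omega> (i, j)) n..} (ereal t)) \<in> borel_measurable (P \<Otimes>\<^sub>M lborel)"
      by (simp add: indicator_def cong: if_cong)
  qed
  also have "\<dots> = (\<integral>\<^sup>+\<omega>. (\<Sum>n. exp_neg s (nth_point (\<xi> \<omega> (i, j)) n)) \<partial>P)"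
  proof (rule nn_integral_cong)
    fix \<omega>
    show "(\<integral>\<^sup>+t. (\<Sum>n. ?h t * indicator {nth_point (\<xi> \<omega> (i, j)) n..} (ereal t)) \<partial>lborel) = (\<Sum>n. exp_neg s (nth_point (\<xi> \<omega> (i, j)) n))"
      using exp_neg_layer_cake[OF s nth_point_nonneg] by (subst nn_integral_suminf) auto
  qed
  also have "\<dots> = (\<Sum>n. child_transform s i (j, n))"
    unfolding child_transform_def by (subst nn_integral_suminf) auto
  finally show ?thesis by (simp add: \<mu>_def)
qed

end

section \<open>The expected generation sizes\<close>

lemma bij_child_label: "bij_betw (child_label :: nat \<Rightarrow> 'p::finite \<times> nat) UNIV UNIV"
proof -
  have "infinite (UNIV :: ('p \<times> nat) set)"
    by (simp add: finite_prod)
  moreover have "countable (UNIV :: ('p \<times> nat) set)"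
    using countable_SIGMA[of "UNIV :: 'p set" "\<lambda>_. UNIV :: nat set"] by (simp add: countable_finite)
  ultimately show ?thesis unfolding child_label_def[abs_def]
    by (rule bij_betw_from_nat_into[rotated])
qed

text \<open>Strict ancestors only: the birth time of an individual does not involve its own
  reproduction process.\<close>

primrec ancestors :: "nat list \<Rightarrow> nat list set" where
  "ancestors [] = {}"
| "ancestors (m # u) = insert u (ancestors u)"

lemma finite_ancestors [simp]: "finite (ancestors u)"
  by (induction u) auto

lemma length_ancestors: "v \<in> ancestors u \<Longrightarrow> length v < length u"
  by (induction u) auto

lemma not_in_ancestors [simp]: "u \<notin> ancestors u"
  using length_ancestors by blast

lemma birth_time_nonneg: "0 \<le> birth_time x i u"
  by (induction u) (auto simp: nth_point_nonneg split: prod.split)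

text \<open>The child of the ancestor \<open>v\<close> of \<open>u\<close> on the line of descent to \<open>u\<close> has the label
  \<open>rev u ! length v # v\<close>.\<close>

lemma exp_neg_birth_time:
  fixes i :: "'p::finite"
  shows "exp_neg s (birth_time x i u) = (\<Prod>v\<in>ancestors u. exp_neg s
     (nth_point (x v (type_of_ind i v, fst (child_label (rev u ! length v)))) (snd (child_label (rev u ! length v) :: 'p \<times> nat))))"
proof (induction u)
  case (Cons m u)
  have "exp_neg s (birth_time x i (m # u)) = exp_neg s (birth_time x i u) *
      exp_neg s (nth_point (x u (type_of_ind i u, fst (child_label m))) (snd (child_label m :: 'p \<times> nat)))"
    by (simp add: case_prod_beta exp_neg_add birth_time_nonneg nth_point_nonneg)
  \<comment> \<open>Prepending \<open>m\<close> to \<open>u\<close> appends it to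
    \<open>rev u\<close>, which leaves the entries at indices below \<open>length u\<close>
    unchanged.\<close>
  moreover have "rev (m # u) ! length v = rev u ! length v" if "v \<in> ancestors u" for v
    using length_ancestors[OF that] by (simp add: nth_append)
  ultimately show ?case by (simp add: Cons.IH mult.commute nth_append)
qed simp

section \<open>Independence along lines of descent and the generation sums\<close>

context cmj_process
begin

lemma copies_measurable [measurable]: "\<xi>c u \<in> P \<rightarrow>\<^sub>M reproduction_space"
  using xi_indep unfolding indep_vars_def by blast

lemma birth_time_measurable [measurable]:
  "(\<lambda>\<omega>. birth_time (\<lambda>v. \<xi>c v \<omega>) i u) \<in> borel_measurable P"
proof (induction u)
  case (Cons m u)
  obtain j n where "child_label m = (j :: 'p, n)" by fastforce
  moreover have "(\<lambda>\<omega>. nth_point (\<xi>c u \<omega> (type_of_ind i u, j)) n) \<in> borel_measurable P"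
    by (rule measurable_compose[OF copies_measurable nth_point_reproduction_measurable])
  ultimately show ?case using Cons by (simp add: borel_measurable_ereal_add)
qed simp

lemma nn_integral_copy:
  "(\<integral>\<^sup>+\<omega>. exp_neg s (nth_point (\<xi>c u \<omega> (k, j)) n) \<partial>P) = child_transform s k (j, n)"
proof -
  have meas: "(\<lambda>x. exp_neg s (nth_point (x (k, j)) n)) \<in> borel_measurable reproduction_space"
    by measurable
  have "(\<integral>\<^sup>+\<omega>. exp_neg s (nth_point (\<xi>c u \<omega> (k, j)) n) \<partial>P)
      = (\<integral>\<^sup>+x. exp_neg s (nth_point (x (k, j)) n) \<partial>distr P reproduction_space (\<xi>c u))"
    by (subst nn_integral_distr[OF copies_measurable]) (use meas in simp_all)
  also have "\<dots> = (\<integral>\<^sup>+\<omega>. exp_neg s (nth_point (\<xi> \<omega> (k, j)) n) \<partial>P)"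
    unfolding xi_copies by (subst nn_integral_distr[OF xi_measurable]) (use meas in simp_all)
  finally show ?thesis by (simp add: child_transform_def)
qed

definition birth_transform :: "real \<Rightarrow> 'p \<Rightarrow> nat list \<Rightarrow> ennreal" where
  "birth_transform s i u = (\<integral>\<^sup>+\<omega>. exp_neg s (birth_time (\<lambda>v. \<xi>c v \<omega>) i u) \<partial>P)"

text \<open>A line of descent visits each individual once and distinct individuals use independent
  copies, so the mean of the product factorizes. The types and labels along the line are determined
  by \<open>u\<close> and not random.\<close>

lemma birth_transform_eq_prod:
  "birth_transform s i u = (\<Prod>v\<in>ancestors u. child_transform s (type_of_ind i v) (child_label (rev u ! length v)))"
proof -
  let ?l = "\<lambda>v. child_label (rev u ! length v) :: 'p \<times> nat"
  have "indep_vars (\<lambda>_. borel) (\<lambda>v \<omega>. exp_neg s (nth_point (\<xi>c v \<omega> (type_of_ind i v, fst (?l v))) (snd (?l v)))) (ancestors u)"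
    by (rule indep_vars_compose2[OF indep_vars_subset[OF xi_indep subset_UNIV]]) measurable
  then show ?thesis
    unfolding birth_transform_def exp_neg_birth_time
    by (subst indep_vars_nn_integral) (auto simp: nn_integral_copy)
qed

lemma birth_transform_Nil [simp]: "birth_transform s i [] = 1"
  by (simp add: birth_transform_eq_prod)

lemma birth_transform_Cons:
  "birth_transform s i (m # u) = birth_transform s i u * child_transform s (type_of_ind i u) (child_label m)"
proof -
  have "rev (m # u) ! length v = rev u ! length v" if "v \<in> ancestors u" for v
    using length_ancestors[OF that] by (simp add: nth_append)
  then show ?thesis by (simp add: birth_transform_eq_prod mult.commute nth_append)
qed

text \<open>Entry (i, j) of the Laplace transform of the intensities at real s, as a sum over points
  in [0,\<infinity>]; the renewal equation can thus be derived before any convergence is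
  known.\<close>

definition laplace_real :: "real \<Rightarrow> 'p \<Rightarrow> 'p \<Rightarrow> ennreal" where
  "laplace_real s i j = (\<Sum>n. child_transform s i (j, n))"

text \<open>By the recursion below this is entry (i, j) of the n-th power of
  \<open>laplace_real s\<close>, and \<open>renewal_transform\<close> is the Neumann series of these
  powers.\<close>

definition generation_transform :: "real \<Rightarrow> nat \<Rightarrow> 'p \<Rightarrow> 'p \<Rightarrow> ennreal" where
  "generation_transform s n i j = (\<integral>\<^sup>+u. birth_transform s i u * (if length u = n \<and> type_of_ind i u = j then 1 else 0) \<partial>count_space UNIV)"

definition renewal_transform :: "real \<Rightarrow> 'p \<Rightarrow> 'p \<Rightarrow> ennreal" where
  "renewal_transform s i j = (\<integral>\<^sup>+u. birth_transform s i u * (if type_of_ind i u = j then 1 else 0) \<partial>count_space UNIV)"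

lemma nn_integral_children:
  "(\<integral>\<^sup>+m. child_transform s k (child_label m) * (if fst (child_label m) = j then 1 else 0) \<partial>count_space UNIV)
     = laplace_real s k j"
proof -
  have "(\<integral>\<^sup>+m. child_transform s k (child_label m) * (if fst (child_label m) = j then 1 else 0) \<partial>count_space UNIV)
     = (\<integral>\<^sup>+q. child_transform s k q * (if fst q = j then 1 else 0) \<partial>count_space (UNIV :: ('p \<times> nat) set))"
    using nn_integral_bij_count_space[OF bij_child_label, of "\<lambda>q. child_transform s k q * (if fst q = j then 1 else 0)"] by simp
  also have "\<dots> = (\<integral>\<^sup>+j'. (\<integral>\<^sup>+n. child_transform s k (j', n) * (if j' = j then 1 else 0) \<partial>count_space UNIV) \<partial>count_space UNIV)"
    by (simp flip: nn_integral_fst_count_space)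
  also have "\<dots> = (\<Sum>j'\<in>UNIV. (\<integral>\<^sup>+n. child_transform s k (j', n) * (if j' = j then 1 else 0) \<partial>count_space UNIV))"
    by (simp add: nn_integral_count_space_finite)
  also have "\<dots> = (\<Sum>j'\<in>UNIV. if j' = j then laplace_real s k j else 0)"
    by (intro sum.cong) (auto simp: laplace_real_def nn_integral_count_space_nat)
  finally show ?thesis by simp
qed

lemma generation_transform_0: "generation_transform s 0 i j = (if i = j then 1 else 0)"
proof -
  have "generation_transform s 0 i j = (\<integral>\<^sup>+u. (if i = j then 1 else 0) * indicator {[]} u \<partial>count_space (UNIV :: nat list set))"
    unfolding generation_transform_def by (intro nn_integral_cong) (auto simp: indicator_def)
  also have "\<dots> = (if i = j then 1 else 0)"
    by (subst nn_integral_cmult_indicator) auto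
  finally show ?thesis .
qed

text \<open>The last birth is split off, as in the list \<open>m # u\<close>, so the new factor
  stands on the right. Only the type k of the parent links it to the earlier generations.\<close>

lemma generation_transform_Suc:
  "generation_transform s (Suc n) i j = (\<Sum>k\<in>UNIV. generation_transform s n i k * laplace_real s k j)"
proof -
  have bij: "bij_betw (\<lambda>(u, m). m # u) (UNIV :: (nat list \<times> nat) set) (UNIV - {[]})"
    by (rule bij_betwI[where g="\<lambda>v. (tl v, hd v)"]) auto
  have "generation_transform s (Suc n) i j
     = (\<integral>\<^sup>+u. birth_transform s i u * (if length u = Suc n \<and> type_of_ind i u = j then 1 else 0) \<partial>count_space (UNIV - {[]}))"
    unfolding generation_transform_def by (rule nn_integral_count_space_eq) auto
  also have "\<dots> = (\<integral>\<^sup>+(u, m). birth_transform s i (m # u) * (if length u = n \<and> fst (child_label m) = j then 1 else 0)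
      \<partial>count_space (UNIV :: (nat list \<times> nat) set))"
    by (subst nn_integral_bij_count_space[OF bij, symmetric]) (auto intro!: nn_integral_cong)
  also have "\<dots> = (\<integral>\<^sup>+u. (\<integral>\<^sup>+m. birth_transform s i (m # u) * (if length u = n \<and> fst (child_label m) = j then 1 else 0)
      \<partial>count_space UNIV) \<partial>count_space UNIV)"
    by (subst nn_integral_fst_count_space[symmetric]) simp
  also have "\<dots> = (\<integral>\<^sup>+u. (\<Sum>k\<in>UNIV. birth_transform s i u * (if length u = n \<and> type_of_ind i u = k then 1 else 0) * laplace_real s k j) \<partial>count_space UNIV)"
  proof (rule nn_integral_cong)
    fix u
    have "(\<integral>\<^sup>+m. birth_transform s i (m # u) * (if length u = n \<and> fst (child_label m) = j then 1 else 0) \<partial>count_space UNIV)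
       = (\<integral>\<^sup>+m. (birth_transform s i u * (if length u = n then 1 else 0)) *
          (child_transform s (type_of_ind i u) (child_label m) * (if fst (child_label m) = j then 1 else 0)) \<partial>count_space UNIV)"
      by (intro nn_integral_cong) (auto simp: birth_transform_Cons mult.assoc)
    also have "\<dots> = birth_transform s i u * (if length u = n then 1 else 0) * laplace_real s (type_of_ind i u) j"
      by (subst nn_integral_cmult) (auto simp: nn_integral_children)
    also have "\<dots> = (\<Sum>k\<in>UNIV. if k = type_of_ind i u then birth_transform s i u * (if length u = n then 1 else 0) * laplace_real s k j else 0)"
      by simp
    also have "\<dots> = (\<Sum>k\<in>UNIV. birth_transform s i u * (if length u = n \<and> type_of_ind i u = k then 1 else 0) * laplace_real s k j)"
      by (intro sum.cong) auto
    finally show "(\<integral>\<^sup>+m. birth_transform s i (m # u) * (if length u = n \<and> fst (child_label m) = j then 1 else 0) \<partial>count_space UNIV) = \<dots>" .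
  qed
  also have "\<dots> = (\<Sum>k\<in>UNIV. generation_transform s n i k * laplace_real s k j)"
    unfolding generation_transform_def by (subst nn_integral_sum) (auto simp: nn_integral_multc)
  finally show ?thesis .
qed

lemma renewal_transform_eq_suminf: "renewal_transform s i j = (\<Sum>n. generation_transform s n i j)"
proof -
  have "(\<Sum>n. generation_transform s n i j)
     = (\<integral>\<^sup>+u. (\<Sum>n. birth_transform s i u * (if length u = n \<and> type_of_ind i u = j then 1 else 0)) \<partial>count_space UNIV)"
    unfolding generation_transform_def by (rule nn_integral_suminf[symmetric]) simp
  also have "\<dots> = renewal_transform s i j"
    unfolding renewal_transform_def
  proof (rule nn_integral_cong)
    fix u
    show "(\<Sum>n. birth_transform s i u * (if length u = n \<and> type_of_ind i u = j then 1 else 0))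
       = birth_transform s i u * (if type_of_ind i u = j then 1 else 0)"
      by (subst suminf_finite[of "{length u}"]) auto
  qed
  finally show ?thesis by simp
qed

lemma renewal_equation:
  "renewal_transform s i j = (if i = j then 1 else 0) + (\<Sum>k\<in>UNIV. renewal_transform s i k * laplace_real s k j)"
proof -
  have "renewal_transform s i j = (\<Sum>n. generation_transform s (n + 1) i j) + (\<Sum>n<1. generation_transform s n i j)"
    unfolding renewal_transform_eq_suminf by (rule suminf_offset) simp
  also have "(\<Sum>n. generation_transform s (n + 1) i j) = (\<Sum>k\<in>UNIV. (\<Sum>n. generation_transform s n i k * laplace_real s k j))"
    by (simp add: generation_transform_Suc suminf_sum)
  also have "\<dots> = (\<Sum>k\<in>UNIV. renewal_transform s i k * laplace_real s k j)"
    unfolding renewal_transform_eq_suminf by (simp add: ennreal_suminf_multc)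
  finally show ?thesis by (simp add: generation_transform_0 add.commute)
qed

text \<open>\<open>v\<close> is a strict supersolution of the iteration. Each application of the
  inequality leaves behind half of the total mass of one generation, so all partial sums of the
  Neumann series are at most 2 v.\<close>

lemma renewal_transform_finite:
  fixes v :: "'p \<Rightarrow> ennreal"
  assumes v: "\<And>k. (\<Sum>j\<in>UNIV. laplace_real s k j * v j) + ennreal (1/2) \<le> v k" "\<And>k. v k < \<infinity>"
  shows "renewal_transform s i j < \<infinity>"
proof -
  let ?G = "generation_transform s"
  have le: "(\<Sum>j\<in>UNIV. ?G n i j * v j) + (\<Sum>m<n. \<Sum>k\<in>UNIV. ?G m i k) * ennreal (1/2) \<le> v i" for n
  proof (induction n)
    case 0
    have "(\<Sum>j\<in>UNIV. ?G 0 i j * v j) = (\<Sum>j\<in>UNIV. if j = i then v j else 0)"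
      by (intro sum.cong) (auto simp: generation_transform_0)
    then show ?case by simp
  next
    case (Suc n)
    have "(\<Sum>j\<in>UNIV. ?G (Suc n) i j * v j) = (\<Sum>j\<in>UNIV. \<Sum>k\<in>UNIV. ?G n i k * (laplace_real s k j * v j))"
      by (simp add: generation_transform_Suc sum_distrib_right mult.assoc)
    also have "\<dots> = (\<Sum>k\<in>UNIV. ?G n i k * (\<Sum>j\<in>UNIV. laplace_real s k j * v j))"
      by (subst sum.swap) (simp add: sum_distrib_left)
    finally have "(\<Sum>j\<in>UNIV. ?G (Suc n) i j * v j) + (\<Sum>m<Suc n. \<Sum>k\<in>UNIV. ?G m i k) * ennreal (1/2)
       = (\<Sum>k\<in>UNIV. ?G n i k * ((\<Sum>j\<in>UNIV. laplace_real s k j * v j) + ennreal (1/2)))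
         + (\<Sum>m<n. \<Sum>k\<in>UNIV. ?G m i k) * ennreal (1/2)"
      by (simp add: distrib_left distrib_right sum.distrib sum_distrib_right add_ac)
    also have "\<dots> \<le> (\<Sum>k\<in>UNIV. ?G n i k * v k) + (\<Sum>m<n. \<Sum>k\<in>UNIV. ?G m i k) * ennreal (1/2)"
      by (intro add_right_mono sum_mono mult_left_mono v) auto
    also have "\<dots> \<le> v i" by (rule Suc.IH)
    finally show ?case .
  qed
  have "(\<Sum>m<n. ?G m i j) * ennreal (1/2) \<le> v i" for n
  proof -
    have "(\<Sum>m<n. ?G m i j) * ennreal (1/2) \<le> (\<Sum>m<n. \<Sum>k\<in>UNIV. ?G m i k) * ennreal (1/2)"
      by (intro mult_right_mono sum_mono member_le_sum) auto
    also have "\<dots> \<le> v i" using le[of n] by (meson add_increasing zero_le order_trans le_add_same_cancel2 order_refl add_mono)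
    finally show ?thesis .
  qed
  then have "(\<Sum>m. ?G m i j * ennreal (1/2)) \<le> v i"
    by (intro suminf_le_const) (auto simp: sum_distrib_right)
  then have "renewal_transform s i j * ennreal (1/2) \<le> v i"
    unfolding renewal_transform_eq_suminf by (simp add: ennreal_suminf_multc)
  then have "renewal_transform s i j * ennreal (1/2) < \<infinity>" using v(2) by (rule le_less_trans)
  then show ?thesis by (auto simp: ennreal_mult_less_top less_top)
qed

end

section \<open>The measure of birth times\<close>

context cmj_process
begin

text \<open>This is \<rho> of the overview, as the image of a measure on pairs of a label and an
  outcome. The density removes the other types and the individuals never born before times are made
  real, so integrals become sums over labels of expectations.\<close>

definition birth_measure :: "'p \<Rightarrow> 'p \<Rightarrow> real measure" where
  "birth_measure i j = distr
     (density (count_space UNIV \<Otimes>\<^sub>M P)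
        (\<lambda>(u, \<omega>). if type_of_ind i u = j \<and> birth_time (\<lambda>v. \<xi>c v \<omega>) i u < \<infinity> then 1 else 0))
     borel (\<lambda>(u, \<omega>). real_of_ereal (birth_time (\<lambda>v. \<xi>c v \<omega>) i u))"

lemma sets_birth_measure [simp]: "sets (birth_measure i j) = sets borel"
  by (simp add: birth_measure_def)

lemma birth_time_pair_measurable [measurable]:
  "(\<lambda>(u, \<omega>). birth_time (\<lambda>v. \<xi>c v \<omega>) i u) \<in> borel_measurable (count_space UNIV \<Otimes>\<^sub>M P)"
  by (rule measurable_pair_measure_countable1) auto

lemma nn_integral_birth_measure:
  assumes [measurable]: "f \<in> borel_measurable borel"
  shows "(\<integral>\<^sup>+x. f x \<partial>birth_measure i j) = (\<integral>\<^sup>+u. (\<integral>\<^sup>+\<omega>.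
     (if type_of_ind i u = j \<and> birth_time (\<lambda>v. \<xi>c v \<omega>) i u < \<infinity>
      then f (real_of_ereal (birth_time (\<lambda>v. \<xi>c v \<omega>) i u)) else 0) \<partial>P) \<partial>count_space UNIV)"
proof -
  let ?B = "\<lambda>p. birth_time (\<lambda>v. \<xi>c v (snd p)) i (fst p)"
  have B[measurable]: "?B \<in> borel_measurable (count_space UNIV \<Otimes>\<^sub>M P)"
    using birth_time_pair_measurable by (simp add: case_prod_beta)
  have T[measurable]: "Measurable.pred (count_space UNIV \<Otimes>\<^sub>M P) (\<lambda>p. type_of_ind i (fst p) = j)"
    by (rule measurable_compose[OF measurable_fst]) simp
  define g where "g p = (if type_of_ind i (fst p) = j \<and> ?B p < \<infinity> then f (real_of_ereal (?B p)) else 0)" for p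
  have g: "g \<in> borel_measurable (count_space UNIV \<Otimes>\<^sub>M P)"
    unfolding g_def by measurable
  have "(\<integral>\<^sup>+x. f x \<partial>birth_measure i j) = (\<integral>\<^sup>+p. (if type_of_ind i (fst p) = j \<and> ?B p < \<infinity> then 1 else 0) * f (real_of_ereal (?B p)) \<partial>(count_space UNIV \<Otimes>\<^sub>M P))"
    unfolding birth_measure_def case_prod_beta
    by (subst nn_integral_distr, measurable, subst nn_integral_density, measurable)
  also have "\<dots> = (\<integral>\<^sup>+p. g p \<partial>(count_space UNIV \<Otimes>\<^sub>M P))"
    unfolding g_def by (intro nn_integral_cong) auto
  also have "\<dots> = (\<integral>\<^sup>+u. (\<integral>\<^sup>+\<omega>. g (u, \<omega>) \<partial>P) \<partial>count_space UNIV)"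
    by (rule nn_integral_fst[OF g, symmetric])
  finally show ?thesis by (simp only: g_def fst_conv snd_conv)
qed

lemma nn_integral_exp_birth_measure:
  "(\<integral>\<^sup>+x\<in>{0..}. ennreal (exp (- s * x)) \<partial>birth_measure i j) = renewal_transform s i j"
proof -
  have "(\<integral>\<^sup>+\<omega>. (if type_of_ind i u = j \<and> birth_time (\<lambda>v. \<xi>c v \<omega>) i u < \<infinity>
      then ennreal (exp (- s * real_of_ereal (birth_time (\<lambda>v. \<xi>c v \<omega>) i u))) *
         indicator {0..} (real_of_ereal (birth_time (\<lambda>v. \<xi>c v \<omega>) i u)) else 0) \<partial>P)
     = birth_transform s i u * (if type_of_ind i u = j then 1 else 0)" for u
  proof -
    have "(if birth_time x i u < \<infinity> then ennreal (exp (- s * real_of_ereal (birth_time x i u))) *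
         indicator {0..} (real_of_ereal (birth_time x i u)) else 0) = exp_neg s (birth_time x i u)" for x
      using birth_time_nonneg[of x i u] by (auto simp: exp_neg_def real_of_ereal_pos less_top[symmetric])
    then show ?thesis by (simp add: birth_transform_def)
  qed
  then show ?thesis
    by (subst nn_integral_birth_measure) (auto simp: renewal_transform_def)
qed

text \<open>Tonelli exchanges the sum over labels with the expectation. Infinite birth times are
  excluded on both sides, by the density and by the finite bound t.\<close>

lemma emeasure_birth_measure: "emeasure (birth_measure i j) {0..t} = expected_born P \<xi>c i t j"
proof -
  interpret pair_sigma_finite "count_space (UNIV :: nat list set)" P
    by (intro pair_sigma_finite.intro sigma_finite_measure_count_space_countable) (auto intro: sigma_finite_measure_axioms)
  have meas: "(\<lambda>(u, \<omega>). if type_of_ind i u = j \<and> birth_time (\<lambda>v. \<xi>c v \<omega>) i u \<le> ereal t then 1 else 0 :: ennreal)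
     \<in> borel_measurable (count_space UNIV \<Otimes>\<^sub>M P)"
    by (rule measurable_pair_measure_countable1) auto
  have "emeasure (birth_measure i j) {0..t} = (\<integral>\<^sup>+x. indicator {0..t} x \<partial>birth_measure i j)"
    by simp
  also have "\<dots> = (\<integral>\<^sup>+u. (\<integral>\<^sup>+\<omega>. (if type_of_ind i u = j \<and> birth_time (\<lambda>v. \<xi>c v \<omega>) i u \<le> ereal t then 1 else 0) \<partial>P) \<partial>count_space UNIV)"
  proof (subst nn_integral_birth_measure, simp, intro nn_integral_cong)
    fix u \<omega>
    show "(if type_of_ind i u = j \<and> birth_time (\<lambda>v. \<xi>c v \<omega>) i u < \<infinity>
        then indicator {0..t} (real_of_ereal (birth_time (\<lambda>v. \<xi>c v \<omega>) i u)) else 0)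
      = (if type_of_ind i u = j \<and> birth_time (\<lambda>v. \<xi>c v \<omega>) i u \<le> ereal t then 1 else 0 :: ennreal)"
      using birth_time_nonneg[of "\<lambda>v. \<xi>c v \<omega>" i u]
      by (cases "birth_time (\<lambda>v. \<xi>c v \<omega>) i u") (auto simp: indicator_def)
  qed
  also have "\<dots> = (\<integral>\<^sup>+\<omega>. (\<integral>\<^sup>+u. (if type_of_ind i u = j \<and> birth_time (\<lambda>v. \<xi>c v \<omega>) i u \<le> ereal t then 1 else 0) \<partial>count_space UNIV) \<partial>P)"
    using Fubini'[OF meas] by simp
  also have "\<dots> = expected_born P \<xi>c i t j"
    unfolding expected_born_def
  proof (rule nn_integral_cong)
    fix \<omega>
    have "num_born (\<lambda>u. \<xi>c u \<omega>) i t j = (\<integral>\<^sup>+u. indicator {u. type_of_ind i u = j \<and> birth_time (\<lambda>u. \<xi>c u \<omega>) i u \<le> ereal t} u \<partial>count_space UNIV)"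
      by (simp add: num_born_def)
    then show "(\<integral>\<^sup>+u. (if type_of_ind i u = j \<and> birth_time (\<lambda>v. \<xi>c v \<omega>) i u \<le> ereal t then 1 else 0) \<partial>count_space UNIV)
        = num_born (\<lambda>u. \<xi>c u \<omega>) i t j"
      by (simp add: indicator_def of_bool_def)
  qed
  finally show ?thesis .
qed

end

section \<open>Nonnegative matrices of spectral radius less than one\<close>

lemma eigenvalue_iff_det:
  fixes M :: "complex^'n^'n"
  shows "(\<exists>v. v \<noteq> 0 \<and> M *v v = l *s v) \<longleftrightarrow> det (mat l - M) = 0"
proof -
  have "(mat l - M) *v v = l *s v - M *v v" for v
    by (simp add: matrix_vector_mult_diff_rdistrib)
      (simp add: vec_eq_iff matrix_vector_mult_def mat_def if_distrib if_distribR cong: if_cong)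
  then have "(mat l - M) *v v = 0 \<longleftrightarrow> M *v v = l *s v" for v
    using right_minus_eq[of "l *s v" "M *v v"] by auto
  then have "(\<exists>v. v \<noteq> 0 \<and> M *v v = l *s v) \<longleftrightarrow> \<not> (\<forall>v. (mat l - M) *v v = 0 \<longrightarrow> v = 0)"
    by blast
  also have "\<dots> \<longleftrightarrow> det (mat l - M) = 0"
    using matrix_left_invertible_ker[of "mat l - M"] invertible_left_inverse[of "mat l - M"]
      invertible_det_nz[of "mat l - M"] by blast
  finally show ?thesis .
qed

text \<open>\<open>spectral_radius\<close> is a \<open>Max\<close>, which is meaningful only for a
  finite set. The characteristic polynomial is treated as an entire function: its zeros lie in a
  disc given by the row sums, and it is not constant.\<close>

lemma finite_eigenvalues:
  fixes M :: "complex^'n^'n"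
  shows "finite {l. \<exists>v. v \<noteq> 0 \<and> M *v v = l *s v}"
  unfolding Collect_cong[OF eigenvalue_iff_det]
proof (cases "\<exists>l. det (mat l - M) = 0")
  case False
  then have "{l. det (mat l - M) = 0} = {}" by blast
  then show "finite {l. det (mat l - M) = 0}" by simp
next
  case True
  define r where "r = (\<Sum>i\<in>UNIV. \<Sum>j\<in>UNIV. norm (M $ i $ j))"
  have bound: "norm l \<le> r" if "det (mat l - M) = 0" for l
  proof -
    from eigenvalue_iff_det[of M l, THEN iffD2, OF that]
    obtain v where v: "v \<noteq> 0" "M *v v = l *s v" by (elim exE conjE)
    \<comment> \<open>The component of largest modulus turns the eigenvalue equation into a bound by
      a row sum.\<close>
    define N where "N = range (\<lambda>i. norm (v $ i))"
    have N: "finite N" "N \<noteq> {}" by (auto simp: N_def)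
    have "Max N \<in> range (\<lambda>i. norm (v $ i))" using Max_in[OF N] by (simp only: N_def)
    then obtain i where i: "Max N = norm (v $ i)" by (rule rangeE)
    have max: "norm (v $ j) \<le> norm (v $ i)" for j
      unfolding i[symmetric] by (rule Max_ge[OF N(1)]) (simp add: N_def)
    have "norm (v $ i) \<noteq> 0"
    proof
      assume "norm (v $ i) = 0"
      then have "norm (v $ j) \<le> 0" for j using max[of j] by (simp only:)
      then have "v $ j = 0" for j by simp
      then show False using v(1) by (simp add: vec_eq_iff)
    qed
    then have pos: "0 < norm (v $ i)" by simp
    have "norm l * norm (v $ i) = norm ((M *v v) $ i)" by (simp add: v(2) norm_mult)
    also have "\<dots> \<le> (\<Sum>j\<in>UNIV. norm (M $ i $ j) * norm (v $ i))"
      unfolding matrix_vector_mult_def vec_lambda_beta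
      by (rule sum_norm_le) (simp add: norm_mult mult_left_mono max)
    also have "\<dots> = (\<Sum>j\<in>UNIV. norm (M $ i $ j)) * norm (v $ i)" by (simp add: sum_distrib_right)
    also have "\<dots> \<le> r * norm (v $ i)"
      unfolding r_def by (intro mult_right_mono member_le_sum[of i UNIV "\<lambda>i. \<Sum>j\<in>UNIV. norm (M $ i $ j)"] sum_nonneg) auto
    finally show ?thesis using pos by simp
  qed
  have hol: "(\<lambda>l. det (mat l - M)) holomorphic_on UNIV"
  proof (rule det_holomorphic)
    fix i j
    show "(\<lambda>l. (mat l - M) $ i $ j) holomorphic_on UNIV"
      by (cases "i = j") (auto simp: mat_def intro!: holomorphic_intros)
  qed
  have "\<not> (\<lambda>l. det (mat l - M)) constant_on UNIV"
  proof
    assume "(\<lambda>l. det (mat l - M)) constant_on UNIV"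
    then obtain k where k: "\<And>l. det (mat l - M) = k" by (auto simp: constant_on_def)
    from True obtain l0 where "det (mat l0 - M) = 0" by (rule exE)
    \<comment> \<open>Constancy would produce the eigenvalue r + 1, outside the disc that contains
      them all.\<close>
    then have "det (mat (of_real (r + 1)) - M) = 0" unfolding k .
    from bound[OF this] have "\<bar>r + 1\<bar> \<le> r" unfolding norm_of_real .
    then show False by linarith
  qed
  then have "finite {l \<in> cball 0 r. det (mat l - M) = 0}"
    by (intro holomorphic_compact_finite_zeros[OF hol]) auto
  moreover have "{l. det (mat l - M) = 0} \<subseteq> {l \<in> cball 0 r. det (mat l - M) = 0}"
    using bound by (simp add: subset_iff)
  ultimately show "finite {l. det (mat l - M) = 0}" by (rule finite_subset[rotated])
qed

lemma eigenvalue_le_spectral_radius: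
  fixes M :: "complex^'n^'n"
  assumes "v \<noteq> 0" "M *v v = l *s v"
  shows "norm l \<le> spectral_radius M"
  unfolding spectral_radius_def using finite_eigenvalues[of M] assms by (intro Max_ge) auto

text \<open>The vector is (1 - A)^-1 applied to the all-ones vector; the point is its positivity.
  For t in [0,1] the matrix 1 - tA is invertible, since a null vector would be an eigenvector of A
  for 1/t \<ge> 1. Positivity is then carried from t = 0 to t = 1 by connectedness.\<close>

lemma nonneg_matrix_supersolution:
  fixes A :: "'n::finite \<Rightarrow> 'n \<Rightarrow> real"
  assumes nonneg: "\<And>i j. 0 \<le> A i j"
    and rad: "spectral_radius (\<chi> i j. complex_of_real (A i j)) < 1"
  shows "\<exists>v. (\<forall>i. 1 \<le> v i) \<and> (\<forall>i. v i = 1 + (\<Sum>j\<in>UNIV. A i j * v j))"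
proof -
  define B :: "real \<Rightarrow> real^'n^'n" where "B t = (\<chi> i j. (if i = j then 1 else 0) - t * A i j)" for t
  have Bv: "(B t *v x) $ i = x $ i - t * (\<Sum>j\<in>UNIV. A i j * x $ j)" for t x i
  proof -
    have "(B t *v x) $ i = (\<Sum>j\<in>UNIV. (if i = j then x $ j else 0) - t * (A i j * x $ j))"
      unfolding B_def matrix_vector_mult_def vec_lambda_beta
      by (intro sum.cong) (auto simp: left_diff_distrib)
    then show ?thesis by (simp add: sum_subtractf sum_distrib_left)
  qed
  have nz: "det (B t) \<noteq> 0" if t: "0 \<le> t" "t \<le> 1" for t
  proof
    assume "det (B t) = 0"
    then have "\<not> (\<exists>B'. B' ** B t = mat 1)"
      using invertible_det_nz[of "B t"] invertible_left_inverse[of "B t"] by simp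
    then have "\<not> (\<forall>x. B t *v x = 0 \<longrightarrow> x = 0)" unfolding matrix_left_invertible_ker .
    then obtain x where x: "B t *v x = 0" "x \<noteq> 0" unfolding not_all not_imp by (elim exE conjE)
    have xi: "x $ i = t * (\<Sum>j\<in>UNIV. A i j * x $ j)" for i
      using Bv[of t x i] x(1) by simp
    have "t \<noteq> 0"
    proof
      assume "t = 0"
      have "x $ i = 0" for i using xi[of i] unfolding \<open>t = 0\<close> mult_zero_left .
      then show False using x(2) by (simp add: vec_eq_iff)
    qed
    then have inv: "s = 1 / t * y" if "y = t * s" for s y using that by simp
    define v where "v = (\<chi> i. complex_of_real (x $ i))"
    have "v \<noteq> 0" using x(2) by (simp add: v_def vec_eq_iff)
    moreover have "(\<chi> i j. complex_of_real (A i j)) *v v = complex_of_real (1 / t) *s v"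
    proof (rule vec_eq_iff[THEN iffD2, rule_format])
      fix i
      have "(\<Sum>j\<in>UNIV. A i j * x $ j) = 1 / t * x $ i" by (rule inv[OF xi])
      then have "complex_of_real (\<Sum>j\<in>UNIV. A i j * x $ j) = complex_of_real (1 / t * x $ i)" by (rule arg_cong)
      then show "((\<chi> i j. complex_of_real (A i j)) *v v) $ i = (complex_of_real (1 / t) *s v) $ i"
        by (simp add: v_def matrix_vector_mult_def)
    qed
    ultimately have "norm (complex_of_real (1 / t)) < 1"
      using eigenvalue_le_spectral_radius rad by (meson le_less_trans)
    then show False unfolding norm_of_real using t \<open>t \<noteq> 0\<close> by simp
  qed
  \<comment> \<open>Cramer's formula for the solution of (1 - tA) w = 1, from which continuity in t
    can be read off.\<close>
  define w where "w t k = det (\<chi> i l. if l = k then 1 else B t $ i $ l) / det (B t)" for t k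
  have w: "w t i = 1 + t * (\<Sum>j\<in>UNIV. A i j * w t j)" if t: "0 \<le> t" "t \<le> 1" for t i
  proof -
    have "B t *v (\<chi> k. w t k) = (\<chi> i. 1)"
      unfolding cramer[OF nz[OF t]] w_def vec_lambda_beta ..
    then show ?thesis using Bv[of t "\<chi> k. w t k" i] by simp
  qed
  have cont: "continuous_on {0..1} (\<lambda>t. w t k)" for k
  proof -
    have e: "continuous_on {0..1} (\<lambda>t. B t $ i $ l)" for i l
      unfolding B_def vec_lambda_beta by (intro continuous_intros)
    have e': "continuous_on {0..1} (\<lambda>t. if l = k then 1 else B t $ i $ l)" for i l
      by (cases "l = k") (auto intro: e)
    have "continuous_on {0..1} (\<lambda>t. det (B t))"
      "continuous_on {0..1} (\<lambda>t. det (\<chi> i l. if l = k then 1 else B t $ i $ l))"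
      unfolding det_def vec_lambda_beta by (intro continuous_intros e e')+
    then show ?thesis unfolding w_def using nz by (intro continuous_on_divide) auto
  qed
  have pos: "1 \<le> w t i" if t: "0 \<le> t" "t \<le> 1" and p: "\<And>j. 1/2 < w t j" for t i
  proof -
    have "0 \<le> A i j * w t j" for j using p[of j] by (intro mult_nonneg_nonneg nonneg) auto
    then have "0 \<le> (\<Sum>j\<in>UNIV. A i j * w t j)" by (rule sum_nonneg)
    then have "0 \<le> t * (\<Sum>j\<in>UNIV. A i j * w t j)" using t by simp
    then show ?thesis using w[OF t, of i] by linarith
  qed
  \<comment> \<open>If all entries exceed 1/2, the equation lifts them to at least 1. The same set
    of t is therefore given by an open and by a closed condition.\<close>
  let ?T = "\<Inter>i. {t \<in> {0..1}. w t i \<in> {1/2<..}}"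
  have eq: "?T = (\<Inter>i. {t \<in> {0..1}. w t i \<in> {1..}})"
  proof (intro equalityI subsetI)
    fix t assume "t \<in> ?T"
    then have "0 \<le> t" "t \<le> 1" "\<And>j. 1/2 < w t j" by auto
    then show "t \<in> (\<Inter>i. {t \<in> {0..1}. w t i \<in> {1..}})" using pos by auto
  next
    fix t assume "t \<in> (\<Inter>i. {t \<in> {0..1}. w t i \<in> {1..}})"
    then have t: "0 \<le> t" "t \<le> 1" "1 \<le> w t j" for j by auto
    have "1 / 2 < w t j" for j using t(3)[of j] by simp
    then show "t \<in> ?T" using t(1,2) by auto
  qed
  have pre: "{t \<in> {0..1}. w t i \<in> X} = {0..1} \<inter> (\<lambda>t. w t i) -` X" for i X by auto
  have "openin (top_of_set {0..1}) {t \<in> {0..1}. w t i \<in> {1/2<..}}" for i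
    unfolding pre by (rule continuous_openin_preimage_gen[OF cont open_greaterThan])
  then have "openin (top_of_set {0..1}) ?T"
    by (intro openin_INT2) auto
  moreover have "closedin (top_of_set {0..1}) {t \<in> {0..1}. w t i \<in> {1..}}" for i
    unfolding pre by (rule continuous_closedin_preimage[OF cont closed_atLeast])
  then have "closedin (top_of_set {0..1}) ?T"
    unfolding eq by (intro closedin_INT) auto
  moreover have "connected {0..1::real}" by simp
  ultimately have T: "?T = {} \<or> ?T = {0..1}" unfolding connected_clopen by blast
  have "0 \<in> ?T" using w[of 0] by simp
  then have "?T = {0..1}" using T by blast
  moreover have "(1::real) \<in> {0..1}" by simp
  ultimately have "1 \<in> ?T" by (simp only:)
  then have "1 \<le> w 1 i" for i unfolding eq by auto
  moreover have "w 1 i = 1 + (\<Sum>j\<in>UNIV. A i j * w 1 j)" for i using w[of 1 i] by simp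
  ultimately show ?thesis by blast
qed

section \<open>Lower bounds in vertical strips\<close>

text \<open>\<open>Z\<close> is a supposed sequence running off to infinity in the strip along which
  \<open>d\<close> tends to 0. The lower bound on Re z = \<theta> survives translation and limit; it
  excludes a zero of the limit on that line and an identically vanishing limit, the two cases out of
  reach of Hurwitz's theorem.\<close>

lemma holomorphic_zero_free_limit:
  fixes d :: "complex \<Rightarrow> complex" and \<sigma> \<theta> m :: real
  assumes \<sigma>: "\<sigma> < \<theta>"
    and hol: "d holomorphic_on {z. \<sigma> < Re z}"
    and bnd: "\<And>z. \<sigma> < Re z \<Longrightarrow> norm (d z) \<le> B"
    and m: "0 < m" and line: "\<And>\<eta>. m \<le> norm (d (Complex \<theta> \<eta>))"
    and fin: "finite {z. \<theta> < Re z \<and> d z = 0}"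
    and Z: "\<And>n. \<theta> - \<delta> \<le> Re (Z n)" "\<And>n. Re (Z n) \<le> c" "\<And>n. real n \<le> \<bar>Im (Z n)\<bar>" and \<delta>: "\<sigma> < \<theta> - \<delta>"
    and Zl: "\<And>n. \<theta> - 1 / real (Suc n) \<le> Re (Z n)" and dZ: "(\<lambda>n. d (Z n)) \<longlonglongrightarrow> 0"
  shows False
proof -
  let ?S = "{z. \<sigma> < Re z}"
  define f where "f n w = d (w + \<i> * of_real (Im (Z n)))" for n w
  define H where "H = {h. h holomorphic_on ?S \<and> (\<forall>z\<in>?S. norm (h z) \<le> B)}"
  have S: "open ?S" by (rule open_halfspace_Re_gt)
  have fH: "f n \<in> H" for n
  proof -
    have "(\<lambda>w. d (w + \<i> * of_real (Im (Z n)))) holomorphic_on ?S"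
      by (rule holomorphic_on_compose_gen[of "\<lambda>w. w + \<i> * of_real (Im (Z n))" ?S d, unfolded o_def, OF _ hol])
        (auto intro!: holomorphic_intros)
    then show ?thesis using bnd by (auto simp: H_def f_def[abs_def])
  qed
  obtain g r where g: "g holomorphic_on ?S" and r: "strict_mono (r :: nat \<Rightarrow> nat)"
    and lim: "\<And>x. x \<in> ?S \<Longrightarrow> (\<lambda>n. f (r n) x) \<longlonglongrightarrow> g x"
    and ul: "\<And>K. compact K \<Longrightarrow> K \<subseteq> ?S \<Longrightarrow> uniform_limit K (f \<circ> r) g sequentially"
  proof (rule Montel[OF S, of H f])
    show "range f \<subseteq> H" using fH by auto
    show "\<exists>B. \<forall>h\<in>H. \<forall>z\<in>K. norm (h z) \<le> B" if "compact K" "K \<subseteq> ?S" for K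
      using that by (intro exI[of _ B]) (auto simp: H_def)
  qed (auto simp: H_def)
  have gl: "m \<le> norm (g (Complex \<theta> 0))"
  proof (rule LIMSEQ_le_const)
    show "(\<lambda>n. norm (f (r n) (Complex \<theta> 0))) \<longlonglongrightarrow> norm (g (Complex \<theta> 0))"
      using \<sigma> by (intro tendsto_norm lim) simp
    have "Complex \<theta> 0 + \<i> * of_real y = Complex \<theta> y" for y by (simp add: complex_eq_iff)
    then show "\<exists>N. \<forall>n\<ge>N. m \<le> norm (f (r n) (Complex \<theta> 0))" using line by (simp add: f_def)
  qed
  have "seq_compact {\<theta> - \<delta>..c}" by (intro compact_imp_seq_compact compact_Icc)
  moreover have "\<forall>n. Re (Z (r n)) \<in> {\<theta> - \<delta>..c}" using Z by simp
  ultimately obtain x q where x: "x \<in> {\<theta> - \<delta>..c}" and q: "strict_mono (q :: nat \<Rightarrow> nat)"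
    and xl': "((\<lambda>n. Re (Z (r n))) \<circ> q) \<longlonglongrightarrow> x"
    by (rule seq_compactE)
  then have xl: "(\<lambda>n. Re (Z (r (q n)))) \<longlonglongrightarrow> x" by (simp add: o_def)
  have rq: "strict_mono (\<lambda>n. r (q n))" using strict_mono_o[OF r q] by (simp add: o_def)
  have "\<theta> \<le> x"
  proof (rule LIMSEQ_le)
    have "(\<lambda>n. \<theta> - 1 / real (Suc n)) \<longlonglongrightarrow> \<theta>" by real_asymp
    from LIMSEQ_subseq_LIMSEQ[OF this rq] show "(\<lambda>n. \<theta> - 1 / real (Suc (r (q n)))) \<longlonglongrightarrow> \<theta>"
      unfolding o_def .
    show "(\<lambda>n. Re (Z (r (q n)))) \<longlonglongrightarrow> x" by (rule xl)
  qed (use Zl in auto)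
  \<comment> \<open>Translation by the imaginary part moves \<open>Z n\<close> to its real part. All
    evaluation points thus lie in this compact segment, where the convergence is uniform; pointwise
    convergence would not do, as they vary with n.\<close>
  define K :: "complex set" where "K = of_real ` {\<theta> - \<delta>..c}"
  have K: "compact K" "K \<subseteq> ?S"
    unfolding K_def using \<delta> by (auto intro!: compact_continuous_image continuous_intros)
  let ?y = "\<lambda>n. complex_of_real (Re (Z (r (q n))))"
  have yK: "?y n \<in> K" for n using Z by (auto simp: K_def)
  have xK: "complex_of_real x \<in> K" using x by (auto simp: K_def)
  have fy: "f (r (q n)) (?y n) = d (Z (r (q n)))" for n
    by (simp add: f_def flip: complex_eq)
  have "(\<lambda>n. f (r (q n)) (?y n)) \<longlonglongrightarrow> 0"
    unfolding fy using LIMSEQ_subseq_LIMSEQ[OF dZ rq] by (simp add: o_def)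
  moreover have "(\<lambda>n. g (?y n)) \<longlonglongrightarrow> g (of_real x)"
  proof (rule continuous_on_tendsto_compose[OF holomorphic_on_imp_continuous_on[OF holomorphic_on_subset[OF g K(2)]]])
    show "?y \<longlonglongrightarrow> of_real x" by (intro tendsto_of_real xl)
  qed (use yK xK in auto)
  moreover have "(\<lambda>n. f (r (q n)) (?y n) - g (?y n)) \<longlonglongrightarrow> 0"
  proof (rule LIMSEQ_I)
    fix e :: real assume "0 < e"
    from uniform_limitD[OF ul[OF K] this] obtain N where
      N: "\<And>n x. n \<ge> N \<Longrightarrow> x \<in> K \<Longrightarrow> dist (f (r n) x) (g x) < e"
      by (auto simp: eventually_sequentially)
    have "n \<le> q n" for n using q by (rule seq_suble)
    then show "\<exists>N. \<forall>n\<ge>N. norm (f (r (q n)) (?y n) - g (?y n) - 0) < e"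
      using N yK by (intro exI[of _ N]) (auto simp: dist_norm intro: order_trans)
  qed
  ultimately have "(\<lambda>n. f (r (q n)) (?y n) - (f (r (q n)) (?y n) - g (?y n))) \<longlonglongrightarrow> 0 - 0"
    by (intro tendsto_diff)
  then have "(\<lambda>n. g (?y n)) \<longlonglongrightarrow> 0" by simp
  then have gx: "g (of_real x) = 0"
    using \<open>(\<lambda>n. g (?y n)) \<longlonglongrightarrow> g (of_real x)\<close> LIMSEQ_unique by blast
  have "x \<noteq> \<theta>" using gl gx m by (auto simp: complex_of_real_def)
  then have x\<theta>: "\<theta> < x" using \<open>\<theta> \<le> x\<close> by simp
  \<comment> \<open>\<open>V\<close> has bounded height, so that translates by large imaginary parts
    clear the finitely many zeros of \<open>d\<close>.\<close>
  define V where "V = {z. \<theta> < Re z} \<inter> ({z. Im z < 1} \<inter> {z. - 1 < Im z})"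
  have V: "open V" "connected V" "V \<subseteq> ?S"
  proof -
    show "open V" unfolding V_def
      by (intro open_Int open_halfspace_Re_gt open_halfspace_Im_gt open_halfspace_Im_lt)
    show "connected V" unfolding V_def
      by (intro convex_connected convex_Int convex_halfspace_Re_gt convex_halfspace_Im_gt convex_halfspace_Im_lt)
    show "V \<subseteq> ?S" unfolding V_def using \<sigma> by auto
  qed
  obtain N :: nat where N: "\<And>z. \<theta> < Re z \<Longrightarrow> d z = 0 \<Longrightarrow> \<bar>Im z\<bar> < real N"
  proof -
    have "finite ((\<lambda>z. \<bar>Im z\<bar>) ` {z. \<theta> < Re z \<and> d z = 0})" using fin by simp
    from bdd_above_finite[OF this] obtain M where M: "\<forall>y \<in> (\<lambda>z. \<bar>Im z\<bar>) ` {z. \<theta> < Re z \<and> d z = 0}. y \<le> M"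
      unfolding bdd_above_def by (rule exE)
    obtain N :: nat where N: "M < real N" using reals_Archimedean2 by blast
    have "\<bar>Im z\<bar> < real N" if "\<theta> < Re z" "d z = 0" for z
      by (rule le_less_trans[OF M[rule_format] N]) (use that in blast)
    then show ?thesis by (rule that)
  qed
  have "g (of_real x) \<noteq> 0"
  \<comment> \<open>The offset \<open>Suc N\<close>: points of \<open>V\<close> have |Im w| < 1, so
    a translation by at least N + 1 reaches heights above N, where \<open>d\<close> has no
    zeros.\<close>
  proof (rule Hurwitz_no_zeros[OF V(1,2), where \<F>="\<lambda>n. f (r (n + Suc N))" and g=g and ?z0.0="of_real x"])
    show "f (r (n + Suc N)) holomorphic_on V" for n
      by (rule holomorphic_on_subset[OF _ V(3)]) (use fH[of "r (n + Suc N)"] in \<open>simp add: H_def\<close>)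
    show "g holomorphic_on V" using g V(3) by (rule holomorphic_on_subset)
    show "uniform_limit K (\<lambda>n. f (r (n + Suc N))) g sequentially" if "compact K" "K \<subseteq> V" for K
    proof (rule uniform_limitI)
      fix e :: real assume "0 < e"
      have "\<forall>\<^sub>F n in sequentially. \<forall>x\<in>K. dist ((f \<circ> r) n x) (g x) < e"
        using that V(3) by (intro uniform_limitD[OF ul \<open>0 < e\<close>]) auto
      then show "\<forall>\<^sub>F n in sequentially. \<forall>x\<in>K. dist (f (r (n + Suc N)) x) (g x) < e"
        by (subst (asm) eventually_sequentially_seg[of _ "Suc N", symmetric]) (simp add: o_def)
    qed
    show "f (r (n + Suc N)) w \<noteq> 0" if w: "w \<in> V" for n w
    proof
      let ?k = "r (n + Suc N)"
      assume "f ?k w = 0"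
      then have "\<bar>Im (w + \<i> * of_real (Im (Z ?k)))\<bar> < real N"
        using w by (intro N) (auto simp: f_def V_def)
      moreover have "n + Suc N \<le> ?k" using r by (rule seq_suble)
      then have "real N + 1 \<le> \<bar>Im (Z ?k)\<bar>" using Z(3)[of ?k] by linarith
      ultimately show False using w by (auto simp: V_def)
    qed
    show "of_real x \<in> V" using x\<theta> by (simp add: V_def)
    show "\<not> g constant_on V"
    proof
      assume "g constant_on V"
      then obtain k where k: "\<And>w. w \<in> V \<Longrightarrow> g w = k" by (auto simp: constant_on_def)
      have "k = 0" using k[OF \<open>of_real x \<in> V\<close>] gx by simp
      then have g0: "g w = 0" if "w \<in> V" for w using k[OF that] by simp
      \<comment> \<open>The point \<theta> is only on the boundary of \<open>V\<close>; the zero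
        function is carried there by continuity and contradicts \<open>gl\<close>.\<close>
      have "(\<lambda>n. g (Complex (\<theta> + 1 / real (Suc n)) 0)) \<longlonglongrightarrow> g (Complex \<theta> 0)"
      proof (rule continuous_on_tendsto_compose[OF holomorphic_on_imp_continuous_on[OF g]])
        have "(\<lambda>n. \<theta> + 1 / real (Suc n)) \<longlonglongrightarrow> \<theta>" by real_asymp
        then show "(\<lambda>n. Complex (\<theta> + 1 / real (Suc n)) 0) \<longlonglongrightarrow> Complex \<theta> 0" by (intro tendsto_Complex tendsto_const)
        have "\<sigma> < \<theta> + 1 / real (Suc n)" for n using \<sigma> by (smt (verit) divide_nonneg_nonneg of_nat_0_le_iff)
        then show "\<forall>\<^sub>F n in sequentially. Complex (\<theta> + 1 / real (Suc n)) 0 \<in> ?S" by simp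
      qed (use \<sigma> in auto)
      moreover have "g (Complex (\<theta> + 1 / real (Suc n)) 0) = 0" for n
        by (rule g0) (simp add: V_def)
      ultimately have "g (Complex \<theta> 0) = 0" by (simp add: LIMSEQ_const_iff)
      then show False using gl m by simp
    qed
  qed
  then show False using gx by simp
qed

text \<open>At large heights the limit argument bounds \<open>d\<close> from below. At small heights
  the zeros in question form a compact set that does not meet the line Re z = \<theta>, so a smaller
  \<delta> avoids them.\<close>

lemma strip_lower_bound:
  fixes d :: "complex \<Rightarrow> complex" and \<sigma> \<theta> m c :: real
  assumes \<sigma>: "\<sigma> < \<theta>"
    and hol: "d holomorphic_on {z. \<sigma> < Re z}"
    and bnd: "\<And>z. \<sigma> < Re z \<Longrightarrow> norm (d z) \<le> B"
    and m: "0 < m" and line: "\<And>\<eta>. m \<le> norm (d (Complex \<theta> \<eta>))"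
    and fin: "finite {z. \<theta> < Re z \<and> d z = 0}"
  shows "\<exists>\<delta> m' T. 0 < \<delta> \<and> 0 < m' \<and> \<delta> < \<theta> - \<sigma> \<and>
     (\<forall>z. \<theta> - \<delta> \<le> Re z \<longrightarrow> Re z \<le> c \<longrightarrow> T \<le> \<bar>Im z\<bar> \<longrightarrow> m' \<le> norm (d z)) \<and>
     (\<forall>z. \<theta> - \<delta> \<le> Re z \<longrightarrow> Re z \<le> \<theta> \<longrightarrow> d z \<noteq> 0)"
proof -
  define \<delta>0 where "\<delta>0 = (\<theta> - \<sigma>) / 2"
  have \<delta>0: "0 < \<delta>0" "\<sigma> < \<theta> - \<delta>0" using \<sigma> by (auto simp: \<delta>0_def field_simps)
  \<comment> \<open>One index governs margin, height and lower bound, so the negation directly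
    yields a sequence. With \<open>max c \<theta>\<close> the range reaches up to \<theta> whatever
    \<open>c\<close> is.\<close>
  have "\<exists>n::nat. \<forall>z. \<theta> - min \<delta>0 (1 / real (Suc n)) \<le> Re z \<longrightarrow> Re z \<le> max c \<theta> \<longrightarrow> real n \<le> \<bar>Im z\<bar> \<longrightarrow> 1 / real (Suc n) \<le> norm (d z)"
  proof (rule ccontr)
    assume "\<not> ?thesis"
    then have "\<forall>n::nat. \<exists>z. \<theta> - min \<delta>0 (1 / real (Suc n)) \<le> Re z \<and> Re z \<le> max c \<theta> \<and> real n \<le> \<bar>Im z\<bar> \<and> norm (d z) < 1 / real (Suc n)"
      by (simp add: not_le)
    from choice[OF this] obtain Z where Z: "\<And>n. \<theta> - min \<delta>0 (1 / real (Suc n)) \<le> Re (Z n)" "\<And>n. Re (Z n) \<le> max c \<theta>"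
      "\<And>n. real n \<le> \<bar>Im (Z n)\<bar>" "\<And>n. norm (d (Z n)) < 1 / real (Suc n)"
      by blast
    show False
    proof (rule holomorphic_zero_free_limit[OF \<sigma> hol bnd m line fin, where Z=Z and \<delta>=\<delta>0 and c="max c \<theta>"])
      show "\<theta> - \<delta>0 \<le> Re (Z n)" for n using Z(1)[of n] by linarith
      show "\<theta> - 1 / real (Suc n) \<le> Re (Z n)" for n using Z(1)[of n] by linarith
      have "(\<lambda>n. 1 / real (Suc n)) \<longlonglongrightarrow> 0" by real_asymp
      then show "(\<lambda>n. d (Z n)) \<longlonglongrightarrow> 0"
        by (rule Lim_null_comparison[rotated]) (use Z(4) in \<open>auto intro!: always_eventually less_imp_le\<close>)
    qed (use Z \<delta>0 in auto)
  qed
  then obtain n :: nat where n: "\<And>z. \<theta> - min \<delta>0 (1 / real (Suc n)) \<le> Re z \<Longrightarrow> Re z \<le> max c \<theta> \<Longrightarrow> real n \<le> \<bar>Im z\<bar> \<Longrightarrow> 1 / real (Suc n) \<le> norm (d z)"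
    by blast
  define \<delta>1 where "\<delta>1 = min \<delta>0 (1 / real (Suc n))"
  have \<delta>1: "0 < \<delta>1" "\<delta>1 \<le> \<delta>0" using \<delta>0 by (auto simp: \<delta>1_def)
  define Q where "Q = {z \<in> cbox (Complex (\<theta> - \<delta>1) (- real n)) (Complex \<theta> (real n)). d z = 0}"
  have Qsub: "cbox (Complex (\<theta> - \<delta>1) (- real n)) (Complex \<theta> (real n)) \<subseteq> {z. \<sigma> < Re z}"
    using \<delta>0 \<delta>1 by (auto simp: in_cbox_complex_iff)
  have "compact Q"
  proof -
    have "closedin (top_of_set (cbox (Complex (\<theta> - \<delta>1) (- real n)) (Complex \<theta> (real n)))) Q"
      unfolding Q_def
      using continuous_closedin_preimage_constant[OF holomorphic_on_imp_continuous_on[OF holomorphic_on_subset[OF hol Qsub]], of 0] .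
    then show ?thesis using closedin_compact compact_cbox by blast
  qed
  have Qlt: "Re z < \<theta>" if "z \<in> Q" for z
  proof -
    have "Re z \<noteq> \<theta>"
    proof
      assume "Re z = \<theta>"
      then have "z = Complex \<theta> (Im z)" by (simp add: complex_eq_iff)
      then show False using line[of "Im z"] m that by (auto simp: Q_def)
    qed
    moreover have "Re z \<le> \<theta>" using that by (auto simp: Q_def in_cbox_complex_iff)
    ultimately show ?thesis by simp
  qed
  obtain \<delta> where \<delta>: "0 < \<delta>" "\<delta> \<le> \<delta>1" "\<And>z. z \<in> Q \<Longrightarrow> Re z < \<theta> - \<delta>"
  proof (cases "Q = {}")
    case True then show ?thesis using that[of \<delta>1] \<delta>1 by auto
  next
    case False
    then obtain z0 where z0: "z0 \<in> Q" "\<And>z. z \<in> Q \<Longrightarrow> Re z \<le> Re z0"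
      using continuous_attains_sup[OF \<open>compact Q\<close> _ continuous_on_Re[OF continuous_on_id]] by auto
    \<comment> \<open>Half the distance from the line to the rightmost zero in \<open>Q\<close>
      keeps the inequality strict.\<close>
    have "Re z < \<theta> - min \<delta>1 ((\<theta> - Re z0) / 2)" if "z \<in> Q" for z
      using z0(2)[OF that] Qlt[OF z0(1)] by (auto simp: min_def field_simps)
    then show ?thesis using that[of "min \<delta>1 ((\<theta> - Re z0) / 2)"] \<delta>1 Qlt[OF z0(1)] by auto
  qed
  have nz: "d z \<noteq> 0" if z: "\<theta> - \<delta> \<le> Re z" "Re z \<le> \<theta>" for z
  proof (cases "real n \<le> \<bar>Im z\<bar>")
    case True
    then have "1 / real (Suc n) \<le> norm (d z)" using z \<delta> by (intro n) (auto simp: \<delta>1_def)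
    then show ?thesis by auto
  next
    case False
    then have "z \<in> cbox (Complex (\<theta> - \<delta>1) (- real n)) (Complex \<theta> (real n))"
      using z \<delta> by (auto simp: in_cbox_complex_iff)
    then show ?thesis using \<delta>(3)[of z] z by (auto simp: Q_def)
  qed
  show ?thesis
  proof (intro exI conjI)
    show "0 < \<delta>" "0 < 1 / real (Suc n)" using \<delta> by auto
    show "\<delta> < \<theta> - \<sigma>" using \<delta> \<delta>1 \<delta>0 by linarith
    show "\<forall>z. \<theta> - \<delta> \<le> Re z \<longrightarrow> Re z \<le> c \<longrightarrow> real n \<le> \<bar>Im z\<bar> \<longrightarrow> 1 / real (Suc n) \<le> norm (d z)"
      using n \<delta>(2) by (auto simp: \<delta>1_def)
    show "\<forall>z. \<theta> - \<delta> \<le> Re z \<longrightarrow> Re z \<le> \<theta> \<longrightarrow> d z \<noteq> 0" using nz by blast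
  qed
qed

section \<open>Residues at the poles\<close>

lemma higher_deriv_exp_mult:
  "(deriv ^^ n) (\<lambda>z. exp (z * c)) = (\<lambda>z. c ^ n * exp (z * c))" for c :: complex
proof (induction n)
  case (Suc n)
  have "deriv (\<lambda>z. c ^ n * exp (z * c)) z = c ^ Suc n * exp (z * c)" for z
    by (rule DERIV_imp_deriv) (auto intro!: derivative_eq_intros)
  then show ?case using Suc by auto
qed simp

text \<open>The residue at a pole of order at most n is the Taylor coefficient of index n - 1 of
  exp(zt) q(z). By Leibniz, derivatives of the exponential bring out the powers of t below n, and
  the coefficients come from q alone, so they do not depend on t.\<close>

lemma residue_exp_expansion:
  assumes r: "0 < r" and q: "q holomorphic_on ball l r"
    and f: "\<And>z. z \<in> ball l r - {l} \<Longrightarrow> f z * (z - l) ^ n = q z"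
  shows "\<exists>c. \<forall>t::real. residue (\<lambda>z. exp (z * complex_of_real t) * f z) l
     = exp (l * complex_of_real t) * (\<Sum>k<n. complex_of_real t ^ k * c k)"
proof -
  have ev: "eventually (\<lambda>z. z \<in> ball l r - {l}) (at l)"
    unfolding eventually_at using r by (intro exI[of _ r]) (auto simp: dist_commute)
  have res: "residue (\<lambda>z. exp (z * complex_of_real t) * f z) l
      = residue (\<lambda>z. exp (z * complex_of_real t) * q z / (z - l) ^ n) l" for t
  proof (rule residue_cong)
    show "eventually (\<lambda>z. exp (z * complex_of_real t) * f z = exp (z * complex_of_real t) * q z / (z - l) ^ n) (at l)"
      using ev
    proof eventually_elim
      case (elim z)
      have "(z - l) ^ n \<noteq> 0" using elim by simp
      then have "f z = q z / (z - l) ^ n" using f[OF elim] by (simp add: eq_divide_eq)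
      then show ?case by simp
    qed
  qed simp
  have hol: "(\<lambda>z. exp (z * complex_of_real t) * q z) holomorphic_on ball l r" for t
    by (intro holomorphic_intros q)
  have l: "l \<in> ball l r" using r by simp
  show ?thesis
  proof (cases n)
    case 0
    have "residue (\<lambda>z. exp (z * complex_of_real t) * q z) l = 0" for t
      by (rule residue_holo[OF open_ball l hol])
    then show ?thesis using res 0 by simp
  next
    case (Suc m)
    \<comment> \<open>Here m = n - 1, and k counts the derivatives that fall on the
      exponential.\<close>
    define c where "c k = of_nat (m choose k) * (deriv ^^ (m - k)) q l / fact m" for k
    have "residue (\<lambda>z. exp (z * complex_of_real t) * f z) l
       = exp (l * complex_of_real t) * (\<Sum>k<n. complex_of_real t ^ k * c k)" for t
    proof -
      have "residue (\<lambda>z. exp (z * complex_of_real t) * f z) l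
          = (deriv ^^ m) (\<lambda>z. exp (z * complex_of_real t) * q z) l / fact m"
        unfolding res Suc by (rule residue_holomorphic_over_power[OF open_ball l hol])
      also have "(deriv ^^ m) (\<lambda>z. exp (z * complex_of_real t) * q z) l
          = (\<Sum>k = 0..m. of_nat (m choose k) * (deriv ^^ k) (\<lambda>z. exp (z * complex_of_real t)) l * (deriv ^^ (m - k)) q l)"
        by (rule higher_deriv_mult[OF _ q open_ball l]) (intro holomorphic_intros)
      also have "\<dots> = exp (l * complex_of_real t) * (\<Sum>k=0..m. complex_of_real t ^ k * (of_nat (m choose k) * (deriv ^^ (m - k)) q l))"
        unfolding higher_deriv_exp_mult sum_distrib_left by (intro sum.cong refl) (simp only: mult_ac)
      also have "\<dots> / fact m = exp (l * complex_of_real t) * (\<Sum>k=0..m. complex_of_real t ^ k * c k)"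
        unfolding c_def by (simp only: sum_divide_distrib[symmetric] times_divide_eq_right)
      also have "{0..m} = {..<n}" using Suc by auto
      finally show ?thesis .
    qed
    then show ?thesis by (intro exI[of _ c] allI)
  qed
qed

section \<open>The characteristic determinant\<close>

text \<open>Applied to two families: the intensities, with \<sigma> to the left of \<theta>, and the
  birth measures, with an abscissa far to the right.\<close>

locale laplace_matrix =
  fixes \<mu> :: "'p::finite \<Rightarrow> 'p \<Rightarrow> real measure" and \<sigma> :: real
  assumes sets_mu [simp]: "sets (\<mu> i j) = sets borel"
    and int_mu: "set_integrable (\<mu> i j) {0..} (\<lambda>x. exp (- \<sigma> * x))"
begin

definition char_det :: "complex \<Rightarrow> complex" where
  "char_det z = det (mat 1 - laplace \<mu> z)"

text \<open>The summand 1 accounts for the identity matrix; it also makes the bound at least 1, so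
  that it covers the entries 0 and 1 of \<open>cofactor_matrix\<close>.\<close>

definition entry_bound :: real where
  "entry_bound = 1 + (\<Sum>i\<in>UNIV. \<Sum>j\<in>UNIV. LINT x:{0..}|\<mu> i j. exp (- \<sigma> * x))"

lemma laplace_entry: "laplace \<mu> z $ i $ j = (LINT x:{0..}|\<mu> i j. exp (- z * complex_of_real x))"
  by (simp add: laplace_def)

lemma entry_holomorphic: "(\<lambda>z. (mat 1 - laplace \<mu> z) $ i $ j) holomorphic_on {z. \<sigma> < Re z}"
proof -
  have "(\<lambda>z. laplace \<mu> z $ i $ j) holomorphic_on {z. \<sigma> < Re z}"
    unfolding laplace_entry by (rule laplace_transform_holomorphic[OF sets_mu int_mu])
  then have "(\<lambda>z. mat 1 $ i $ j - laplace \<mu> z $ i $ j) holomorphic_on {z. \<sigma> < Re z}"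
    by (intro holomorphic_on_diff holomorphic_on_const)
  then show ?thesis by simp
qed

lemma entry_norm_le:
  assumes z: "\<sigma> \<le> Re z"
  shows "norm ((mat 1 - laplace \<mu> z) $ i $ j) \<le> entry_bound"
proof -
  have nn: "0 \<le> (LINT x:{0..}|\<mu> k l. exp (- \<sigma> * x))" for k l
    unfolding set_lebesgue_integral_def by (intro Bochner_Integration.integral_nonneg) (simp add: indicator_def)
  have "norm (laplace \<mu> z $ i $ j) \<le> (LINT x:{0..}|\<mu> i j. exp (- \<sigma> * x))"
    unfolding laplace_entry by (rule laplace_transform_bound(2)[OF sets_mu int_mu z])
  also have "\<dots> \<le> (\<Sum>l\<in>UNIV. LINT x:{0..}|\<mu> i l. exp (- \<sigma> * x))"
    by (rule member_le_sum) (use nn in auto)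
  also have "\<dots> \<le> (\<Sum>k\<in>UNIV. \<Sum>l\<in>UNIV. LINT x:{0..}|\<mu> k l. exp (- \<sigma> * x))"
    by (rule member_le_sum[of i UNIV "\<lambda>k. \<Sum>l\<in>UNIV. LINT x:{0..}|\<mu> k l. exp (- \<sigma> * x)"])
      (use nn in \<open>auto intro!: sum_nonneg\<close>)
  finally have "norm (laplace \<mu> z $ i $ j) \<le> entry_bound - 1" by (simp add: entry_bound_def)
  moreover have "norm ((mat 1 :: complex^'p^'p) $ i $ j) \<le> 1" by (simp add: mat_def)
  moreover have "norm ((mat 1 - laplace \<mu> z) $ i $ j) \<le> norm ((mat 1 :: complex^'p^'p) $ i $ j) + norm (laplace \<mu> z $ i $ j)"
    using norm_triangle_ineq4 by simp
  ultimately show ?thesis by linarith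
qed

lemma entry_bound_ge_1: "1 \<le> entry_bound"
  unfolding entry_bound_def set_lebesgue_integral_def
  by (auto intro!: sum_nonneg Bochner_Integration.integral_nonneg simp: indicator_def)

lemma cofactor_holomorphic:
  "(\<lambda>z. det (cofactor_matrix (mat 1 - laplace \<mu> z) i j)) holomorphic_on {z. \<sigma> < Re z}"
proof (rule det_holomorphic)
  fix k l
  show "(\<lambda>z. cofactor_matrix (mat 1 - laplace \<mu> z) i j $ k $ l) holomorphic_on {z. \<sigma> < Re z}"
    unfolding cofactor_matrix_def vec_lambda_beta
    by (cases "l = i") (simp_all add: entry_holomorphic del: vector_minus_component)
qed

lemma char_det_holomorphic: "char_det holomorphic_on {z. \<sigma> < Re z}"
  unfolding char_det_def[abs_def] by (rule det_holomorphic[OF entry_holomorphic])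

lemma char_det_norm_le:
  "\<sigma> \<le> Re z \<Longrightarrow> norm (char_det z) \<le> fact CARD('p) * entry_bound ^ CARD('p)"
  unfolding char_det_def by (rule norm_det_le[OF entry_norm_le])

lemma cofactor_norm_le:
  assumes "\<sigma> \<le> Re z"
  shows "norm (det (cofactor_matrix (mat 1 - laplace \<mu> z) i j)) \<le> fact CARD('p) * entry_bound ^ CARD('p)"
proof (rule norm_det_le)
  fix k l
  show "norm (cofactor_matrix (mat 1 - laplace \<mu> z) i j $ k $ l) \<le> entry_bound"
    using entry_norm_le[OF assms, of k l] entry_bound_ge_1
    by (simp add: cofactor_matrix_def del: vector_minus_component)
qed

lemma inverse_entry:
  "char_det z \<noteq> 0 \<Longrightarrow> matrix_inv (mat 1 - laplace \<mu> z) $ i $ j = det (cofactor_matrix (mat 1 - laplace \<mu> z) i j) / char_det z"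
  unfolding char_det_def by (rule matrix_inv_entry)

lemma inverse_holomorphic:
  assumes "\<And>z. z \<in> S \<Longrightarrow> \<sigma> < Re z" "\<And>z. z \<in> S \<Longrightarrow> char_det z \<noteq> 0"
  shows "(\<lambda>z. matrix_inv (mat 1 - laplace \<mu> z) $ i $ j) holomorphic_on S"
proof -
  have "S \<subseteq> {z. \<sigma> < Re z}" using assms(1) by auto
  then have "(\<lambda>z. det (cofactor_matrix (mat 1 - laplace \<mu> z) i j) / char_det z) holomorphic_on S"
    by (intro holomorphic_on_divide assms(2) holomorphic_on_subset[OF cofactor_holomorphic]
        holomorphic_on_subset[OF char_det_holomorphic])
  then show ?thesis
    by (rule holomorphic_transform) (simp add: inverse_entry assms(2))
qed

lemma in_laplace_domain:
  assumes "\<sigma> \<le> Re z"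
  shows "z \<in> laplace_domain \<mu>"
  unfolding laplace_domain_def
proof (intro CollectI allI)
  fix i j
  have "(\<integral>\<^sup>+x\<in>{0..}. ennreal (exp (- Re z * x)) \<partial>\<mu> i j) \<le> (\<integral>\<^sup>+x. ennreal (norm (indicator {0..} x *\<^sub>R exp (- \<sigma> * x))) \<partial>\<mu> i j)"
    using assms by (intro nn_integral_mono) (auto simp: indicator_def intro!: ennreal_leI mult_right_mono)
  also have "\<dots> < \<infinity>"
    using int_mu[of i j] unfolding set_integrable_def integrable_iff_bounded by simp
  finally show "(\<integral>\<^sup>+x\<in>{0..}. ennreal (exp (- Re z * x)) \<partial>\<mu> i j) < \<infinity>" .
qed

lemma mem_roots_iff: "\<sigma> \<le> Re z \<Longrightarrow> z \<in> roots \<mu> \<longleftrightarrow> char_det z = 0"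
  by (simp add: roots_def in_laplace_domain char_det_def)

lemma invertible_iff: "invertible (mat 1 - laplace \<mu> z) \<longleftrightarrow> char_det z \<noteq> 0"
  by (simp add: char_det_def invertible_det_nz)

text \<open>\<open>pole_order\<close> is a least number, so an admissible exponent has to be
  exhibited: the order of the zero of the determinant, since the adjugate is holomorphic. The point
  \<open>w\<close> ensures that the determinant does not vanish identically and this order is
  finite.\<close>

lemma pole_removed_pole_order:
  assumes p: "\<sigma> < Re p" "char_det p = 0" and w: "\<sigma> < Re w" "char_det w \<noteq> 0"
  shows "pole_removed \<mu> p (pole_order \<mu> p)"
proof -
  let ?S = "{z. \<sigma> < Re z}"
  have S: "open ?S" "connected ?S"
    by (simp_all add: open_halfspace_Re_gt convex_connected convex_halfspace_Re_gt)
  have "\<not> char_det constant_on ?S"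
    using p w unfolding constant_on_def by (metis (mono_tags, lifting) mem_Collect_eq)
  moreover have "p \<in> ?S" using p by simp
  ultimately obtain g r n where n: "0 < n" and r: "0 < r" "ball p r \<subseteq> ?S"
    and g: "g holomorphic_on ball p r" "\<And>z. z \<in> ball p r \<Longrightarrow> char_det z = (z - p) ^ n * g z"
      "\<And>z. z \<in> ball p r \<Longrightarrow> g z \<noteq> 0"
    using holomorphic_factor_zero_nonconstant[OF char_det_holomorphic S _ p(2)] by metis
  have nz: "char_det z \<noteq> 0" if "z \<in> ball p r - {p}" for z
    using that g(2)[of z] g(3)[of z] by simp
  have "pole_removed \<mu> p n"
    unfolding pole_removed_def
  proof (intro exI[of _ r] conjI ballI allI r)
    fix z assume z: "z \<in> ball p r - {p}"
    then have "\<sigma> < Re z" using r(2) by auto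
    then show "z \<in> laplace_domain \<mu>" by (intro in_laplace_domain) simp
    show "invertible (mat 1 - laplace \<mu> z)" using nz[OF z] by (simp add: invertible_iff)
  next
    fix i j
    show "\<exists>h. h holomorphic_on ball p r \<and>
       (\<forall>z\<in>ball p r - {p}. h z = (z - p) ^ n * matrix_inv (mat 1 - laplace \<mu> z) $ i $ j)"
    proof (intro exI[of _ "\<lambda>z. det (cofactor_matrix (mat 1 - laplace \<mu> z) i j) / g z"] conjI ballI)
      show "(\<lambda>z. det (cofactor_matrix (mat 1 - laplace \<mu> z) i j) / g z) holomorphic_on ball p r"
        by (intro holomorphic_on_divide holomorphic_on_subset[OF cofactor_holomorphic r(2)] g(1) g(3))
      fix z assume z: "z \<in> ball p r - {p}"
      then have "g z \<noteq> 0" "(z - p) ^ n \<noteq> 0" using g(3)[of z] by auto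
      then show "det (cofactor_matrix (mat 1 - laplace \<mu> z) i j) / g z = (z - p) ^ n * matrix_inv (mat 1 - laplace \<mu> z) $ i $ j"
        using z by (simp add: inverse_entry[OF nz[OF z]] g(2))
    qed
  qed
  then have "1 \<le> n \<and> pole_removed \<mu> p n" using n by simp
  then have "pole_removed \<mu> p (LEAST k. 1 \<le> k \<and> pole_removed \<mu> p k)"
    using LeastI[of "\<lambda>k. 1 \<le> k \<and> pole_removed \<mu> p k"] by blast
  moreover have "p \<in> roots \<mu>" using p by (simp add: mem_roots_iff)
  ultimately show ?thesis by (simp add: pole_order_def)
qed

text \<open>The factor 1/z raises the order of the pole by one at 0 and nowhere else, hence the
  longer range of \<open>k\<close> there. The case of 0 with nonzero determinant is included:
  \<open>pole_order\<close> is 0 and a single constant term remains.\<close>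

lemma residue_expansion:
  assumes p: "\<sigma> < Re p" and w: "\<sigma> < Re w" "char_det w \<noteq> 0"
    and p0: "p \<noteq> 0 \<Longrightarrow> char_det p = 0"
  shows "\<exists>c. \<forall>t::real. residue (\<lambda>z. exp (z * complex_of_real t) * matrix_inv (mat 1 - laplace \<mu> z) $ i $ j / z) p
     = exp (p * complex_of_real t) * (\<Sum>k<pole_order \<mu> p + (if p = 0 then 1 else 0). complex_of_real t ^ k * c k)"
proof -
  let ?R = "\<lambda>z. matrix_inv (mat 1 - laplace \<mu> z) $ i $ j"
  let ?n = "pole_order \<mu> p + (if p = 0 then 1 else 0)"
  obtain r g where r: "0 < r" and g: "g holomorphic_on ball p r"
    and gR: "\<And>z. z \<in> ball p r - {p} \<Longrightarrow> g z = (z - p) ^ pole_order \<mu> p * ?R z"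
  proof (cases "char_det p = 0")
    case True
    obtain r where "0 < r" and r: "\<forall>i j. \<exists>g. g holomorphic_on ball p r \<and>
           (\<forall>z \<in> ball p r - {p}. g z = (z - p) ^ pole_order \<mu> p * matrix_inv (mat 1 - laplace \<mu> z) $ i $ j)"
      using pole_removed_pole_order[OF p True w] unfolding pole_removed_def by (elim exE conjE)
    from r[rule_format, of i j] obtain g where "g holomorphic_on ball p r"
      "\<forall>z \<in> ball p r - {p}. g z = (z - p) ^ pole_order \<mu> p * ?R z" by (elim exE conjE)
    then show ?thesis using that[of r g] \<open>0 < r\<close> by simp
  next
    case False
    then have "pole_order \<mu> p = 0" using p by (simp add: pole_order_def mem_roots_iff)
    have "open {z. \<sigma> < Re z}" by (rule open_halfspace_Re_gt)
    moreover have cont: "continuous_on {z. \<sigma> < Re z} char_det"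
      by (rule holomorphic_on_imp_continuous_on[OF char_det_holomorphic])
    ultimately have "open ({z. \<sigma> < Re z} \<inter> char_det -` (- {0}))"
      by (intro continuous_open_preimage) auto
    moreover have "p \<in> {z. \<sigma> < Re z} \<inter> char_det -` (- {0})" using p False by simp
    ultimately obtain r where r: "0 < r" "ball p r \<subseteq> {z. \<sigma> < Re z} \<inter> char_det -` (- {0})"
      by (rule openE)
    have "?R holomorphic_on ball p r" using r(2) by (intro inverse_holomorphic) auto
    then show ?thesis using that[of r ?R] r(1) \<open>pole_order \<mu> p = 0\<close> by simp
  qed
  have "\<exists>c. \<forall>t::real. residue (\<lambda>z. exp (z * complex_of_real t) * (?R z / z)) p
     = exp (p * complex_of_real t) * (\<Sum>k<?n. complex_of_real t ^ k * c k)"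
  proof (cases "p = 0")
    case True
    show ?thesis
    proof (rule residue_exp_expansion[OF r g])
      fix z assume z: "z \<in> ball p r - {p}"
      then have "z \<noteq> 0" using True by simp
      then show "?R z / z * (z - p) ^ ?n = g z" using gR[OF z] True by simp
    qed
  next
    case False
    \<comment> \<open>On the smaller disc 1/z is holomorphic and can be absorbed into the
      numerator.\<close>
    define r' where "r' = min r (norm p)"
    have r': "0 < r'" using r False by (simp add: r'_def)
    have sub: "ball p r' \<subseteq> ball p r" by (rule subset_ball) (simp add: r'_def)
    have nz: "z \<noteq> 0" if "z \<in> ball p r'" for z using that by (auto simp: r'_def)
    show ?thesis
    proof (rule residue_exp_expansion[OF r', where q="\<lambda>z. g z / z"])
      show "(\<lambda>z. g z / z) holomorphic_on ball p r'"
        by (intro holomorphic_on_divide holomorphic_on_subset[OF g sub] holomorphic_on_ident nz)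
      fix z assume z: "z \<in> ball p r' - {p}"
      then have "z \<in> ball p r - {p}" using sub by blast
      from gR[OF this] show "?R z / z * (z - p) ^ ?n = g z / z" using False by simp
    qed
  qed
  then show ?thesis by simp
qed

end

section \<open>The renewal identity\<close>

lemma set_nn_integral_exp:
  fixes \<nu> :: "real measure"
  assumes "set_integrable \<nu> {0..} (\<lambda>x. exp (- s * x))"
  shows "(\<integral>\<^sup>+x\<in>{0..}. ennreal (exp (- s * x)) \<partial>\<nu>) = ennreal (LINT x:{0..}|\<nu>. exp (- s * x))"
proof -
  have "(\<integral>\<^sup>+x\<in>{0..}. ennreal (exp (- s * x)) \<partial>\<nu>) = (\<integral>\<^sup>+x. ennreal (indicator {0..} x *\<^sub>R exp (- s * x)) \<partial>\<nu>)"
    by (intro nn_integral_cong) (simp add: indicator_def)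
  also have "\<dots> = ennreal (LINT x:{0..}|\<nu>. exp (- s * x))"
    using assms unfolding set_integrable_def set_lebesgue_integral_def
    by (intro nn_integral_eq_integral) (auto simp: indicator_def)
  finally show ?thesis .
qed

lemma set_integrable_exp_iff:
  fixes \<nu> :: "real measure"
  assumes [measurable_cong, simp]: "sets \<nu> = sets borel"
  shows "set_integrable \<nu> {0..} (\<lambda>x. exp (- s * x)) \<longleftrightarrow> (\<integral>\<^sup>+x\<in>{0..}. ennreal (exp (- s * x)) \<partial>\<nu>) < \<infinity>"
proof -
  have "(\<lambda>x. indicator {0..} x *\<^sub>R exp (- s * x)) \<in> borel_measurable \<nu>" by measurable
  moreover have "(\<integral>\<^sup>+x. ennreal (norm (indicator {0..} x *\<^sub>R exp (- s * x))) \<partial>\<nu>) = (\<integral>\<^sup>+x\<in>{0..}. ennreal (exp (- s * x)) \<partial>\<nu>)"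
    by (intro nn_integral_cong) (simp add: indicator_def)
  ultimately show ?thesis unfolding set_integrable_def integrable_iff_bounded by simp
qed

lemma set_integrable_exp_mono:
  fixes \<nu> :: "real measure"
  assumes [simp]: "sets \<nu> = sets borel" and int: "set_integrable \<nu> {0..} (\<lambda>x. exp (- \<sigma> * x))" and s: "\<sigma> \<le> s"
  shows "set_integrable \<nu> {0..} (\<lambda>x. exp (- s * x))"
proof -
  have "(\<integral>\<^sup>+x\<in>{0..}. ennreal (exp (- s * x)) \<partial>\<nu>) \<le> (\<integral>\<^sup>+x\<in>{0..}. ennreal (exp (- \<sigma> * x)) \<partial>\<nu>)"
    using s by (intro nn_integral_mono) (auto simp: indicator_def intro!: ennreal_leI mult_right_mono)
  also have "\<dots> < \<infinity>" using int by (simp only: set_integrable_exp_iff assms(1))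
  finally show ?thesis by (simp only: set_integrable_exp_iff assms(1))
qed

lemma laplace_transform_of_real:
  "(LINT x:{0..}|\<nu>. exp (- complex_of_real s * complex_of_real x)) = complex_of_real (LINT x:{0..}|\<nu>. exp (- s * x))"
proof -
  have "exp (- complex_of_real s * complex_of_real x) = complex_of_real (exp (- s * x))" for x
    by (simp flip: exp_of_real)
  then show ?thesis by (simp only: set_integral_complex_of_real)
qed

text \<open>As s grows, exp(-s x) tends to 0 for x > 0 and stays 1 at 0; the transform at \<sigma>
  provides the majorant.\<close>

lemma laplace_transform_tendsto_atom:
  fixes \<nu> :: "real measure"
  assumes sets[measurable_cong, simp]: "sets \<nu> = sets borel" and int: "set_integrable \<nu> {0..} (\<lambda>x. exp (- \<sigma> * x))"
  shows "((\<lambda>s. LINT x:{0..}|\<nu>. exp (- s * x)) \<longlongrightarrow> measure \<nu> {0}) at_top"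
proof -
  have "((\<lambda>s. LINT x|\<nu>. indicator {0..} x *\<^sub>R exp (- s * x)) \<longlongrightarrow> (LINT x|\<nu>. indicator {0} x)) at_top"
  proof (rule integral_dominated_convergence_at_top[where w="\<lambda>x. indicator {0..} x *\<^sub>R exp (- \<sigma> * x)"])
    show "AE x in \<nu>. ((\<lambda>s. indicator {0..} x *\<^sub>R exp (- s * x)) \<longlongrightarrow> indicator {0} x) at_top"
    proof (intro AE_I2)
      fix x :: real
      consider "x < 0" | "x = 0" | "0 < x" by linarith
      then show "((\<lambda>s. indicator {0..} x *\<^sub>R exp (- s * x)) \<longlongrightarrow> indicator {0} x) at_top"
      proof cases
        case 3
        then have "((\<lambda>s. exp (- s * x)) \<longlongrightarrow> 0) at_top" by real_asymp
        then show ?thesis using 3 by simp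
      qed auto
    qed
    show "\<forall>\<^sub>F s in at_top. AE x in \<nu>. norm (indicator {0..} x *\<^sub>R exp (- s * x)) \<le> indicator {0..} x *\<^sub>R exp (- \<sigma> * x)"
      using eventually_ge_at_top[of \<sigma>]
      by eventually_elim (auto simp: indicator_def mult_right_mono)
    show "integrable \<nu> (\<lambda>x. indicator {0..} x *\<^sub>R exp (- \<sigma> * x))"
      using int unfolding set_integrable_def .
  qed measurable
  moreover have "space \<nu> = UNIV" using sets_eq_imp_space_eq[OF sets] by simp
  ultimately show ?thesis unfolding set_lebesgue_integral_def by simp
qed

context cmj_process
begin

lemma laplace_real_eq:
  assumes "laplace_matrix (intensity P \<xi>) \<sigma>" "locally_finite (intensity P \<xi> i j)" and s: "0 < s" "\<sigma> \<le> s"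
  shows "laplace_real s i j = ennreal (LINT x:{0..}|intensity P \<xi> i j. exp (- s * x))"
proof -
  interpret laplace_matrix "intensity P \<xi>" \<sigma> by fact
  show ?thesis
    unfolding laplace_real_def laplace_intensity_eq_suminf[OF s(1) assms(2), symmetric]
    by (rule set_nn_integral_exp[OF set_integrable_exp_mono[OF sets_mu int_mu s(2)]])
qed

text \<open>With A the matrix of atoms at 0, a vector v = 1 + A v exceeds A v + 1/2 strictly in each
  component. The transforms at s tend to A, so the inequality persists for large s and
  \<open>renewal_transform_finite\<close> applies; the constant 1/2 there leaves the room for this
  limit.\<close>

lemma renewal_transform_eventually_finite:
  assumes LM: "laplace_matrix (intensity P \<xi>) \<sigma>" and lf: "\<And>i j. locally_finite (intensity P \<xi> i j)"
    and rad: "spectral_radius (atom_at_zero (intensity P \<xi>)) < 1"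
  shows "\<forall>\<^sub>F s in at_top. \<forall>i j. renewal_transform s i j < \<infinity>"
proof -
  interpret laplace_matrix "intensity P \<xi>" \<sigma> by fact
  let ?\<mu> = "intensity P \<xi>"
  let ?l = "\<lambda>s i j. LINT x:{0..}|?\<mu> i j. exp (- s * x)"
  have nn: "0 \<le> ?l s k l" for s k l
    unfolding set_lebesgue_integral_def by (intro Bochner_Integration.integral_nonneg) (simp add: indicator_def)
  have "spectral_radius (\<chi> i j. complex_of_real (measure (?\<mu> i j) {0})) < 1"
    using rad unfolding atom_at_zero_def .
  from nonneg_matrix_supersolution[OF measure_nonneg this]
  obtain v where v': "\<forall>i. 1 \<le> v i" "\<forall>i. v i = 1 + (\<Sum>j\<in>UNIV. measure (?\<mu> i j) {0} * v j)"
    by (elim exE conjE)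
  note v = v'[rule_format]
  have "\<forall>\<^sub>F s in at_top. (\<Sum>j\<in>UNIV. ?l s k j * v j) + 1/2 < v k" for k
  proof (rule order_tendstoD(2))
    show "((\<lambda>s. (\<Sum>j\<in>UNIV. ?l s k j * v j) + 1/2) \<longlongrightarrow> (\<Sum>j\<in>UNIV. measure (?\<mu> k j) {0} * v j) + 1/2) at_top"
      by (intro tendsto_add tendsto_sum tendsto_mult tendsto_const laplace_transform_tendsto_atom[OF sets_mu int_mu])
    show "(\<Sum>j\<in>UNIV. measure (?\<mu> k j) {0} * v j) + 1/2 < v k"
      using v(2)[of k] by linarith
  qed
  then have "\<forall>\<^sub>F s in at_top. \<forall>k. (\<Sum>j\<in>UNIV. ?l s k j * v j) + 1/2 < v k"
    by (rule eventually_all_finite)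
  moreover have "\<forall>\<^sub>F s in at_top. (0::real) < s" by (rule eventually_gt_at_top)
  moreover have "\<forall>\<^sub>F s in at_top. \<sigma> \<le> s" by (rule eventually_ge_at_top)
  ultimately show ?thesis
  proof eventually_elim
    case (elim s)
    show ?case
    proof (intro allI renewal_transform_finite[where v="\<lambda>k. ennreal (v k)"])
      fix k
      have v0: "0 \<le> v j" for j using v(1)[of j] by linarith
      have "(\<Sum>j\<in>UNIV. laplace_real s k j * ennreal (v j)) + ennreal (1/2) = ennreal ((\<Sum>j\<in>UNIV. ?l s k j * v j) + 1/2)"
        using v0 nn by (simp add: laplace_real_eq[OF LM lf elim(2,3)] ennreal_mult[symmetric] sum_nonneg)
      also have "\<dots> \<le> ennreal (v k)" using elim(1) by (intro ennreal_leI less_imp_le) simp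
      finally show "(\<Sum>j\<in>UNIV. laplace_real s k j * ennreal (v j)) + ennreal (1/2) \<le> ennreal (v k)" .
    qed simp
  qed
qed

text \<open>The renewal equation is known at real s only, where all terms are nonnegative. Its
  defect \<open>D\<close> is holomorphic and vanishes on a real half-line, hence on the whole
  half-plane.\<close>

lemma birth_measure_transform_inverse:
  assumes LM: "laplace_matrix (intensity P \<xi>) \<sigma>" and lf: "\<And>i j. locally_finite (intensity P \<xi> i j)"
    and s1: "0 < s1" "\<sigma> \<le> s1" and fin: "\<And>s i j. s1 \<le> s \<Longrightarrow> renewal_transform s i j < \<infinity>"
    and z: "s1 < Re z"
  shows "laplace birth_measure z ** (mat 1 - laplace (intensity P \<xi>) z) = mat 1"
proof -
  interpret laplace_matrix "intensity P \<xi>" \<sigma> by fact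
  let ?\<mu> = "intensity P \<xi>"
  have int_rho: "set_integrable (birth_measure i j) {0..} (\<lambda>x. exp (- s * x))" if "s1 \<le> s" for s i j
    using fin[OF that] unfolding set_integrable_exp_iff[OF sets_birth_measure] nn_integral_exp_birth_measure .
  interpret rho: laplace_matrix birth_measure s1
    by (rule laplace_matrix.intro[OF sets_birth_measure int_rho[OF order_refl]])
  let ?S = "{z. s1 < Re z}"
  have S: "open ?S" "connected ?S"
    by (simp_all add: open_halfspace_Re_gt convex_connected convex_halfspace_Re_gt)
  define D where "D i j z = laplace birth_measure z $ i $ j - (mat 1 :: complex^'p^'p) $ i $ j
      - (\<Sum>k\<in>UNIV. laplace birth_measure z $ i $ k * laplace ?\<mu> z $ k $ j)" for i j z
  have h1: "(\<lambda>z. laplace birth_measure z $ i $ j) holomorphic_on ?S" for i j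
    unfolding rho.laplace_entry by (rule laplace_transform_holomorphic[OF rho.sets_mu rho.int_mu])
  have "?S \<subseteq> {z. \<sigma> < Re z}" using s1 by auto
  then have h2: "(\<lambda>z. laplace ?\<mu> z $ i $ j) holomorphic_on ?S" for i j
    unfolding laplace_entry by (rule holomorphic_on_subset[OF laplace_transform_holomorphic[OF sets_mu int_mu]])
  have hD: "D i j holomorphic_on ?S" for i j
    unfolding D_def by (intro holomorphic_intros h1 h2)
  have D_real: "D i j (complex_of_real s) = 0" if s: "s1 \<le> s" for i j s
  proof -
    let ?u = "\<lambda>i j. LINT x:{0..}|birth_measure i j. exp (- s * x)"
    let ?l = "\<lambda>i j. LINT x:{0..}|?\<mu> i j. exp (- s * x)"
    have nn: "0 \<le> ?u i j" "0 \<le> ?l i j" for i j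
      unfolding set_lebesgue_integral_def by (intro Bochner_Integration.integral_nonneg; simp add: indicator_def)+
    have U: "renewal_transform s i j = ennreal (?u i j)" for i j
      unfolding nn_integral_exp_birth_measure[symmetric] by (rule set_nn_integral_exp[OF int_rho[OF s]])
    have L: "laplace_real s i j = ennreal (?l i j)" for i j
      using s s1 by (intro laplace_real_eq[OF LM lf]) auto
    have "ennreal (?u i j) = ennreal ((if i = j then 1 else 0) + (\<Sum>k\<in>UNIV. ?u i k * ?l k j))"
      using renewal_equation[of s i j] nn unfolding U L
      by (simp add: ennreal_mult[symmetric] sum_nonneg)
    then have "?u i j = (if i = j then 1 else 0) + (\<Sum>k\<in>UNIV. ?u i k * ?l k j)"
      using nn by (subst (asm) ennreal_inj) (auto intro!: add_nonneg_nonneg sum_nonneg)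
    then have "complex_of_real (?u i j) = complex_of_real ((if i = j then 1 else 0) + (\<Sum>k\<in>UNIV. ?u i k * ?l k j))"
      by (rule arg_cong)
    then have "complex_of_real (?u i j) = (mat 1 :: complex^'p^'p) $ i $ j + (\<Sum>k\<in>UNIV. complex_of_real (?u i k) * complex_of_real (?l k j))"
      by (simp add: mat_def)
    then show ?thesis
      unfolding D_def rho.laplace_entry laplace_entry laplace_transform_of_real by simp
  qed
  have lim: "complex_of_real (s1 + 1) islimpt (complex_of_real ` {s1<..})"
    unfolding islimpt_approachable
  proof (intro allI impI)
    fix e :: real assume e: "0 < e"
    have d: "dist (complex_of_real x) (complex_of_real y) = \<bar>x - y\<bar>" for x y
      unfolding dist_norm of_real_diff[symmetric] norm_of_real ..
    show "\<exists>x'\<in>complex_of_real ` {s1<..}. x' \<noteq> complex_of_real (s1 + 1) \<and> dist x' (complex_of_real (s1 + 1)) < e"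
    proof (intro bexI conjI)
      show "complex_of_real (s1 + 1 + e / 2) \<noteq> complex_of_real (s1 + 1)"
        unfolding of_real_eq_iff using e by simp
      show "dist (complex_of_real (s1 + 1 + e / 2)) (complex_of_real (s1 + 1)) < e"
        unfolding d using e by simp
      show "complex_of_real (s1 + 1 + e / 2) \<in> complex_of_real ` {s1<..}"
        using e by (intro imageI) simp
    qed
  qed
  have sub: "complex_of_real ` {s1<..} \<subseteq> ?S" by auto
  have mem: "complex_of_real (s1 + 1) \<in> ?S" "z \<in> ?S" using z by simp_all
  have Dz: "D i j z = 0" for i j
  proof (rule analytic_continuation[OF hD S sub mem(1) lim _ mem(2)])
    fix w assume "w \<in> complex_of_real ` {s1<..}"
    then obtain s where "w = complex_of_real s" "s \<in> {s1<..}" by (rule imageE)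
    then show "D i j w = 0" using D_real[of s i j] by simp
  qed
  have alg: "a - b = m" if "a - m - b = 0" for a b m :: complex
    using that by (simp add: algebra_simps)
  show ?thesis
  proof (rule vec_eq_iff[THEN iffD2, rule_format], rule vec_eq_iff[THEN iffD2, rule_format])
    fix i j
    have "(laplace birth_measure z ** (mat 1 - laplace ?\<mu> z)) $ i $ j
        = (\<Sum>k\<in>UNIV. laplace birth_measure z $ i $ k * (mat 1 - laplace ?\<mu> z) $ k $ j)"
      by (simp add: matrix_matrix_mult_def)
    also have "\<dots> = (\<Sum>k\<in>UNIV. (if k = j then laplace birth_measure z $ i $ k else 0) - laplace birth_measure z $ i $ k * laplace ?\<mu> z $ k $ j)"
      by (intro sum.cong) (auto simp: mat_def algebra_simps)
    also have "\<dots> = laplace birth_measure z $ i $ j - (\<Sum>k\<in>UNIV. laplace birth_measure z $ i $ k * laplace ?\<mu> z $ k $ j)"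
      by (simp add: sum_subtractf)
    also have "\<dots> = (mat 1 :: complex^'p^'p) $ i $ j"
      by (rule alg) (rule Dz[unfolded D_def])
    finally show "(laplace birth_measure z ** (mat 1 - laplace ?\<mu> z)) $ i $ j = (mat 1 :: complex^'p^'p) $ i $ j" .
  qed
qed

end

section \<open>The asymptotic expansion\<close>

lemma laplace_matrix_of_interior:
  fixes \<mu> :: "'p::finite \<Rightarrow> 'p \<Rightarrow> real measure"
  assumes sets: "\<And>i j. sets (\<mu> i j) = sets borel"
    and int: "complex_of_real \<theta> \<in> interior (laplace_domain \<mu>)"
  shows "\<exists>\<sigma><\<theta>. laplace_matrix \<mu> \<sigma>"
proof -
  obtain e where e: "0 < e" "ball (complex_of_real \<theta>) e \<subseteq> laplace_domain \<mu>"
    using int by (auto simp: mem_interior)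
  have "dist (complex_of_real \<theta>) (complex_of_real (\<theta> - e / 2)) < e"
    unfolding dist_norm of_real_diff[symmetric] norm_of_real using e(1) by simp
  then have "complex_of_real (\<theta> - e / 2) \<in> laplace_domain \<mu>" using e(2) by auto
  then have "set_integrable (\<mu> i j) {0..} (\<lambda>x. exp (- (\<theta> - e / 2) * x))" for i j
    unfolding set_integrable_exp_iff[OF sets] laplace_domain_def mem_Collect_eq Re_complex_of_real by (elim allE)
  then have "laplace_matrix \<mu> (\<theta> - e / 2)" by (intro laplace_matrix.intro sets)
  then show ?thesis using e(1) by (intro exI[of _ "\<theta> - e / 2"]) simp
qed

text \<open>The determinants of A and of its inverse multiply to 1, and the latter is bounded along
  with the entries. The matrix hypothesis thus becomes a lower bound for one scalar function, the
  form in which the strip argument uses it.\<close>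

lemma (in laplace_matrix) char_det_bounded_below:
  assumes inv: "\<And>\<eta>. invertible (mat 1 - laplace \<mu> (Complex \<theta> \<eta>))"
    and bdd: "bdd_above (range (\<lambda>\<eta>. norm (matrix_inv (mat 1 - laplace \<mu> (Complex \<theta> \<eta>)))))"
  shows "\<exists>m>0. \<forall>\<eta>. m \<le> norm (char_det (Complex \<theta> \<eta>))"
proof -
  from bdd obtain K where K': "\<forall>x\<in>range (\<lambda>\<eta>. norm (matrix_inv (mat 1 - laplace \<mu> (Complex \<theta> \<eta>)))). x \<le> K"
    unfolding bdd_above_def by (rule exE)
  have K: "norm (matrix_inv (mat 1 - laplace \<mu> (Complex \<theta> \<eta>))) \<le> K" for \<eta>
    by (rule bspec[OF K']) (rule rangeI)
  define M where "M = \<bar>fact CARD('p) * K ^ CARD('p)\<bar> + 1"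
  have M: "0 < M" by (simp add: M_def add_nonneg_pos)
  have "1 / M \<le> norm (char_det (Complex \<theta> \<eta>))" for \<eta>
  proof -
    let ?A = "mat 1 - laplace \<mu> (Complex \<theta> \<eta>)"
    have "norm (matrix_inv ?A $ i $ j) \<le> K" for i j
      using Finite_Cartesian_Product.norm_nth_le[of "matrix_inv ?A $ i" j] Finite_Cartesian_Product.norm_nth_le[of "matrix_inv ?A" i] K[of \<eta>] by linarith
    then have "norm (det (matrix_inv ?A)) \<le> fact CARD('p) * K ^ CARD('p)" by (rule norm_det_le)
    then have le: "norm (det (matrix_inv ?A)) \<le> M" by (simp add: M_def)
    have "det ?A * det (matrix_inv ?A) = 1"
      unfolding det_mul[symmetric] matrix_inv_mult(1)[OF inv] by (rule det_I)
    then have "1 = norm (char_det (Complex \<theta> \<eta>)) * norm (det (matrix_inv ?A))"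
      unfolding char_det_def norm_mult[symmetric] by simp
    also have "\<dots> \<le> norm (char_det (Complex \<theta> \<eta>)) * M"
      by (intro mult_left_mono le) simp
    finally show ?thesis using M by (simp add: divide_le_eq)
  qed
  then show ?thesis using M by (intro exI[of _ "1 / M"]) simp
qed

lemma matrix_inv_unique_left:
  fixes A X :: "complex^'n^'n"
  assumes "X ** A = mat 1"
  shows "invertible A" "matrix_inv A = X"
proof -
  have "A ** X = mat 1" using assms matrix_left_right_inverse by blast
  then show inv: "invertible A" using assms unfolding invertible_def by (intro exI[of _ X] conjI)
  have "matrix_inv A = (X ** A) ** matrix_inv A" by (simp add: assms)
  also have "\<dots> = X ** (A ** matrix_inv A)" by (rule matrix_mul_assoc[symmetric])
  also have "\<dots> = X" by (simp add: matrix_inv_mult(1)[OF inv])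
  finally show "matrix_inv A = X" .
qed

text \<open>Birth times are nonnegative, so the negative half-line is a null set and completes the
  intervals \<open>{0..real n}\<close> to a cover of the line.\<close>

lemma (in cmj_process) birth_measure_sigma_finite:
  assumes "\<And>t. emeasure (birth_measure i j) {0..t} < \<infinity>"
  shows "sigma_finite_measure (birth_measure i j)"
proof
  have "space (birth_measure i j) = UNIV" using sets_eq_imp_space_eq[OF sets_birth_measure] by simp
  moreover have "emeasure (birth_measure i j) {..<0} = 0"
  proof -
    have "emeasure (birth_measure i j) {..<0} = (\<integral>\<^sup>+x. indicator {..<0} x \<partial>birth_measure i j)" by simp
    also have "\<dots> = 0"
      by (subst nn_integral_birth_measure) (auto simp: real_of_ereal_pos birth_time_nonneg not_less indicator_def
          intro!: nn_integral_zero' AE_I2)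
    finally show ?thesis .
  qed
  moreover have "\<Union> (insert {..<0} (range (\<lambda>n::nat. {0..real n}))) = UNIV"
  proof -
    have "x \<in> \<Union> (insert {..<0} (range (\<lambda>n::nat. {0..real n})))" for x
      using real_arch_simple[of x] by (cases "x < 0") auto
    then show ?thesis by blast
  qed
  ultimately show "\<exists>A. countable A \<and> A \<subseteq> sets (birth_measure i j) \<and> \<Union> A = space (birth_measure i j)
      \<and> (\<forall>a\<in>A. emeasure (birth_measure i j) a \<noteq> \<infinity>)"
    using assms by (intro exI[of _ "insert {..<0} (range (\<lambda>n::nat. {0..real n}))"]) (auto simp: less_top)
qed

text \<open>At 0 the range of k is longer by one, and this top term becomes the separate term of the
  expansion. If 0 is in \<open>pts\<close> without being in \<Lambda>, it is the whole contribution
  of 0; if 0 is not in \<open>pts\<close>, its coefficient is 0.\<close>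

lemma exponential_sum_rearrange:
  fixes pts \<Lambda> :: "complex set" and n :: "complex \<Rightarrow> nat" and C :: "complex \<Rightarrow> nat \<Rightarrow> complex"
  assumes fin: "finite pts" and sub: "\<Lambda> \<subseteq> pts" "pts \<subseteq> insert 0 \<Lambda>"
    and n0: "0 \<in> pts \<Longrightarrow> 0 \<notin> \<Lambda> \<Longrightarrow> n 0 = 0" and C0: "0 \<notin> pts \<Longrightarrow> C 0 (n 0) = 0"
  shows "(\<Sum>l\<in>pts. exp (l * s) * (\<Sum>k<n l + (if l = 0 then 1 else 0). s ^ k * C l k))
     = (\<Sum>l\<in>\<Lambda>. exp (l * s) * (\<Sum>k<n l. s ^ k * C l k)) + s ^ n 0 * C 0 (n 0)"
proof -
  have "(\<Sum>l\<in>pts. exp (l * s) * (\<Sum>k<n l + (if l = 0 then 1 else 0). s ^ k * C l k))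
     = (\<Sum>l\<in>pts. exp (l * s) * (\<Sum>k<n l. s ^ k * C l k) + (if l = 0 then s ^ n 0 * C 0 (n 0) else 0))"
    by (intro sum.cong) (auto simp: distrib_left)
  also have "\<dots> = (\<Sum>l\<in>pts. exp (l * s) * (\<Sum>k<n l. s ^ k * C l k)) + (if 0 \<in> pts then s ^ n 0 * C 0 (n 0) else 0)"
    unfolding sum.distrib using fin by simp
  also have "(if 0 \<in> pts then s ^ n 0 * C 0 (n 0) else 0) = s ^ n 0 * C 0 (n 0)"
    using C0 by simp
  also have "(\<Sum>l\<in>pts. exp (l * s) * (\<Sum>k<n l. s ^ k * C l k)) = (\<Sum>l\<in>\<Lambda>. exp (l * s) * (\<Sum>k<n l. s ^ k * C l k))"
  proof (rule sum.mono_neutral_right[OF fin sub(1)], rule ballI)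
    fix l assume "l \<in> pts - \<Lambda>"
    then have "l = 0" "n l = 0" using sub n0 by auto
    then show "exp (l * s) * (\<Sum>k<n l. s ^ k * C l k) = 0" by simp
  qed
  finally show ?thesis .
qed

theorem theorem4p1:
  fixes P :: "'w measure"
    and \<xi> :: "'w \<Rightarrow> 'p::finite \<times> 'p \<Rightarrow> real measure"
    and \<xi>c :: "nat list \<Rightarrow> 'w \<Rightarrow> 'p \<times> 'p \<Rightarrow> real measure"
    and \<mu> :: "'p \<Rightarrow> 'p \<Rightarrow> real measure"
    and \<theta> :: real
  assumes "cmj_process P \<xi> \<xi>c"
    and "\<mu> = intensity P \<xi>"
    and "\<And>i j. locally_finite (\<mu> i j)"
    and "non_lattice \<mu>"
    and "complex_of_real \<theta> \<in> interior (laplace_domain \<mu>)"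
    and "spectral_radius (atom_at_zero \<mu>) < 1"
    and "\<And>\<eta>. invertible (mat 1 - laplace \<mu> (Complex \<theta> \<eta>))"
    and "bdd_above (range (\<lambda>\<eta>. norm (matrix_inv (mat 1 - laplace \<mu> (Complex \<theta> \<eta>)))))"
    and "finite (roots_gt \<mu> \<theta>)"
  shows "(\<forall>i j t. expected_born P \<xi>c i t j < \<infinity>) \<and>
    (\<exists>C :: complex \<Rightarrow> nat \<Rightarrow> complex^'p^'p. \<forall>i j.
       (\<lambda>t. complex_of_real (mean_matrix P \<xi>c t $ i $ j)
            - ((\<Sum>l\<in>roots_gt \<mu> \<theta>. exp (l * complex_of_real t) *
                  (\<Sum>k<pole_order \<mu> l. complex_of_real t ^ k * C l k $ i $ j))
               + complex_of_real t ^ pole_order \<mu> 0 * C 0 (pole_order \<mu> 0) $ i $ j))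
       \<in> O[at_top](\<lambda>t. complex_of_real (t * exp (\<theta> * t))))"
proof -
  interpret cmj_process P \<xi> \<xi>c by fact
  have mu: "\<mu> = intensity P \<xi>" by fact
  have lf: "locally_finite (intensity P \<xi> i j)" for i j using assms(3) unfolding mu .
  have sets_mu0: "sets (\<mu> i j) = sets borel" for i j by (simp add: mu)
  obtain \<sigma> where \<sigma>: "\<sigma> < \<theta>" and LM: "laplace_matrix \<mu> \<sigma>"
    using laplace_matrix_of_interior[OF sets_mu0 assms(5)] by (elim exE conjE)
  interpret laplace_matrix \<mu> \<sigma> by fact
  have LM': "laplace_matrix (intensity P \<xi>) \<sigma>" using LM unfolding mu .
  obtain m where m: "0 < m" "\<forall>\<eta>. m \<le> norm (char_det (Complex \<theta> \<eta>))"
    using char_det_bounded_below[OF assms(7,8)] by (elim exE conjE)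
  let ?\<Lambda> = "roots_gt \<mu> \<theta>"
  have \<Lambda>_iff: "z \<in> ?\<Lambda> \<longleftrightarrow> \<theta> < Re z \<and> char_det z = 0" for z
    using mem_roots_iff[of z] \<sigma> by (auto simp: roots_gt_def)
  have "{z. \<theta> < Re z \<and> char_det z = 0} = ?\<Lambda>" using \<Lambda>_iff by blast
  then have finz: "finite {z. \<theta> < Re z \<and> char_det z = 0}" using assms(9) by simp
  have "\<forall>\<^sub>F s in at_top. \<forall>i j. renewal_transform s i j < \<infinity>"
    using assms(6) unfolding mu by (intro renewal_transform_eventually_finite[OF LM' lf])
  then obtain s0 where s0: "\<forall>s\<ge>s0. \<forall>i j. renewal_transform s i j < \<infinity>"
    unfolding eventually_at_top_linorder by (rule exE)
  \<comment> \<open>From \<open>s1\<close> on the renewal transforms are finite and the intensities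
    have Laplace transforms; the 1 keeps s positive for the layer-cake formula.\<close>
  define s1 where "s1 = max 1 (max s0 \<sigma>)"
  have s1: "0 < s1" "\<sigma> \<le> s1" "s0 \<le> s1" by (auto simp: s1_def)
  have fin1: "renewal_transform s i j < \<infinity>" if "s1 \<le> s" for s i j
    using s1 that by (intro s0[rule_format]) simp
  have inv_eq: "laplace birth_measure z ** (mat 1 - laplace \<mu> z) = mat 1" if "s1 < Re z" for z
    unfolding mu by (rule birth_measure_transform_inverse[OF LM' lf s1(1,2) fin1 that])
  have nz1: "char_det z \<noteq> 0" if "s1 < Re z" for z
    using matrix_inv_unique_left(1)[OF inv_eq[OF that]] by (simp add: invertible_iff)
  have int_rho: "set_integrable (birth_measure i j) {0..} (\<lambda>x. exp (- s * x))" if "s1 \<le> s" for s i j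
    using fin1[OF that] unfolding set_integrable_exp_iff[OF sets_birth_measure] nn_integral_exp_birth_measure .
  define c where "c = max s1 \<theta> + 1"
  have c: "s1 < c" "\<theta> < c" "0 < c" using s1 by (auto simp: c_def)
  have int_c: "set_integrable (birth_measure i j) {0..} (\<lambda>x. exp (- c * x))" for i j
    using c by (intro int_rho) simp
  have fin_rho: "emeasure (birth_measure i j) {0..t} < \<infinity>" for i j t
    by (rule distribution_between_smoothings(3)[OF sets_birth_measure c(3) zero_less_one int_c])
  \<comment> \<open>This gives \<open>mean_matrix\<close> its meaning, since \<open>enn2real\<close>
    sends infinity to 0.\<close>
  have expected_finite: "expected_born P \<xi>c i t j < \<infinity>" for i j t
    using fin_rho[of i j t] unfolding emeasure_birth_measure .
  have bnd: "norm (char_det z) \<le> fact CARD('p) * entry_bound ^ CARD('p)" if "\<sigma> < Re z" for z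
    using that by (intro char_det_norm_le) simp
  have "\<exists>\<delta> m' T. 0 < \<delta> \<and> 0 < m' \<and> \<delta> < \<theta> - \<sigma> \<and>
     (\<forall>z. \<theta> - \<delta> \<le> Re z \<longrightarrow> Re z \<le> c \<longrightarrow> T \<le> \<bar>Im z\<bar> \<longrightarrow> m' \<le> norm (char_det z)) \<and>
     (\<forall>z. \<theta> - \<delta> \<le> Re z \<longrightarrow> Re z \<le> \<theta> \<longrightarrow> char_det z \<noteq> 0)"
    by (rule strip_lower_bound[OF \<sigma> char_det_holomorphic bnd m(1) m(2)[rule_format] finz])
  then obtain \<delta> m' T where \<delta>: "0 < \<delta>" "0 < m'" "\<delta> < \<theta> - \<sigma>"
    and low: "\<forall>z. \<theta> - \<delta> \<le> Re z \<longrightarrow> Re z \<le> c \<longrightarrow> T \<le> \<bar>Im z\<bar> \<longrightarrow> m' \<le> norm (char_det z)"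
    and nz\<delta>: "\<forall>z. \<theta> - \<delta> \<le> Re z \<longrightarrow> Re z \<le> \<theta> \<longrightarrow> char_det z \<noteq> 0"
    by (elim exE conjE)
  \<comment> \<open>The line Re z = a must not pass through 0. For \<theta> > 0 the strip is cut off
    at 0, so the pole of the kernel there is never crossed; for \<theta> \<le> 0 the midpoint
    \<open>a\<close> is negative and the residue at 0 is collected.\<close>
  define a' where "a' = (if 0 < \<theta> then max (\<theta> - \<delta>) 0 else \<theta> - \<delta>)"
  define a where "a = (a' + \<theta>) / 2"
  have a': "a' < \<theta>" "\<theta> - \<delta> \<le> a'" using \<delta> by (auto simp: a'_def)
  have a: "a' < a" "a < \<theta>" using a' by (auto simp: a_def)
  have a0: "a < 0 \<or> 0 < a \<and> 0 \<le> a'" using \<delta> by (auto simp: a_def a'_def)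
  have a_neg: "\<theta> \<le> 0" if "a < 0" using that by (auto simp: a_def a'_def split: if_splits)
  define pts where "pts = ?\<Lambda> \<union> (if a < 0 then {0} else {})"
  \<comment> \<open>No root lies to the right of \<open>s1\<close>, because there the transform of
    the birth measures inverts the matrix.\<close>
  have \<Lambda>_strip: "a < Re p \<and> Re p < c" if "p \<in> ?\<Lambda>" for p
  proof -
    have "\<theta> < Re p" "char_det p = 0" using that by (auto simp: \<Lambda>_iff)
    then show ?thesis using a c nz1[of p] by (cases "s1 < Re p") auto
  qed
  define R where "R i j z = matrix_inv (mat 1 - laplace \<mu> z) $ i $ j" for i j z
  have zero_free: "char_det z \<noteq> 0" if "a' < Re z" "z \<notin> ?\<Lambda>" for z
    using that a' nz\<delta> by (cases "Re z \<le> \<theta>") (auto simp: \<Lambda>_iff)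
  have \<sigma>a': "\<sigma> < a'" using a' \<delta> by linarith
  have K_ex: "\<exists>K. \<forall>t\<ge>1. norm (complex_of_real (measure (birth_measure i j) {0..t})
      - (\<Sum>p\<in>pts. residue (\<lambda>z. exp (z * complex_of_real t) * R i j z / z) p)) \<le> K * t * exp (a * t)" for i j
    unfolding pts_def
  proof (rule distribution_asymptotics[OF sets_birth_measure birth_measure_sigma_finite[OF fin_rho] int_c a(1) _ _ c(3) a0 assms(9) \<Lambda>_strip,
        where b'="c + 1" and T=T and B="fact CARD('p) * entry_bound ^ CARD('p) / m'"])
    show "a < c" "c < c + 1" using a c by auto
    show "R i j holomorphic_on {z. a' < Re z \<and> Re z < c + 1} - ?\<Lambda>"
      unfolding R_def[abs_def] using \<sigma>a' by (intro inverse_holomorphic zero_free) auto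
    show "norm (R i j z) \<le> fact CARD('p) * entry_bound ^ CARD('p) / m'"
      if z: "a \<le> Re z" "Re z \<le> c" "T \<le> \<bar>Im z\<bar>" for z
    proof -
      have l: "m' \<le> norm (char_det z)" using z a a' by (intro low[rule_format]) auto
      then have nz: "char_det z \<noteq> 0" using \<delta>(2) by auto
      have cof: "norm (det (cofactor_matrix (mat 1 - laplace \<mu> z) i j)) \<le> fact CARD('p) * entry_bound ^ CARD('p)"
        using z a \<sigma>a' by (intro cofactor_norm_le) linarith
      show ?thesis
        unfolding R_def inverse_entry[OF nz] norm_divide
        by (rule frac_le[OF order_trans[OF norm_ge_zero cof] cof \<delta>(2) l])
    qed
    show "R i j (Complex c x) = (LINT y:{0..}|birth_measure i j. exp (- Complex c x * complex_of_real y))" for x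
    proof -
      have "s1 < Re (Complex c x)" using c by simp
      from matrix_inv_unique_left(2)[OF inv_eq[OF this]]
      have "R i j (Complex c x) = laplace birth_measure (Complex c x) $ i $ j" unfolding R_def by (rule arg_cong)
      then show ?thesis by (simp add: laplace_def)
    qed
  qed
  define K where "K i j = (SOME K. \<forall>t\<ge>1. norm (complex_of_real (measure (birth_measure i j) {0..t})
      - (\<Sum>p\<in>pts. residue (\<lambda>z. exp (z * complex_of_real t) * R i j z / z) p)) \<le> K * t * exp (a * t))" for i j
  have K: "\<forall>t\<ge>1. norm (complex_of_real (measure (birth_measure i j) {0..t})
      - (\<Sum>p\<in>pts. residue (\<lambda>z. exp (z * complex_of_real t) * R i j z / z) p)) \<le> K i j * t * exp (a * t)" for i j
    unfolding K_def by (rule someI_ex[OF K_ex])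
  have pts_strip: "\<sigma> < Re p" "p \<noteq> 0 \<Longrightarrow> char_det p = 0" if "p \<in> pts" for p
    using that a_neg a0 \<sigma>a' a \<sigma> by (auto simp: pts_def \<Lambda>_iff split: if_splits)
  define cf where "cf i j p = (SOME c. \<forall>t::real. residue (\<lambda>z. exp (z * complex_of_real t) * R i j z / z) p
     = exp (p * complex_of_real t) * (\<Sum>k<pole_order \<mu> p + (if p = 0 then 1 else 0). complex_of_real t ^ k * c k))" for i j p
  have wit: "\<sigma> < Re (complex_of_real c)" "char_det (complex_of_real c) \<noteq> 0"
    using c \<sigma> nz1 by auto
  have cf: "residue (\<lambda>z. exp (z * complex_of_real t) * R i j z / z) p
     = exp (p * complex_of_real t) * (\<Sum>k<pole_order \<mu> p + (if p = 0 then 1 else 0). complex_of_real t ^ k * cf i j p k)"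
    if "p \<in> pts" for i j p and t :: real
  proof -
    from residue_expansion[OF pts_strip(1)[OF that] wit pts_strip(2)[OF that], of i j]
    show ?thesis unfolding R_def[symmetric] cf_def by (rule someI_ex[THEN spec])
  qed
  \<comment> \<open>The default 0 outside \<open>pts\<close> makes the separate term at 0 vanish
    when the contour shift does not cross 0.\<close>
  define C :: "complex \<Rightarrow> nat \<Rightarrow> complex^'p^'p" where "C l k = (\<chi> i j. if l \<in> pts then cf i j l k else 0)" for l k
  have sum_eq: "(\<Sum>p\<in>pts. residue (\<lambda>z. exp (z * complex_of_real t) * R i j z / z) p)
     = (\<Sum>l\<in>?\<Lambda>. exp (l * complex_of_real t) * (\<Sum>k<pole_order \<mu> l. complex_of_real t ^ k * C l k $ i $ j))
       + complex_of_real t ^ pole_order \<mu> 0 * C 0 (pole_order \<mu> 0) $ i $ j" for i j and t :: real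
  proof -
    have "(\<Sum>p\<in>pts. residue (\<lambda>z. exp (z * complex_of_real t) * R i j z / z) p)
      = (\<Sum>p\<in>pts. exp (p * complex_of_real t) * (\<Sum>k<pole_order \<mu> p + (if p = 0 then 1 else 0). complex_of_real t ^ k * C p k $ i $ j))"
    proof (intro sum.cong refl)
      fix p assume p: "p \<in> pts"
      have "C p k $ i $ j = cf i j p k" for k using p by (simp add: C_def)
      then show "residue (\<lambda>z. exp (z * complex_of_real t) * R i j z / z) p
        = exp (p * complex_of_real t) * (\<Sum>k<pole_order \<mu> p + (if p = 0 then 1 else 0). complex_of_real t ^ k * C p k $ i $ j)"
        using cf[OF p, of t i j] by (simp only:)
    qed
    also have "\<dots> = (\<Sum>l\<in>?\<Lambda>. exp (l * complex_of_real t) * (\<Sum>k<pole_order \<mu> l. complex_of_real t ^ k * C l k $ i $ j))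
       + complex_of_real t ^ pole_order \<mu> 0 * C 0 (pole_order \<mu> 0) $ i $ j"
    proof (rule exponential_sum_rearrange)
      show "finite pts" using assms(9) by (simp add: pts_def)
      show "?\<Lambda> \<subseteq> pts" "pts \<subseteq> insert 0 ?\<Lambda>" by (auto simp: pts_def)
      \<comment> \<open>Here \<open>a\<close> is negative, so 0 lies in the strip whose only zeros
        of the determinant are the elements of \<Lambda>; hence 0 is not a root at all, also when
        \<theta> = 0.\<close>
      show "pole_order \<mu> 0 = 0" if "0 \<in> pts" "0 \<notin> ?\<Lambda>"
      proof -
        have "a < 0" using that by (auto simp: pts_def split: if_splits)
        then have "char_det 0 \<noteq> 0" using a that by (intro zero_free) auto
        moreover have "\<sigma> \<le> Re 0" using \<open>a < 0\<close> a_neg pts_strip(1)[OF that(1)] by simp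
        ultimately show ?thesis by (simp add: pole_order_def mem_roots_iff)
      qed
      show "C 0 (pole_order \<mu> 0) $ i $ j = 0" if "0 \<notin> pts" using that by (simp add: C_def)
    qed
    finally show ?thesis .
  qed
  have mm: "mean_matrix P \<xi>c t $ i $ j = measure (birth_measure i j) {0..t}" for t i j
    unfolding mean_matrix_def vec_lambda_beta measure_def emeasure_birth_measure ..
  have "(\<lambda>t. complex_of_real (mean_matrix P \<xi>c t $ i $ j)
            - ((\<Sum>l\<in>?\<Lambda>. exp (l * complex_of_real t) *
                  (\<Sum>k<pole_order \<mu> l. complex_of_real t ^ k * C l k $ i $ j))
               + complex_of_real t ^ pole_order \<mu> 0 * C 0 (pole_order \<mu> 0) $ i $ j))
       \<in> O[at_top](\<lambda>t. complex_of_real (t * exp (\<theta> * t)))" for i j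
    unfolding mm sum_eq[symmetric]
  proof (rule bigoI[where c="\<bar>K i j\<bar>"])
    show "\<forall>\<^sub>F t in at_top. norm (complex_of_real (measure (birth_measure i j) {0..t})
        - (\<Sum>p\<in>pts. residue (\<lambda>z. exp (z * complex_of_real t) * R i j z / z) p)) \<le> \<bar>K i j\<bar> * norm (complex_of_real (t * exp (\<theta> * t)))"
      using eventually_ge_at_top[of "1::real"]
    proof eventually_elim
      case (elim t)
      have "K i j * t * exp (a * t) \<le> \<bar>K i j\<bar> * t * exp (\<theta> * t)"
        using elim a by (intro mult_mono) auto
      moreover have "norm (complex_of_real (t * exp (\<theta> * t))) = t * exp (\<theta> * t)"
        using elim unfolding norm_of_real by simp
      ultimately show ?case using K[rule_format, OF elim, of i j] by simp
    qed
  qed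
  then show ?thesis using expected_finite by blast
qed

end
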